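(* Let $k\ge 2$ be a fixed integer, let $\alpha\in(0,1)$ be fixed, and set $$K=K_{\alpha,k}=\frac{k!\,(k-1)!}{\alpha^{k-1}}.$$ For each $n$, choose each element of $\{0,1,\ldots,n\}$ to be in a random set $\mathcal{A}$ independently with probability $p=p_n$. Let $X=X_n$ be the number of integers $j\in[\alpha n,(k-\alpha)n]$ that cannot be written as $j=x_1+\cdots+x_k$ with $x_1,\ldots,x_k\in\mathcal{A}$ (repetitions allowed). (a) If $$p=\sqrt[k]{\frac{K\log n-K\log\log n+A_n}{n^{k-1}}},\qquad |A_n|=o(\log\log n),$$ then, as $n\to\infty$, $$\mathbb{P}(\mathcal{A}\text{ is a truncated }k\text{-basis})\to\begin{cases}0 & \text{if }A_n\to-\infty,\\ 1 & \text{if }A_n\to\infty,\\ \exp\left\{-\frac{2\alpha}{k-1}e^{-A/K}\right\} & \text{if }A_n\to A\in\mathbb{R}.\end{cases}$$ (b) If $$p=\sqrt[k]{\frac{\beta K\log n}{n^{k-1}}}$$ with $\beta>(k-1)/k$ a constant, and $Y=Y_n$ is a Poisson random variable with mean $\mathbb{E}(X)$, then $d_{TV}(X,Y)\to 0$ as $n\to\infty$.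
   Context: A set $\mathcal{A}\subseteq\{0,1,\ldots,n\}$ is a truncated $k$-basis (with parameter $\alpha\in(0,1)$) if every integer $j\in[\alpha n,(k-\alpha)n]$ can be written as $j=x_1+\cdots+x_k$ with $x_1,\ldots,x_k\in\mathcal{A}$, repetitions allowed. Thus $\mathcal{A}$ is a truncated $k$-basis if and only if $X=0$. For nonnegative-integer-valued random variables $X,Y$, the total variation distance between their distributions is $d_{TV}(X,Y)=\sup_{B\subseteq\mathbb{Z}_{\ge 0}}|\mathbb{P}(X\in B)-\mathbb{P}(Y\in B)|$. The number $p_n$ is considered for $n$ large enough that it is a well-defined probability in $[0,1]$. *)

theory Defs
  imports
    "HOL-Probability.Probability"
    "HOL-Probability.Product_PMF"
    "HOL-Library.Landau_Symbols"
begin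

definition is_k_sum :: "nat \<Rightarrow> nat set \<Rightarrow> nat \<Rightarrow> bool" where
  "is_k_sum k S j \<longleftrightarrow> (\<exists>x. (\<forall>i\<in>{1..k}. x i \<in> S) \<and> j = (\<Sum>i=1..k. x i))"

text \<open>
  The integers in the interval from \<open>\<alpha> n\<close> to \<open>(k - \<alpha>) n\<close>. Since \<open>\<alpha>\<close> will always be positive,
  they are all nonnegative, so naturals suffice.
\<close>
definition targets :: "nat \<Rightarrow> real \<Rightarrow> nat \<Rightarrow> nat set" where
  "targets k \<alpha> n = {j. \<alpha> * real n \<le> real j \<and> real j \<le> (real k - \<alpha>) * real n}"

definition truncated_basis :: "nat \<Rightarrow> real \<Rightarrow> nat \<Rightarrow> nat set \<Rightarrow> bool" where
  "truncated_basis k \<alpha> n S \<longleftrightarrow> S \<subseteq> {0..n} \<and> (\<forall>j\<in>targets k \<alpha> n. is_k_sum k S j)"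

definition num_missing :: "nat \<Rightarrow> real \<Rightarrow> nat \<Rightarrow> nat set \<Rightarrow> nat" where
  "num_missing k \<alpha> n S = card {j \<in> targets k \<alpha> n. \<not> is_k_sum k S j}"

text \<open>
  \<^const>\<open>bernoulli_pmf\<close> clamps its parameter to the unit interval, so this law is the intended
  one only for \<open>0 \<le> p \<le> 1\<close>.
\<close>
definition random_subset :: "nat \<Rightarrow> real \<Rightarrow> nat set pmf" where
  "random_subset n p =
     map_pmf (\<lambda>f. {x \<in> {0..n}. f x}) (Pi_pmf {0..n} False (\<lambda>_. bernoulli_pmf p))"

definition tv_dist :: "nat pmf \<Rightarrow> nat pmf \<Rightarrow> real" where
  "tv_dist P Q = (SUP B. \<bar>measure_pmf.prob P B - measure_pmf.prob Q B\<bar>)"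

lemma finite_targets [simp]: "finite (targets k \<alpha> n)"
proof (rule finite_subset)
  show "targets k \<alpha> n \<subseteq> {..nat \<lfloor>(real k - \<alpha>) * real n\<rfloor>}"
    by (auto simp: targets_def le_nat_floor)
qed simp

lemma truncated_basis_iff_num_missing_eq_0:
  assumes "S \<subseteq> {0..n}"
  shows "truncated_basis k \<alpha> n S \<longleftrightarrow> num_missing k \<alpha> n S = 0"
  using assms by (auto simp: truncated_basis_def num_missing_def)

end

theory Submission
  imports Defs "HOL-Combinatorics.Multiset_Permutations" "HOL-Real_Asymp.Real_Asymp"
begin

text \<open>
  A target \<open>j\<close> is missed exactly when \<open>\<A>\<close> contains none of the \<^emph>\<open>supports\<close> of \<open>j\<close>, the sets of
  values of the \<open>k\<close>-tuples with sum \<open>j\<close>. Let \<open>R\<^sub>j\<close> be the number of these tuples in \<open>{0..n}\<close>, let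
  \<open>\<lambda>\<^sub>j = p^k R\<^sub>j / k!\<close>, which is nearly the expected number of supports inside \<open>\<A>\<close>, and write
  \<open>x = (n + 1) p\<close> and \<open>\<epsilon> = x^(2k-1) / (n + 1)^2\<close>. At the densities of the theorem, \<open>\<epsilon>\<close> is
  \<open>n^(-1/k)\<close> up to powers of \<open>log n\<close>.

  \<^emph>\<open>One or two targets.\<close> If the events \<open>S \<subseteq> \<A>\<close> were independent, \<open>j\<close> would be missed with
  probability \<open>\<Prod>\<^sub>S (1 - p^|S|)\<close>. Harris' inequality (\<open>harris_inequality\<close>) makes this product a
  lower bound, and Janson's inequality (\<open>janson_inequality\<close>) makes it an upper bound up to the
  exponential of the sum of \<open>p^|S \<union> T|\<close> over overlapping pairs of supports. Two supports that share
  an element have at most \<open>2k - 1\<close> elements altogether, and these satisfy two linear equations, so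
  that the sum is \<open>O(\<epsilon>)\<close>; supports with fewer than \<open>k\<close> elements also contribute \<open>O(\<epsilon>)\<close> only.
  Hence \<open>P(j missed) = exp (-\<lambda>\<^sub>j + O(\<epsilon>))\<close> uniformly in \<open>j\<close> (\<open>miss_prob_upper\<close>, \<open>miss_prob_lower\<close>). The same argument for the supports of two
  targets together gives \<open>P(i and j missed) \<le> P(i missed) P(j missed) exp (O(\<epsilon>))\<close>
  (\<open>miss_both_upper\<close>).

  \<^emph>\<open>Poisson approximation.\<close> Being missed is a decreasing property of \<open>\<A>\<close>, so the indicators of
  missed targets are positively correlated, and Stein's method bounds the distance of \<open>X\<close> from the
  Poisson law with mean \<open>\<mu> = E X\<close> by \<open>1/\<mu>\<close> times the sum of the covariances and of the squared
  probabilities (\<open>poisson_approximation_antitone\<close>). This is at most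
  \<open>max\<^sub>j P(j missed) + O(\<mu> \<epsilon>)\<close>. Every \<open>\<lambda>\<^sub>j\<close> with \<open>j\<close> a target is at least
  \<open>L = p^k n^(k-1) / K\<close>, so if \<open>L \<sim> \<beta> log n\<close> then \<open>\<mu> \<le> n^(1-\<beta>+o(1))\<close>, and
  \<open>\<mu> \<epsilon>\<close> tends to \<open>0\<close> as soon as \<open>1 - \<beta> - 1/k < 0\<close>. This is part (b).

  \<^emph>\<open>The mean.\<close> As a function of \<open>j\<close>, \<open>R\<^sub>j\<close> is symmetric about \<open>k n / 2\<close> and unimodal, and for
  \<open>j \<le> n\<close> it is the number of all compositions of \<open>j\<close>, so that \<open>\<lambda>\<^sub>j\<close> is very nearly
  \<open>L (j / (\<alpha> n))^(k-1)\<close>. Starting from \<open>j = \<alpha> n\<close>, \<open>exp (-\<lambda>\<^sub>j)\<close> decays like a geometric sequence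
  with first term \<open>exp (-L)\<close> and ratio \<open>exp (-(k-1) L / (\<alpha> n))\<close>; each of the two ends of the target
  interval therefore contributes \<open>exp (-L) \<alpha> n / ((k-1) L)\<close> asymptotically, and the middle is
  negligible (\<open>mean_asymptotics\<close>). In part (a), \<open>L = log n - log log n + A\<^sub>n / K\<close>, which turns
  this into \<open>\<mu> \<sim> 2\<alpha>/(k-1) exp (-A\<^sub>n / K)\<close>, and \<open>P(X = 0) = exp (-\<mu>) + o(1)\<close> by the Poisson
  approximation with \<open>\<beta> = 1\<close>.
\<close>

section \<open>Expectations over random subsets\<close>

text \<open>
  The expectation of \<open>f\<close> over a subset of \<open>V\<close> that contains each element independently with
  probability \<open>p\<close>. A finite sum is more convenient here than an integral over a probability
  mass function: adding one point to \<open>V\<close> gives a recursion on which all later inductions run.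
\<close>
definition subset_exp :: "real \<Rightarrow> 'a set \<Rightarrow> ('a set \<Rightarrow> real) \<Rightarrow> real" where
  "subset_exp p V f = (\<Sum>A\<in>Pow V. p ^ card A * (1 - p) ^ card (V - A) * f A)"

lemma subset_exp_empty [simp]: "subset_exp p {} f = f {}"
  by (simp add: subset_exp_def)

lemma subset_exp_insert:
  assumes "finite V" "x \<notin> V"
  shows "subset_exp p (insert x V) f =
           p * subset_exp p V (\<lambda>A. f (insert x A)) + (1 - p) * subset_exp p V f"
proof -
  have inj: "inj_on (insert x) (Pow V)"
    using assms(2) by (auto simp: inj_on_def)
  have 1: "p ^ card (insert x A) * (1 - p) ^ card (insert x V - insert x A) * f (insert x A)
       = p * (p ^ card A * (1 - p) ^ card (V - A) * f (insert x A))" if "A \<in> Pow V" for A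
  proof -
    have "finite A" "x \<notin> A" "insert x V - insert x A = V - A"
      using that assms by (auto intro: finite_subset)
    then show ?thesis by simp
  qed
  have 2: "p ^ card A * (1 - p) ^ card (insert x V - A) * f A
       = (1 - p) * (p ^ card A * (1 - p) ^ card (V - A) * f A)" if "A \<in> Pow V" for A
  proof -
    have "insert x V - A = insert x (V - A)" "finite (V - A)" "x \<notin> V - A"
      using that assms by auto
    then show ?thesis by simp
  qed
  have "subset_exp p (insert x V) f =
     (\<Sum>A\<in>insert x ` Pow V. p ^ card A * (1 - p) ^ card (insert x V - A) * f A)
   + (\<Sum>A\<in>Pow V. p ^ card A * (1 - p) ^ card (insert x V - A) * f A)"
    unfolding subset_exp_def Pow_insert using assms
    by (subst sum.union_disjoint) auto
  then show ?thesis
    unfolding subset_exp_def sum.reindex[OF inj] sum_distrib_left o_def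
    using sum.cong[OF refl 1, of "Pow V"] sum.cong[OF refl 2, of "Pow V"] by simp
qed

lemma subset_exp_const: "finite V \<Longrightarrow> subset_exp p V (\<lambda>_. c) = c"
  by (induction V rule: finite_induct) (simp_all add: subset_exp_insert algebra_simps)

lemma subset_exp_mono:
  assumes "0 \<le> p" "p \<le> 1" "\<And>A. A \<subseteq> V \<Longrightarrow> f A \<le> g A"
  shows "subset_exp p V f \<le> subset_exp p V g"
  unfolding subset_exp_def using assms by (intro sum_mono mult_left_mono) auto

lemma subset_exp_cong:
  "(\<And>A. A \<subseteq> V \<Longrightarrow> f A = g A) \<Longrightarrow> subset_exp p V f = subset_exp p V g"
  unfolding subset_exp_def by (intro sum.cong) auto

lemma subset_exp_nonneg:
  assumes "0 \<le> p" "p \<le> 1" "\<And>A. A \<subseteq> V \<Longrightarrow> 0 \<le> f A"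
  shows "0 \<le> subset_exp p V f"
  unfolding subset_exp_def using assms by (intro sum_nonneg) auto

lemma subset_exp_diff:
  "subset_exp p V (\<lambda>A. f A - g A) = subset_exp p V f - subset_exp p V g"
  by (simp add: subset_exp_def algebra_simps sum_subtractf)

lemma subset_exp_cmult:
  "subset_exp p V (\<lambda>A. c * f A) = c * subset_exp p V f"
  by (simp add: subset_exp_def algebra_simps sum_distrib_left)

lemma subset_exp_sum:
  "subset_exp p V (\<lambda>A. \<Sum>i\<in>I. f i A) = (\<Sum>i\<in>I. subset_exp p V (f i))"
  unfolding subset_exp_def sum_distrib_left by (rule sum.swap)

lemma expectation_Pi_bernoulli:
  assumes "finite V" "0 \<le> p" "p \<le> 1"
  shows "measure_pmf.expectation
           (map_pmf (\<lambda>f. {x \<in> V. f x}) (Pi_pmf V False (\<lambda>_. bernoulli_pmf p))) g = subset_exp p V g"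
  using assms(1)
proof (induction V arbitrary: g rule: finite_induct)
  case empty
  then show ?case by simp
next
  case (insert x V)
  let ?P = "Pi_pmf V False (\<lambda>_. bernoulli_pmf p)"
  let ?D = "map_pmf (\<lambda>f. {x \<in> V. f x}) ?P"
  have fin: "finite (set_pmf ?D)"
    by (rule finite_subset[of _ "Pow V"]) (use insert in auto)
  have *: "{y \<in> insert x V. (f(x := b)) y} = (if b then insert x {y \<in> V. f y} else {y \<in> V. f y})"
    for f and b using insert.hyps by auto
  have "map_pmf (\<lambda>f. {y \<in> insert x V. f y}) (Pi_pmf (insert x V) False (\<lambda>_. bernoulli_pmf p))
     = bind_pmf (bernoulli_pmf p) (\<lambda>b. map_pmf (\<lambda>A. if b then insert x A else A) ?D)"
    unfolding Pi_pmf_insert[OF insert.hyps(1,2)]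
    unfolding pair_pmf_def map_pmf_def bind_assoc_pmf bind_return_pmf split_conv *
    by (intro bind_pmf_cong refl arg_cong[of _ _ return_pmf])
  also have "measure_pmf.expectation \<dots> g =
     measure_pmf.expectation (bernoulli_pmf p)
       (\<lambda>b. measure_pmf.expectation ?D (\<lambda>A. g (if b then insert x A else A)))"
    using fin by (subst pmf_expectation_bind[where A = UNIV])
      (auto simp: integral_measure_pmf_real[where A=UNIV] mult.commute)
  also have "\<dots> = p * subset_exp p V (\<lambda>A. g (insert x A)) + (1 - p) * subset_exp p V g"
    using assms insert.IH insert.IH[of "\<lambda>A. g (insert x A)"] by (simp add: mult.commute)
  finally show ?case
    by (simp add: subset_exp_insert insert.hyps)
qed

lemma expectation_random_subset:
  assumes "0 \<le> p" "p \<le> 1"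
  shows "measure_pmf.expectation (random_subset n p) g = subset_exp p {0..n} g"
  unfolding random_subset_def by (rule expectation_Pi_bernoulli) (use assms in auto)

lemma prob_random_subset:
  assumes "0 \<le> p" "p \<le> 1"
  shows "measure_pmf.prob (random_subset n p) {S. Q S} = subset_exp p {0..n} (\<lambda>S. of_bool (Q S))"
proof -
  have "measure_pmf.prob (random_subset n p) {S. Q S}
      = measure_pmf.expectation (random_subset n p) (indicat_real {S. Q S})"
    by simp
  also have "indicat_real {S. Q S} = (\<lambda>S. of_bool (Q S))"
    by (auto simp: indicator_def)
  finally show ?thesis using expectation_random_subset[OF assms] by simp
qed

section \<open>Correlation inequalities\<close>

text \<open>
  Induction on the ground set. Conditioned on whether the new point \<open>x\<close> is present, the induction
  hypothesis applies to both \<open>f\<close> and \<open>g\<close>; the two conditional means of \<open>f\<close> and of \<open>g\<close> are ordered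
  in the same way, so averaging over \<open>x\<close> can only help (Chebyshev's inequality on two points).
\<close>
theorem harris_inequality:
  assumes "finite V" "0 \<le> p" "p \<le> 1"
    and "\<And>A B. A \<subseteq> B \<Longrightarrow> B \<subseteq> V \<Longrightarrow> f A \<le> f B"
    and "\<And>A B. A \<subseteq> B \<Longrightarrow> B \<subseteq> V \<Longrightarrow> g A \<le> g B"
  shows "subset_exp p V f * subset_exp p V g \<le> subset_exp p V (\<lambda>A. f A * g A)"
  using assms(1,4,5)
proof (induction V arbitrary: f g rule: finite_induct)
  case empty
  then show ?case by simp
next
  case (insert x V)
  let ?E = "subset_exp p V"
  let ?f1 = "\<lambda>A. f (insert x A)" and ?g1 = "\<lambda>A. g (insert x A)"
  have 1: "?E ?f1 * ?E ?g1 \<le> ?E (\<lambda>A. ?f1 A * ?g1 A)"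
    by (rule insert.IH) (rule insert.prems; blast)+
  have 0: "?E f * ?E g \<le> ?E (\<lambda>A. f A * g A)"
    by (rule insert.IH) (rule insert.prems; blast)+
  have "?E f \<le> ?E ?f1" "?E g \<le> ?E ?g1"
    by (rule subset_exp_mono; (rule assms insert.prems; blast)?)+
  then have "0 \<le> p * (1 - p) * ((?E ?f1 - ?E f) * (?E ?g1 - ?E g))"
    using assms(2,3) by (intro mult_nonneg_nonneg) auto
  moreover have "p * (?E ?f1 * ?E ?g1) + (1 - p) * (?E f * ?E g)
     \<le> p * ?E (\<lambda>A. ?f1 A * ?g1 A) + (1 - p) * ?E (\<lambda>A. f A * g A)"
    using 0 1 assms(2,3) by (intro add_mono mult_left_mono) auto
  ultimately have "(p * ?E ?f1 + (1 - p) * ?E f) * (p * ?E ?g1 + (1 - p) * ?E g)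
    \<le> p * ?E (\<lambda>A. ?f1 A * ?g1 A) + (1 - p) * ?E (\<lambda>A. f A * g A)"
    by (simp add: algebra_simps)
  then show ?case
    by (simp only: subset_exp_insert[OF insert.hyps])
qed

corollary harris_inequality_antitone:
  assumes "finite V" "0 \<le> p" "p \<le> 1"
    and "\<And>A B. A \<subseteq> B \<Longrightarrow> B \<subseteq> V \<Longrightarrow> f B \<le> f A"
    and "\<And>A B. A \<subseteq> B \<Longrightarrow> B \<subseteq> V \<Longrightarrow> g B \<le> g A"
  shows "subset_exp p V f * subset_exp p V g \<le> subset_exp p V (\<lambda>A. f A * g A)"
  using harris_inequality[of V p "\<lambda>A. -1 * f A" "\<lambda>A. -1 * g A"] assms
  unfolding subset_exp_cmult by simp

corollary harris_inequality_opposite: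
  assumes "finite V" "0 \<le> p" "p \<le> 1"
    and "\<And>A B. A \<subseteq> B \<Longrightarrow> B \<subseteq> V \<Longrightarrow> f A \<le> f B"
    and "\<And>A B. A \<subseteq> B \<Longrightarrow> B \<subseteq> V \<Longrightarrow> g B \<le> g A"
  shows "subset_exp p V (\<lambda>A. f A * g A) \<le> subset_exp p V f * subset_exp p V g"
proof -
  have *: "subset_exp p V (\<lambda>A. f A * (-1 * g A)) = - subset_exp p V (\<lambda>A. f A * g A)"
    using subset_exp_cmult[of p V "-1" "\<lambda>A. f A * g A"] by simp
  show ?thesis
    using harris_inequality[of V p f "\<lambda>A. -1 * g A"] assms
    unfolding subset_exp_cmult * by simp
qed

text \<open>
  Conditioned on \<open>S\<close> being contained in the random set, the set is distributed as its union
  with \<open>S\<close>.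
\<close>
lemma subset_exp_contains:
  assumes "finite V" "S \<subseteq> V"
  shows "subset_exp p V (\<lambda>A. of_bool (S \<subseteq> A) * g A) = p ^ card S * subset_exp p V (\<lambda>A. g (A \<union> S))"
proof -
  have one: "subset_exp p V (\<lambda>A. of_bool (x \<in> A) * g A) = p * subset_exp p V (\<lambda>A. g (insert x A))"
    if "x \<in> V" for x and g :: "'a set \<Rightarrow> real"
  proof -
    define V' where "V' = V - {x}"
    have V: "V = insert x V'" "finite V'" "x \<notin> V'" using that assms by (auto simp: V'_def)
    have "subset_exp p V' (\<lambda>A. of_bool (x \<in> A) * g A) = subset_exp p V' (\<lambda>_. 0)"
      by (rule subset_exp_cong) (use V(3) in auto)
    then show ?thesis unfolding V(1)
      by (simp add: subset_exp_insert[OF V(2,3)] subset_exp_const V(2) algebra_simps)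
  qed
  have "finite S" using assms finite_subset by blast
  then show ?thesis using assms(2)
  proof (induction S arbitrary: g rule: finite_induct)
    case empty
    then show ?case by simp
  next
    case (insert x S)
    have "subset_exp p V (\<lambda>A. of_bool (insert x S \<subseteq> A) * g A)
        = subset_exp p V (\<lambda>A. of_bool (x \<in> A) * (of_bool (S \<subseteq> A) * g A))"
      by (rule subset_exp_cong) auto
    also have "\<dots> = p * subset_exp p V (\<lambda>A. of_bool (S \<subseteq> insert x A) * g (insert x A))"
      using insert.prems by (subst one) auto
    also have "\<dots> = p * subset_exp p V (\<lambda>A. of_bool (S \<subseteq> A) * g (insert x A))"
      using insert.hyps by (simp add: subset_insert)
    also have "\<dots> = p * (p ^ card S * subset_exp p V (\<lambda>A. g (A \<union> insert x S)))"
      using insert.IH[of "\<lambda>A. g (insert x A)"] insert.prems by simp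
    finally show ?case using insert.hyps by simp
  qed
qed

lemma subset_exp_contains_const:
  assumes "finite V" "S \<subseteq> V"
  shows "subset_exp p V (\<lambda>A. of_bool (S \<subseteq> A)) = p ^ card S"
  using subset_exp_contains[OF assms, of p "\<lambda>_. 1"] assms by (simp add: subset_exp_const)

definition avoids :: "'a set set \<Rightarrow> 'a set \<Rightarrow> bool" where
  "avoids W A \<longleftrightarrow> (\<forall>S\<in>W. \<not> S \<subseteq> A)"

abbreviation avoid_prob :: "real \<Rightarrow> 'a set \<Rightarrow> 'a set set \<Rightarrow> real" where
  "avoid_prob p V W \<equiv> subset_exp p V (\<lambda>A. of_bool (avoids W A))"

lemma avoids_antimono: "avoids W B \<Longrightarrow> A \<subseteq> B \<Longrightarrow> avoids W A"
  unfolding avoids_def by blast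

lemma avoid_prob_nonneg: "0 \<le> p \<Longrightarrow> p \<le> 1 \<Longrightarrow> 0 \<le> avoid_prob p V W"
  by (rule subset_exp_nonneg) auto

text \<open>
  Avoiding a single set is a decreasing event, so Harris' inequality multiplies the
  probabilities of avoiding the members of \<open>W\<close> one at a time.
\<close>
lemma avoid_prob_lower:
  assumes "finite V" "0 \<le> p" "p \<le> 1" "finite W" "W \<subseteq> Pow V"
  shows "(\<Prod>S\<in>W. 1 - p ^ card S) \<le> avoid_prob p V W"
  using assms(4,5)
proof (induction W rule: finite_induct)
  case empty
  then show ?case using assms by (simp add: avoids_def subset_exp_const)
next
  case (insert S W)
  have one: "avoid_prob p V {S} = 1 - p ^ card S"
  proof -
    have "avoid_prob p V {S} = subset_exp p V (\<lambda>A. 1 - of_bool (S \<subseteq> A))"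
      by (rule subset_exp_cong) (auto simp: avoids_def)
    then show ?thesis using assms insert.prems
      by (simp add: subset_exp_diff subset_exp_const subset_exp_contains_const)
  qed
  have "(\<Prod>S\<in>insert S W. 1 - p ^ card S) = (1 - p ^ card S) * (\<Prod>S\<in>W. 1 - p ^ card S)"
    using insert.hyps by simp
  also have "\<dots> \<le> avoid_prob p V {S} * avoid_prob p V W"
    unfolding one using insert assms by (intro mult_left_mono) (auto simp: power_le_one)
  also have "\<dots> \<le> subset_exp p V (\<lambda>A. of_bool (avoids {S} A) * of_bool (avoids W A))"
    by (rule harris_inequality_antitone) (use assms avoids_antimono in \<open>auto simp: of_bool_def\<close>)
  also have "\<dots> = avoid_prob p V (insert S W)"
    by (rule subset_exp_cong) (auto simp: avoids_def)
  finally show ?case .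
qed

text \<open>
  The Boppana-Spencer step towards Janson's inequality: an upper bound for the probability of
  avoiding \<open>S\<close>, given that all of \<open>W\<close> is avoided. Split \<open>W\<close> into the sets \<open>W0\<close> disjoint from \<open>S\<close> and
  the sets \<open>W1\<close> meeting it. Avoidance of \<open>W0\<close> is independent of \<open>S \<subseteq> A\<close>, and each \<open>T \<in> W1\<close> costs at
  most \<open>p ^ card (S \<union> T)\<close> by Harris' inequality, because containing \<open>S \<union> T\<close> is increasing while
  avoiding \<open>W0\<close> is decreasing.
\<close>
lemma avoid_prob_insert_le:
  assumes "finite V" "0 \<le> p" "p \<le> 1" "finite W" "insert S W \<subseteq> Pow V"
  shows "avoid_prob p V (insert S W) \<le>
    avoid_prob p V W * (1 - p ^ card S + (\<Sum>T\<in>{T\<in>W. T \<inter> S \<noteq> {}}. p ^ card (S \<union> T)))"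
proof -
  let ?E = "subset_exp p V"
  define W0 where "W0 = {T\<in>W. T \<inter> S = {}}"
  define W1 where "W1 = {T\<in>W. T \<inter> S \<noteq> {}}"
  define d where "d = (\<Sum>T\<in>W1. p ^ card (S \<union> T))"
  have fin: "finite W1" using assms by (simp add: W1_def)
  have le: "avoid_prob p V W \<le> avoid_prob p V W0"
    by (rule subset_exp_mono) (use assms in \<open>auto simp: W0_def avoids_def\<close>)
  have SW0: "?E (\<lambda>A. of_bool (S \<subseteq> A) * of_bool (avoids W0 A)) = p ^ card S * avoid_prob p V W0"
  proof -
    have "?E (\<lambda>A. of_bool (avoids W0 (A \<union> S))) = avoid_prob p V W0"
      by (rule subset_exp_cong, rule arg_cong[of _ _ of_bool]) (auto simp: W0_def avoids_def)
    then show ?thesis using assms by (subst subset_exp_contains) auto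
  qed
  have STW0: "?E (\<lambda>A. of_bool (S \<union> T \<subseteq> A) * of_bool (avoids W0 A))
      \<le> p ^ card (S \<union> T) * avoid_prob p V W0" if "T \<in> W1" for T
  proof -
    have "?E (\<lambda>A. of_bool (S \<union> T \<subseteq> A) * of_bool (avoids W0 A))
       \<le> ?E (\<lambda>A. of_bool (S \<union> T \<subseteq> A)) * avoid_prob p V W0"
      by (rule harris_inequality_opposite)
         (use assms avoids_antimono in \<open>auto simp: of_bool_def\<close>)
    then show ?thesis using that assms
      by (subst (asm) subset_exp_contains_const) (auto simp: W1_def)
  qed
  \<comment> \<open>Given avoidance of \<open>W0\<close>, avoidance of \<open>W\<close> can fail only through some \<open>T \<in> W1\<close>: a union bound.\<close>
  have pt: "of_bool (S \<subseteq> A) * of_bool (avoids W0 A)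
     - (\<Sum>T\<in>W1. of_bool (S \<union> T \<subseteq> A) * of_bool (avoids W0 A))
     \<le> (of_bool (S \<subseteq> A) * of_bool (avoids W A) :: real)" for A
  proof (cases "S \<subseteq> A \<and> avoids W0 A \<and> \<not> avoids W A")
    case True
    then obtain T where T: "T \<in> W1" "T \<subseteq> A"
      unfolding avoids_def W0_def W1_def by blast
    then have "(1::real) \<le> (\<Sum>T\<in>W1. of_bool (S \<union> T \<subseteq> A) * of_bool (avoids W0 A))"
      using True fin member_le_sum[of T W1 "\<lambda>T. of_bool (S \<union> T \<subseteq> A) * of_bool (avoids W0 A) :: real"]
      by auto
    then show ?thesis using True by simp
  next
    case False
    have "(0::real) \<le> (\<Sum>T\<in>W1. of_bool (S \<union> T \<subseteq> A) * of_bool (avoids W0 A))"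
      by (intro sum_nonneg) auto
    then show ?thesis using False by auto
  qed
  have lower: "(p ^ card S - d) * avoid_prob p V W
     \<le> ?E (\<lambda>A. of_bool (S \<subseteq> A) * of_bool (avoids W A))"
  proof (cases "p ^ card S - d \<ge> 0")
    case True
    have "(p ^ card S - d) * avoid_prob p V W \<le> (p ^ card S - d) * avoid_prob p V W0"
      using True le by (rule mult_left_mono[rotated])
    also have "\<dots> = p ^ card S * avoid_prob p V W0 - (\<Sum>T\<in>W1. p ^ card (S \<union> T) * avoid_prob p V W0)"
      by (simp add: d_def algebra_simps sum_distrib_left)
    also have "\<dots> \<le> ?E (\<lambda>A. of_bool (S \<subseteq> A) * of_bool (avoids W0 A))
       - (\<Sum>T\<in>W1. ?E (\<lambda>A. of_bool (S \<union> T \<subseteq> A) * of_bool (avoids W0 A)))"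
      unfolding SW0 by (intro diff_mono sum_mono STW0) auto
    also have "\<dots> = ?E (\<lambda>A. of_bool (S \<subseteq> A) * of_bool (avoids W0 A)
     - (\<Sum>T\<in>W1. of_bool (S \<union> T \<subseteq> A) * of_bool (avoids W0 A)))"
      by (simp add: subset_exp_diff subset_exp_sum)
    also have "\<dots> \<le> ?E (\<lambda>A. of_bool (S \<subseteq> A) * of_bool (avoids W A))"
      by (rule subset_exp_mono[OF assms(2,3)]) (rule pt)
    finally show ?thesis .
  next
    case False
    then have "(p ^ card S - d) * avoid_prob p V W \<le> 0"
      using avoid_prob_nonneg[OF assms(2,3), of V W] by (intro mult_nonpos_nonneg) auto
    also have "0 \<le> ?E (\<lambda>A. of_bool (S \<subseteq> A) * of_bool (avoids W A))"
      by (rule subset_exp_nonneg) (use assms in auto)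
    finally show ?thesis .
  qed
  have "avoid_prob p V (insert S W) =
     ?E (\<lambda>A. of_bool (avoids W A) - of_bool (S \<subseteq> A) * of_bool (avoids W A))"
    by (rule subset_exp_cong) (auto simp: avoids_def)
  also have "\<dots> = avoid_prob p V W - ?E (\<lambda>A. of_bool (S \<subseteq> A) * of_bool (avoids W A))"
    by (simp add: subset_exp_diff)
  also have "\<dots> \<le> avoid_prob p V W * (1 - p ^ card S + d)"
    using lower by (simp add: algebra_simps)
  finally show ?thesis by (simp add: d_def W1_def)
qed

text \<open>
  Ordered pairs: each unordered pair of overlapping sets is counted twice, which costs only a
  constant factor in the exponent.
\<close>
definition overlaps :: "'a set set \<Rightarrow> ('a set \<times> 'a set) set" where
  "overlaps W = {(S, T). S \<in> W \<and> T \<in> W \<and> S \<noteq> T \<and> S \<inter> T \<noteq> {}}"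

lemma finite_overlaps: "finite W \<Longrightarrow> finite (overlaps W)"
  by (rule finite_subset[of _ "W \<times> W"]) (auto simp: overlaps_def)

text \<open>
  Iterating the previous lemma gives a product of factors \<open>1 - p ^ card S + d\<close>. As \<open>p \<le> 1/2\<close>
  and \<open>S\<close> is nonempty, \<open>1 - p ^ card S \<ge> 1/2\<close>, so such a factor is at most
  \<open>(1 - p ^ card S) (1 + 2 d)\<close>. Keeping the exact product in front makes the upper bound directly
  comparable with the lower bound from Harris' inequality.
\<close>
theorem janson_inequality:
  assumes "finite V" "0 \<le> p" "p \<le> 1/2" "finite W" "W \<subseteq> Pow V" "{} \<notin> W"
  shows "avoid_prob p V W \<le>
    (\<Prod>S\<in>W. 1 - p ^ card S) * exp (2 * (\<Sum>(S, T)\<in>overlaps W. p ^ card (S \<union> T)))"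
  using assms(4-6)
proof (induction W rule: finite_induct)
  case empty
  then show ?case using assms by (simp add: avoids_def subset_exp_const overlaps_def)
next
  case (insert S W)
  let ?D = "\<lambda>W. \<Sum>(S, T)\<in>overlaps W. p ^ card (S \<union> T)"
  let ?P = "\<Prod>S\<in>W. 1 - p ^ card S"
  define d where "d = (\<Sum>T\<in>{T\<in>W. T \<inter> S \<noteq> {}}. p ^ card (S \<union> T))"
  have "card S > 0" using insert.prems assms(1) finite_subset by (auto simp: card_gt_0_iff)
  then have "p ^ card S \<le> p ^ 1" using assms by (intro power_decreasing) auto
  then have half: "1 - p ^ card S \<ge> 1/2" using assms by simp
  have d0: "d \<ge> 0" unfolding d_def using assms by (intro sum_nonneg) auto
  have "1 - p ^ card S + d \<le> (1 - p ^ card S) * (1 + 2 * d)"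
    using half mult_right_mono[OF half, of "2*d"] d0 by (simp add: algebra_simps)
  also have "\<dots> \<le> (1 - p ^ card S) * exp (2 * d)"
    using half by (intro mult_left_mono exp_ge_add_one_self) auto
  finally have step: "1 - p ^ card S + d \<le> (1 - p ^ card S) * exp (2 * d)" .
  have D: "?D W + d \<le> ?D (insert S W)"
  proof -
    have "d = (\<Sum>(S, T)\<in>Pair S ` {T\<in>W. T \<inter> S \<noteq> {}}. p ^ card (S \<union> T))"
      unfolding d_def by (subst sum.reindex) (auto simp: inj_on_def)
    moreover have "overlaps W \<inter> Pair S ` {T\<in>W. T \<inter> S \<noteq> {}} = {}"
      using insert.hyps by (auto simp: overlaps_def)
    ultimately have "?D W + d = (\<Sum>(S, T)\<in>overlaps W \<union> Pair S ` {T\<in>W. T \<inter> S \<noteq> {}}. p ^ card (S \<union> T))"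
      using insert.hyps by (subst sum.union_disjoint) (auto simp: finite_overlaps)
    also have "\<dots> \<le> ?D (insert S W)"
      using insert.hyps assms by (intro sum_mono2 finite_overlaps) (auto simp: overlaps_def)
    finally show ?thesis .
  qed
  have P0: "0 \<le> ?P" using assms by (intro prod_nonneg) (auto simp: power_le_one)
  have "avoid_prob p V (insert S W) \<le> avoid_prob p V W * (1 - p ^ card S + d)"
    unfolding d_def by (rule avoid_prob_insert_le) (use assms insert in auto)
  also have "\<dots> \<le> avoid_prob p V W * ((1 - p ^ card S) * exp (2 * d))"
    by (rule mult_left_mono[OF step avoid_prob_nonneg]) (use assms in auto)
  also have "\<dots> \<le> (?P * exp (2 * ?D W)) * ((1 - p ^ card S) * exp (2 * d))"
    using insert half by (intro mult_right_mono) auto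
  also have "\<dots> = ((1 - p ^ card S) * ?P) * exp (2 * (?D W + d))"
    by (simp add: exp_add algebra_simps)
  also have "\<dots> \<le> ((1 - p ^ card S) * ?P) * exp (2 * ?D (insert S W))"
    using D P0 half by (intro mult_left_mono) auto
  finally show ?case using insert.hyps by simp
qed

section \<open>Poisson approximation by Stein's method\<close>

definition stein_num :: "real \<Rightarrow> nat set \<Rightarrow> nat \<Rightarrow> real" where
  "stein_num r B w = (\<Sum>i\<le>w. pmf (poisson_pmf r) i * (of_bool (i \<in> B) - measure_pmf.prob (poisson_pmf r) B))"

text \<open>
  The solution of Stein's equation for the Poisson law with mean \<open>r\<close> and the test set \<open>B\<close>. At \<open>0\<close>,
  where the equation leaves the value free, truncated subtraction repeats the value at \<open>1\<close>.
\<close>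
definition stein_sol :: "real \<Rightarrow> nat set \<Rightarrow> nat \<Rightarrow> real" where
  "stein_sol r B m = stein_num r B (m - 1) / (r * pmf (poisson_pmf r) (m - 1))"

text \<open>
  This recurrence characterises the Poisson weights; the two tail comparisons below sum it over \<open>i\<close>.
\<close>
lemma pmf_poisson_Suc:
  assumes "0 < r" shows "real (Suc i) * pmf (poisson_pmf r) (Suc i) = r * pmf (poisson_pmf r) i"
  using assms by (simp add: field_simps del: of_nat_Suc)

lemma stein_equation:
  assumes "0 < r"
  shows "r * stein_sol r B (w + 1) - real w * stein_sol r B w
       = of_bool (w \<in> B) - measure_pmf.prob (poisson_pmf r) B"
proof (cases w)
  case 0
  then show ?thesis using assms by (simp add: stein_sol_def stein_num_def field_simps)
next
  case (Suc v)
  let ?q = "pmf (poisson_pmf r)"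
  have q: "?q w > 0" "?q v > 0" using assms by auto
  have e: "r * ?q v = real w * ?q w"
    using pmf_poisson_Suc[OF assms, of v] Suc by simp
  have "real w * stein_sol r B w = real w * (stein_num r B v / (real w * ?q w))"
    unfolding stein_sol_def e[symmetric] by (simp add: Suc del: pmf_poisson of_nat_Suc)
  also have "\<dots> = stein_num r B v / ?q w"
    using Suc by simp
  finally have 1: "real w * stein_sol r B w = stein_num r B v / ?q w" .
  have 2: "r * stein_sol r B (w + 1) = stein_num r B w / ?q w"
    unfolding stein_sol_def using assms q by (simp del: pmf_poisson)
  have "stein_num r B w = stein_num r B v + ?q w * (of_bool (w \<in> B) - measure_pmf.prob (poisson_pmf r) B)"
    by (simp add: stein_num_def Suc)
  then show ?thesis unfolding 1 2 using q by (simp add: field_simps del: pmf_poisson)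
qed

lemma poisson_lower_tail:
  assumes "0 < r"
  shows "r * (\<Sum>i<w. pmf (poisson_pmf r) i) \<le> real w * (\<Sum>i\<le>w. pmf (poisson_pmf r) i)"
proof -
  let ?q = "pmf (poisson_pmf r)"
  have "r * (\<Sum>i<w. ?q i) = (\<Sum>i<w. real (Suc i) * ?q (Suc i))"
    by (simp only: pmf_poisson_Suc[OF assms] sum_distrib_left)
  also have "\<dots> \<le> (\<Sum>i<w. real w * ?q (Suc i))"
    by (intro sum_mono mult_right_mono) auto
  also have "\<dots> \<le> real w * ?q 0 + (\<Sum>i<w. real w * ?q (Suc i))"
    by (simp del: pmf_poisson)
  also have "\<dots> = (\<Sum>i<Suc w. real w * ?q i)"
    by (simp only: sum.lessThan_Suc_shift)
  also have "\<dots> = real w * (\<Sum>i\<le>w. ?q i)"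
    by (simp only: sum_distrib_left lessThan_Suc_atMost)
  finally show ?thesis .
qed

lemma poisson_upper_tail:
  assumes "0 < r"
  shows "real w * (1 - (\<Sum>i\<le>w. pmf (poisson_pmf r) i)) \<le> r * (1 - (\<Sum>i<w. pmf (poisson_pmf r) i))"
proof -
  let ?q = "pmf (poisson_pmf r)"
  have s: "?q sums 1"
  proof -
    have "(\<lambda>n. r ^ n / fact n * exp (- r)) sums (exp r * exp (-r))"
      using exp_converges[of r] by (intro sums_mult2) (simp add: field_simps)
    moreover have "?q = (\<lambda>n. r ^ n / fact n * exp (- r))" using assms by (intro ext) simp
    ultimately show ?thesis by (simp only: exp_minus_inverse)
  qed
  have tail: "(\<lambda>i. ?q (i + m)) sums (1 - (\<Sum>i<m. ?q i))" for m
    using s sums_iff_shift[of ?q m] by auto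
  have "(\<lambda>i. real w * ?q (i + Suc w)) sums (real w * (1 - (\<Sum>i\<le>w. ?q i)))"
    using tail[of "Suc w"] by (intro sums_mult) (simp only: lessThan_Suc_atMost)
  moreover have "(\<lambda>i. r * ?q (i + w)) sums (r * (1 - (\<Sum>i<w. ?q i)))"
    using tail[of w] by (intro sums_mult)
  moreover have "real w * ?q (i + Suc w) \<le> r * ?q (i + w)" for i
  proof -
    have "real w * ?q (i + Suc w) \<le> real (Suc (i + w)) * ?q (Suc (i + w))"
      unfolding add_Suc_right by (intro mult_right_mono) auto
    then show ?thesis unfolding pmf_poisson_Suc[OF assms] .
  qed
  ultimately show ?thesis by (rule sums_le[rotated])
qed

text \<open>
  Multiplied by \<open>r \<pi>\<^sub>w\<close>, the increment is \<open>b0 (1 - r/w) + \<pi>\<^sub>w 1\<^sub>B(w) - b c\<close>, where \<open>b\<close> and \<open>b0\<close> are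
  the Poisson masses of \<open>B\<close> and of its part below \<open>w\<close>. Replacing \<open>b\<close> by the mass of \<open>B\<close> up to
  \<open>w\<close> only enlarges this, as \<open>c \<ge> 0\<close> by the lower tail comparison; the coefficient of \<open>b0\<close> then
  becomes \<open>1 - c - r/w\<close>, which is at most \<open>0\<close> by the upper tail comparison. What remains is at
  most \<open>\<pi>\<^sub>w\<close>.
\<close>
lemma stein_sol_increment_le:
  assumes "0 < r" "0 < w"
  shows "stein_sol r B (w + 1) - stein_sol r B w \<le> 1 / r"
proof -
  let ?q = "pmf (poisson_pmf r)"
  obtain v where w: "w = Suc v" using assms(2) by (cases w) auto
  define U where "U = (\<Sum>i\<le>w. ?q i)"
  define U' where "U' = (\<Sum>i<w. ?q i)"
  define b where "b = measure_pmf.prob (poisson_pmf r) B"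
  define b0 where "b0 = (\<Sum>i<w. ?q i * of_bool (i \<in> B))"
  define c where "c = U - r / w * U'"
  have q: "?q w > 0" "?q v > 0" using assms by auto
  have UU: "U = U' + ?q w"
    unfolding U_def U'_def by (simp only: lessThan_Suc_atMost[symmetric] sum.lessThan_Suc)
  have t1: "real w * (1 - U) \<le> r * (1 - U')"
    using poisson_upper_tail[OF assms(1)] unfolding U_def U'_def .
  have t2: "r * U' \<le> real w * U"
    using poisson_lower_tail[OF assms(1)] unfolding U_def U'_def .
  have c0: "0 \<le> c" using t2 assms by (simp add: c_def field_simps)
  have U1: "U \<le> 1"
    unfolding U_def by (subst measure_measure_pmf_finite[symmetric]) auto
  have c1: "1 - c \<le> 1" using c0 by simp
  have "1 - U \<le> r / w * (1 - U')" using t1 assms(2) by (simp add: pos_le_divide_eq mult.commute)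
  then have c2: "1 - c - r / w \<le> 0" unfolding c_def right_diff_distrib by linarith
  have "0 \<le> r / w * U'"
    unfolding U'_def using assms by (intro mult_nonneg_nonneg sum_nonneg) (auto simp del: pmf_poisson)
  then have c3: "0 \<le> 1 - c" using U1 unfolding c_def by linarith
  have b0: "0 \<le> b0" unfolding b0_def by (intro sum_nonneg) auto
  have bge: "b0 + ?q w * of_bool (w \<in> B) \<le> b"
  proof -
    have "b0 + ?q w * of_bool (w \<in> B) = (\<Sum>i\<le>w. ?q i * of_bool (i \<in> B))"
      unfolding b0_def by (simp only: lessThan_Suc_atMost[symmetric] sum.lessThan_Suc)
    also have "\<dots> = (\<Sum>i\<in>{..w}\<inter>B. ?q i)"
      by (intro sum.mono_neutral_cong_right) auto
    also have "\<dots> = measure_pmf.prob (poisson_pmf r) ({..w} \<inter> B)"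
      by (subst measure_measure_pmf_finite) auto
    also have "\<dots> \<le> b" unfolding b_def by (intro measure_pmf.finite_measure_mono) auto
    finally show ?thesis .
  qed
  have N: "stein_num r B v = b0 - b * U'"
    unfolding stein_num_def b0_def U'_def b_def w lessThan_Suc_atMost
    by (simp only: sum_distrib_left right_diff_distrib sum_subtractf mult.commute)
  have N': "stein_num r B w = b0 + ?q w * of_bool (w \<in> B) - b * U"
    unfolding stein_num_def b0_def U_def b_def
    unfolding lessThan_Suc_atMost[symmetric] sum.lessThan_Suc
    by (simp add: sum_distrib_left algebra_simps sum_subtractf del: pmf_poisson)
  have "?q v = real w / r * ?q w"
    using pmf_poisson_Suc[OF assms(1), of v] assms(1) unfolding w by (simp add: field_simps del: pmf_poisson)
  then have s1: "stein_sol r B w = stein_num r B v / (real w * ?q w)"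
    unfolding stein_sol_def w using assms(1) by (simp del: pmf_poisson)
  have s2: "stein_sol r B (w + 1) = stein_num r B w / (r * ?q w)"
    unfolding stein_sol_def by simp
  have "?q w * r * (stein_sol r B (w + 1) - stein_sol r B w)
     = stein_num r B w - r / w * stein_num r B v"
    unfolding s1 s2 using q assms by (simp add: field_simps del: pmf_poisson)
  also have "\<dots> = b0 * (1 - r / w) + ?q w * of_bool (w \<in> B) - b * c"
    unfolding N N' c_def by (simp add: algebra_simps)
  also have "\<dots> \<le> b0 * (1 - r / w) + ?q w * of_bool (w \<in> B) - (b0 + ?q w * of_bool (w \<in> B)) * c"
    using mult_right_mono[OF bge c0] by linarith
  also have "\<dots> = b0 * (1 - c - r / w) + ?q w * of_bool (w \<in> B) * (1 - c)"
    by (simp add: algebra_simps)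
  also have "\<dots> \<le> 0 + ?q w * 1 * 1"
    using b0 c1 c2 c3 q by (intro add_mono mult_mono mult_nonneg_nonpos) (auto simp del: pmf_poisson)
  finally have "?q w * (r * (stein_sol r B (w + 1) - stein_sol r B w)) \<le> ?q w * 1"
    by (simp add: mult.assoc)
  then have "r * (stein_sol r B (w + 1) - stein_sol r B w) \<le> 1"
    using q by (simp only: mult_le_cancel_left_pos)
  then show ?thesis using assms by (simp add: field_simps)
qed

text \<open>
  Complementing the test set reverses signs, which turns the upper bound on increments into a
  two-sided one.
\<close>
lemma stein_sol_Compl: "stein_sol r (- B) m = - stein_sol r B m"
proof -
  have c: "measure_pmf.prob (poisson_pmf r) (- B) = 1 - measure_pmf.prob (poisson_pmf r) B"
    by (subst measure_pmf.prob_compl[symmetric]) (auto simp: Compl_eq_Diff_UNIV)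
  then have "stein_num r (- B) w = - stein_num r B w" for w
    unfolding stein_num_def sum_negf[symmetric] c
    by (intro sum.cong) (auto simp: algebra_simps simp del: pmf_poisson)
  then show ?thesis by (simp add: stein_sol_def)
qed

lemma stein_sol_increment:
  assumes "0 < r" "0 < w"
  shows "\<bar>stein_sol r B (w + 1) - stein_sol r B w\<bar> \<le> 1 / r"
  using stein_sol_increment_le[OF assms, of B] stein_sol_increment_le[OF assms, of "- B"]
  unfolding stein_sol_Compl by linarith

text \<open>
  The Stein-Chen bound for decreasing events. Testing Stein's equation at \<open>W\<close> leaves, for each
  \<open>j\<close>, the difference between \<open>E x\<^sub>j E f(W + 1)\<close> and \<open>E (x\<^sub>j f(W))\<close>. Up to \<open>(E x\<^sub>j)\<^sup>2 / r\<close> this is the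
  covariance of \<open>x\<^sub>j\<close> with \<open>g\<^sub>j = f(W\<^sub>j + 1)\<close>, where \<open>W\<^sub>j\<close> counts the other events. The usual
  coupling of \<open>W\<^sub>j\<close> with its law conditioned on \<open>X\<^sub>j\<close> is replaced by Harris' inequality: because \<open>f\<close> has
  increments at most \<open>1/r\<close>, both \<open>W\<^sub>j / r + g\<^sub>j\<close> and \<open>W\<^sub>j / r - g\<^sub>j\<close> are nondecreasing functions of
  \<open>W\<^sub>j\<close>, hence decreasing functions of the random set, and therefore nonnegatively correlated with
  \<open>x\<^sub>j\<close>. So the covariance of \<open>x\<^sub>j\<close> and \<open>g\<^sub>j\<close> is at most \<open>1/r\<close> times that of \<open>x\<^sub>j\<close> and \<open>W\<^sub>j\<close>.
\<close>
theorem poisson_approximation_antitone: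
  fixes X :: "'i \<Rightarrow> 'a set \<Rightarrow> bool" and p :: real and V :: "'a set" and J :: "'i set"
  defines "E \<equiv> subset_exp p V"
  defines "W \<equiv> \<lambda>A. card {j\<in>J. X j A}"
  defines "r \<equiv> E (\<lambda>A. real (W A))"
  assumes V: "finite V" and p: "0 \<le> p" "p \<le> 1" and J: "finite J"
    and anti: "\<And>j A B. j \<in> J \<Longrightarrow> A \<subseteq> B \<Longrightarrow> B \<subseteq> V \<Longrightarrow> X j B \<Longrightarrow> X j A"
    and r: "0 < r"
  shows "\<bar>E (\<lambda>A. of_bool (W A \<in> B)) - measure_pmf.prob (poisson_pmf r) B\<bar> \<le>
    1 / r * (\<Sum>j\<in>J. (E (\<lambda>A. of_bool (X j A)))\<^sup>2 +
      (\<Sum>i\<in>J - {j}. E (\<lambda>A. of_bool (X i A \<and> X j A)) - E (\<lambda>A. of_bool (X i A)) * E (\<lambda>A. of_bool (X j A))))"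
proof -
  let ?f = "stein_sol r B"
  define x where "x = (\<lambda>j A. of_bool (X j A) :: real)"
  define W' where "W' = (\<lambda>j A. card {i\<in>J-{j}. X i A})"
  have W_sum: "real (W A) = (\<Sum>j\<in>J. x j A)" for A
    using J by (simp add: W_def x_def of_bool_def sum.If_cases Int_def)
  have W'_sum: "real (W' j A) = (\<Sum>i\<in>J-{j}. x i A)" for j A
    using J by (simp add: W'_def x_def of_bool_def sum.If_cases Int_def)
  have WW': "W A = W' j A + of_bool (X j A)" if "j \<in> J" for j A
  proof -
    have "real (W A) = real (W' j A) + x j A"
      unfolding W_sum W'_sum using that J by (simp add: sum.remove)
    then show ?thesis by (simp add: x_def of_bool_def split: if_splits)
  qed
  have r_sum: "r = (\<Sum>j\<in>J. E (x j))"
    unfolding r_def W_sum E_def by (simp add: subset_exp_sum)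
  have inc: "\<bar>?f (m + 1) - ?f m\<bar> \<le> 1 / r" if "m \<ge> 1" for m
    using stein_sol_increment[OF r, of m] that by auto
  have lip: "\<bar>?f (m' + 1) - ?f (m + 1)\<bar> \<le> 1 / r * (real m' - real m)" if "m \<le> m'" for m m'
    using that
  proof (induction m' rule: dec_induct)
    case (step i)
    have "\<bar>?f (Suc i + 1) - ?f (i + 1)\<bar> \<le> 1 / r" using inc[of "i+1"] by simp
    then show ?case using step.IH by (simp add: algebra_simps add_divide_distrib)
  qed simp
  define g where "g = (\<lambda>j A. ?f (W' j A + 1))"
  define Cov where "Cov = (\<lambda>j. \<Sum>i\<in>J - {j}. E (\<lambda>A. of_bool (X i A \<and> X j A)) - E (x i) * E (x j))"
  have W'_anti: "W' j B \<le> W' j A" if "A \<subseteq> B" "B \<subseteq> V" for j A B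
    unfolding W'_def by (rule card_mono) (use J anti that in auto)
  have cov1: "E (x j) * E (\<lambda>A. real (W' j A)) + Cov j = E (\<lambda>A. x j A * real (W' j A))" if "j \<in> J" for j
  proof -
    have "E (\<lambda>A. x j A * real (W' j A)) = (\<Sum>i\<in>J-{j}. E (\<lambda>A. x j A * x i A))"
      unfolding W'_sum sum_distrib_left E_def by (rule subset_exp_sum)
    also have "\<dots> = (\<Sum>i\<in>J-{j}. E (\<lambda>A. of_bool (X i A \<and> X j A)))"
      unfolding x_def by (simp add: of_bool_conj mult.commute)
    finally have 1: "E (\<lambda>A. x j A * real (W' j A)) = (\<Sum>i\<in>J-{j}. E (\<lambda>A. of_bool (X i A \<and> X j A)))" .
    have "E (\<lambda>A. real (W' j A)) = (\<Sum>i\<in>J-{j}. E (x i))"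
      unfolding W'_sum E_def by (rule subset_exp_sum)
    then show ?thesis unfolding 1 Cov_def by (simp add: sum_subtractf sum_distrib_left mult.commute)
  qed
  \<comment> \<open>Harris' inequality for \<open>x\<^sub>j\<close> and \<open>W\<^sub>j / r - s g\<^sub>j\<close>, with the sign \<open>s = 1\<close> or \<open>s = -1\<close> giving both directions.\<close>
  have cov_g: "s * (E (\<lambda>A. x j A * g j A) - E (x j) * E (g j)) \<le> 1 / r * Cov j"
    if j: "j \<in> J" and s: "\<bar>s\<bar> = 1" for j s
  proof -
    let ?h = "\<lambda>A. 1 / r * real (W' j A) - s * g j A"
    have "E (x j) * E ?h \<le> E (\<lambda>A. x j A * ?h A)"
      unfolding E_def
    proof (rule harris_inequality_antitone[OF V p])
      fix A B assume AB: "A \<subseteq> B" "B \<subseteq> V"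
      show "x j B \<le> x j A" using anti[OF j AB] by (auto simp: x_def of_bool_def)
      have "s * (g j A - g j B) \<le> \<bar>s\<bar> * \<bar>g j A - g j B\<bar>"
        by (metis abs_ge_self abs_mult)
      also have "\<dots> \<le> 1 / r * (real (W' j A) - real (W' j B))"
        unfolding s g_def using lip[OF W'_anti[OF AB]] by simp
      finally show "?h B \<le> ?h A" by (simp add: algebra_simps)
    qed
    also have "E (\<lambda>A. x j A * ?h A) = 1 / r * E (\<lambda>A. x j A * real (W' j A)) - s * E (\<lambda>A. x j A * g j A)"
      unfolding E_def subset_exp_cmult[symmetric] subset_exp_diff[symmetric]
      by (simp add: algebra_simps)
    also have "E ?h = 1 / r * E (\<lambda>A. real (W' j A)) - s * E (g j)"
      unfolding E_def subset_exp_cmult[symmetric] subset_exp_diff[symmetric] by simp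
    finally show ?thesis unfolding cov1[OF j, symmetric] by (simp add: algebra_simps)
  qed
  have cov_abs: "\<bar>E (\<lambda>A. x j A * g j A) - E (x j) * E (g j)\<bar> \<le> 1 / r * Cov j" if "j \<in> J" for j
    using cov_g[OF that, of 1] cov_g[OF that, of "-1"] by (simp add: abs_le_iff)
  have x0: "0 \<le> E (x j)" for j unfolding E_def x_def by (rule subset_exp_nonneg) (use p in auto)
  \<comment> \<open>Passing from \<open>W\<close> to \<open>W\<^sub>j\<close> changes the argument of \<open>f\<close> only when \<open>X\<^sub>j\<close> occurs, and then by one.\<close>
  have fW: "\<bar>E (\<lambda>A. ?f (W A + 1)) - E (g j)\<bar> \<le> 1 / r * E (x j)" if j: "j \<in> J" for j
  proof -
    have *: "\<bar>?f (W A + 1) - g j A\<bar> \<le> 1 / r * x j A" for A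
      using lip[of "W' j A" "W' j A + 1"] by (auto simp: WW'[OF j] g_def x_def)
    have "E (\<lambda>A. ?f (W A + 1) - g j A) \<le> E (\<lambda>A. 1 / r * x j A)"
      unfolding E_def by (rule subset_exp_mono[OF p]) (use * in \<open>simp add: abs_le_iff\<close>)
    moreover have "E (\<lambda>A. g j A - ?f (W A + 1)) \<le> E (\<lambda>A. 1 / r * x j A)"
      unfolding E_def by (rule subset_exp_mono[OF p]) (use * in \<open>simp add: abs_le_iff\<close>)
    ultimately show ?thesis unfolding E_def subset_exp_diff subset_exp_cmult by linarith
  qed
  have xg: "x j A * ?f (W A) = x j A * g j A" if "j \<in> J" for j A
    by (simp add: x_def g_def WW'[OF that])
  have "E (\<lambda>A. of_bool (W A \<in> B)) - measure_pmf.prob (poisson_pmf r) B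
      = E (\<lambda>A. of_bool (W A \<in> B) - measure_pmf.prob (poisson_pmf r) B)"
    unfolding E_def subset_exp_diff by (simp add: subset_exp_const V)
  also have "\<dots> = E (\<lambda>A. r * ?f (W A + 1) - (\<Sum>j\<in>J. x j A * g j A))"
    unfolding stein_equation[OF r, symmetric] W_sum sum_distrib_right
    by (simp add: xg)
  also have "\<dots> = r * E (\<lambda>A. ?f (W A + 1)) - (\<Sum>j\<in>J. E (\<lambda>A. x j A * g j A))"
    unfolding E_def subset_exp_diff subset_exp_cmult subset_exp_sum ..
  also have "\<dots> = (\<Sum>j\<in>J. E (x j) * E (\<lambda>A. ?f (W A + 1)) - E (\<lambda>A. x j A * g j A))"
    by (subst r_sum) (simp add: sum_distrib_right sum_subtractf)
  also have "\<bar>\<dots>\<bar> \<le> (\<Sum>j\<in>J. 1 / r * ((E (x j))\<^sup>2 + Cov j))"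
  proof (rule sum_abs[THEN order_trans], rule sum_mono)
    fix j assume j: "j \<in> J"
    have "\<bar>E (x j) * (E (\<lambda>A. ?f (W A + 1)) - E (g j))\<bar> \<le> E (x j) * (1 / r * E (x j))"
      unfolding abs_mult abs_of_nonneg[OF x0] by (rule mult_left_mono[OF fW[OF j] x0])
    then show "\<bar>E (x j) * E (\<lambda>A. ?f (W A + 1)) - E (\<lambda>A. x j A * g j A)\<bar> \<le> 1 / r * ((E (x j))\<^sup>2 + Cov j)"
      using cov_abs[OF j] by (simp add: algebra_simps power2_eq_square)
  qed
  finally show ?thesis unfolding sum_distrib_left[symmetric] Cov_def x_def .
qed

section \<open>Counting representations\<close>

definition sum_lists :: "nat \<Rightarrow> nat \<Rightarrow> nat \<Rightarrow> nat list set" where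
  "sum_lists n k j = {xs. length xs = k \<and> set xs \<subseteq> {0..n} \<and> sum_list xs = j}"

text \<open>
  The sets of values of representations of \<open>j\<close>. Sets rather than tuples or multisets are the
  right index for Janson's inequality: the permutations of one tuple have the same support and must
  not be counted as overlapping pairs.
\<close>
definition supports :: "nat \<Rightarrow> nat \<Rightarrow> nat \<Rightarrow> nat set set" where
  "supports n k j = set ` sum_lists n k j"

lemma finite_sum_lists [simp]: "finite (sum_lists n k j)"
  by (rule finite_subset[OF _ finite_lists_length_eq[of "{0..n}" k]]) (auto simp: sum_lists_def)

lemma finite_supports [simp]: "finite (supports n k j)"
  by (simp add: supports_def)

lemma supports_subset: "supports n k j \<subseteq> Pow {0..n}"
  by (auto simp: supports_def sum_lists_def)

lemma not_is_k_sum_iff_avoids: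
  assumes "A \<subseteq> {0..n}"
  shows "\<not> is_k_sum k A j \<longleftrightarrow> avoids (supports n k j) A"
proof -
  have "is_k_sum k A j \<longleftrightarrow> (\<exists>xs. length xs = k \<and> set xs \<subseteq> A \<and> sum_list xs = j)"
  proof
    assume "is_k_sum k A j"
    then obtain x where x: "\<forall>i\<in>{1..k}. x i \<in> A" "j = (\<Sum>i=1..k. x i)"
      by (auto simp: is_k_sum_def)
    let ?xs = "map x [1..<Suc k]"
    have "length ?xs = k \<and> set ?xs \<subseteq> A" using x by auto
    moreover have "sum_list ?xs = j"
      unfolding x(2) interv_sum_list_conv_sum_set_nat by (intro sum.cong) auto
    ultimately show "\<exists>xs. length xs = k \<and> set xs \<subseteq> A \<and> sum_list xs = j" by blast
  next
    assume "\<exists>xs. length xs = k \<and> set xs \<subseteq> A \<and> sum_list xs = j"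
    then obtain xs where xs: "length xs = k" "set xs \<subseteq> A" "sum_list xs = j" by blast
    have "j = (\<Sum>i=1..k. xs ! (i - 1))"
      using xs by (simp add: sum_list_sum_nth sum.atLeast1_atMost_eq atLeast0LessThan)
    moreover have "\<forall>i\<in>{1..k}. xs ! (i - 1) \<in> A"
      using xs by (auto intro!: nth_mem[THEN subsetD[OF xs(2)]])
    ultimately show "is_k_sum k A j"
      unfolding is_k_sum_def by (intro exI[of _ "\<lambda>i. xs ! (i - 1)"] conjI)
  qed
  also have "\<dots> \<longleftrightarrow> \<not> avoids (supports n k j) A"
    using assms by (fastforce simp: avoids_def supports_def sum_lists_def)
  finally show ?thesis by blast
qed

text \<open>
  The \<open>t\<close>-element sets that satisfy a linear equation with multiplicities in \<open>{1..k}\<close>. They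
  describe whole supports, and also the part of a support that lies outside a given set.
\<close>
definition weighted_sets :: "nat \<Rightarrow> nat \<Rightarrow> nat \<Rightarrow> nat \<Rightarrow> nat set set" where
  "weighted_sets n k t c =
     {U. U \<subseteq> {0..n} \<and> card U = t \<and> (\<exists>m. (\<forall>u\<in>U. m u \<in> {1..k}) \<and> (\<Sum>u\<in>U. m u * u) = c)}"

lemma finite_weighted_sets [simp]: "finite (weighted_sets n k t c)"
  by (rule finite_subset[of _ "Pow {0..n}"]) (auto simp: weighted_sets_def)

text \<open>
  The multiplicities and all elements but one determine the last element through the equation, so
  the \<open>t\<close> elements have only \<open>t - 1\<close> degrees of freedom.
\<close>
lemma card_weighted_sets:
  assumes "1 \<le> t"
  shows "card (weighted_sets n k t c) \<le> k ^ t * (n + 1) ^ (t - 1)"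
proof -
  define L where "L = {ms. set ms \<subseteq> {1..k} \<and> length ms = t} \<times> {zs. set zs \<subseteq> {0..n} \<and> length zs = t - 1}"
  define h where "h = (\<lambda>(ms, zs). set (((c - sum_list (map (\<lambda>(a, b). a * b) (zip (tl ms) zs))) div hd ms) # zs))"
  have finL: "finite L" unfolding L_def by (intro finite_cartesian_product finite_lists_length_eq) auto
  have "weighted_sets n k t c \<subseteq> h ` L"
  proof
    fix U assume "U \<in> weighted_sets n k t c"
    then obtain m where U: "U \<subseteq> {0..n}" "card U = t" and m: "\<And>u. u \<in> U \<Longrightarrow> m u \<in> {1..k}"
      "(\<Sum>u\<in>U. m u * u) = c"
      by (auto simp: weighted_sets_def)
    have "finite U" using U finite_subset by blast
    then obtain ys where ys: "set ys = U" "distinct ys"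
      using finite_distinct_list by blast
    then have len: "length ys = t" using U distinct_card by metis
    then obtain y zs where yz: "ys = y # zs" using assms by (cases ys) auto
    have "c = sum_list (map (\<lambda>u. m u * u) ys)"
      unfolding sum_list_distinct_conv_sum_set[OF ys(2)] ys(1) by (rule m(2)[symmetric])
    then have c: "c = m y * y + sum_list (map (\<lambda>u. m u * u) zs)"
      by (simp add: yz)
    have z: "sum_list (map (\<lambda>(a, b). a * b) (zip (map m zs) zs)) = sum_list (map (\<lambda>u. m u * u) zs)"
      by (induction zs) auto
    have "m y > 0" using m(1)[of y] ys yz by auto
    then have "(c - sum_list (map (\<lambda>u. m u * u) zs)) div m y = y"
      unfolding c by simp
    then have "h (map m ys, zs) = U"
      unfolding h_def using ys(1) by (simp add: yz z)
    moreover have "(map m ys, zs) \<in> L"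
      unfolding L_def using m(1) ys(1) len yz U(1) by auto
    ultimately show "U \<in> h ` L" by blast
  qed
  then have "card (weighted_sets n k t c) \<le> card L"
    using finL by (rule surj_card_le[rotated])
  also have "\<dots> = k ^ t * (n + 1) ^ (t - 1)"
    unfolding L_def card_cartesian_product by (subst (1 2) card_lists_length_eq) auto
  finally show ?thesis .
qed

lemma supports_props:
  assumes "S \<in> supports n k j"
  shows finite_support: "finite S" and support_le: "S \<subseteq> {0..n}" and card_support_le: "card S \<le> k"
    and card_support_ge: "1 \<le> k \<Longrightarrow> 1 \<le> card S"
    and support_multiplicities: "\<exists>m. (\<forall>u\<in>S. m u \<in> {1..k}) \<and> (\<Sum>u\<in>S. m u * u) = j"
proof -
  obtain xs where xs: "S = set xs" "length xs = k" "set xs \<subseteq> {0..n}" "sum_list xs = j"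
    using assms by (auto simp: supports_def sum_lists_def)
  show "finite S" "S \<subseteq> {0..n}" using xs by auto
  show "card S \<le> k" using xs card_length by metis
  show "1 \<le> card S" if "1 \<le> k"
    using xs that by (cases xs) (auto simp: Suc_le_eq card_gt_0_iff)
  have "\<forall>u\<in>S. count_list xs u \<in> {1..k}"
  proof
    fix u assume "u \<in> S"
    then have "count_list xs u \<noteq> 0" using xs by (simp add: count_list_0_iff)
    then show "count_list xs u \<in> {1..k}" using count_le_length[of xs u] xs by simp
  qed
  moreover have "(\<Sum>u\<in>S. count_list xs u * u) = j"
    using sum_list_map_eq_sum_count[of "\<lambda>u. u" xs] xs by simp
  ultimately show "\<exists>m. (\<forall>u\<in>S. m u \<in> {1..k}) \<and> (\<Sum>u\<in>S. m u * u) = j" by blast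
qed

text \<open>
  Converts counting into probability: \<open>k^t (n + 1)^(t-1) p^t = (k x)^t / (n + 1)\<close>, and as
  \<open>k x \<ge> 1\<close> the largest size \<open>s\<close> dominates.
\<close>
lemma sum_power_le_of_card:
  fixes p x D :: real
  assumes "finite F" "\<And>T. T \<in> F \<Longrightarrow> \<phi> T \<in> {1..s}"
    and "\<And>t. t \<in> {1..s} \<Longrightarrow> real (card {T\<in>F. \<phi> T = t}) \<le> D * real (k ^ t * (n + 1) ^ (t - 1))"
    and p: "0 \<le> p" and x: "x = (real n + 1) * p" "1 \<le> x" and k: "1 \<le> k" and D: "0 \<le> D"
  shows "(\<Sum>T\<in>F. p ^ \<phi> T) \<le> D * s * (k * x) ^ s / (real n + 1)"
proof -
  have kx: "1 \<le> real k * x" using k x(2) mult_mono[of 1 "real k" 1 x] by simp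
  have "(\<Sum>T\<in>F. p ^ \<phi> T) = (\<Sum>t\<in>{1..s}. \<Sum>T\<in>{T\<in>F. \<phi> T = t}. p ^ \<phi> T)"
    by (rule sum.group[symmetric]) (use assms in auto)
  also have "\<dots> = (\<Sum>t\<in>{1..s}. real (card {T\<in>F. \<phi> T = t}) * p ^ t)"
    by (intro sum.cong refl) simp
  also have "\<dots> \<le> (\<Sum>t\<in>{1..s}. D * (k * x) ^ s / (real n + 1))"
  proof (rule sum_mono)
    fix t assume t: "t \<in> {1..s}"
    obtain t' where t': "t = Suc t'" using t by (cases t) auto
    have "real (card {T\<in>F. \<phi> T = t}) * p ^ t \<le> D * real (k ^ t * (n + 1) ^ (t - 1)) * p ^ t"
      using assms(3)[OF t] p by (intro mult_right_mono) auto
    also have "\<dots> = D * (k * x) ^ t / (real n + 1)"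
      unfolding x t' by (simp add: power_mult_distrib add.commute)
    also have "\<dots> \<le> D * (k * x) ^ s / (real n + 1)"
      using t kx D by (intro divide_right_mono mult_left_mono power_increasing) auto
    finally show "real (card {T\<in>F. \<phi> T = t}) * p ^ t \<le> D * (k * x) ^ s / (real n + 1)" .
  qed
  finally show ?thesis by (simp add: mult_ac)
qed

lemma card_supports_of_size:
  assumes "1 \<le> t" "1 \<le> k"
  shows "card {S \<in> supports n k j. card S = t} \<le> k ^ t * (n + 1) ^ (t - 1)"
proof -
  have "{S \<in> supports n k j. card S = t} \<subseteq> weighted_sets n k t j"
    unfolding weighted_sets_def using support_le support_multiplicities by blast
  then have "card {S \<in> supports n k j. card S = t} \<le> card (weighted_sets n k t j)"
    by (intro card_mono) auto
  also note card_weighted_sets[OF assms(1)]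
  finally show ?thesis .
qed

lemma sum_supports_le:
  fixes p x :: real
  assumes "0 \<le> p" "x = (real n + 1) * p" "1 \<le> x" "1 \<le> k"
  shows "(\<Sum>S\<in>{S\<in>supports n k j. card S \<le> s}. p ^ card S) \<le> s * (k * x) ^ s / (real n + 1)"
proof -
  have "(\<Sum>S\<in>{S\<in>supports n k j. card S \<le> s}. p ^ card S) \<le> 1 * real s * (k * x) ^ s / (real n + 1)"
  proof (rule sum_power_le_of_card[OF _ _ _ assms])
    fix t assume t: "t \<in> {1..s}"
    then have "{T \<in> {S \<in> supports n k j. card S \<le> s}. card T = t} = {S \<in> supports n k j. card S = t}"
      by auto
    then show "real (card {T \<in> {S \<in> supports n k j. card S \<le> s}. card T = t})
        \<le> 1 * real (k ^ t * (n + 1) ^ (t - 1))"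
      using card_supports_of_size[of t k n j] t assms by (simp only: mult_1 of_nat_le_iff) auto
  qed (use assms(4) card_support_ge in auto)
  then show ?thesis by simp
qed

text \<open>
  Given \<open>S\<close>, a support \<open>T\<close> is determined by \<open>T \<inter> S\<close>, the multiplicities on \<open>T \<inter> S\<close>, and the set \<open>T - S\<close>,
  which then satisfies a linear equation with a known right-hand side. If \<open>T\<close> meets \<open>S\<close>, then
  \<open>T - S\<close> has at most \<open>k - 1\<close> elements: this is where the overlap saves a factor \<open>x\<close>.
\<close>
lemma sum_overlapping_supports_le:
  fixes p x :: real
  assumes "0 \<le> p" "x = (real n + 1) * p" "1 \<le> x" "1 \<le> k"
    and S: "finite S" "card S \<le> k"
  shows "(\<Sum>T\<in>{T\<in>supports n k j. T \<inter> S \<noteq> {} \<and> T - S \<noteq> {}}. p ^ card (T - S))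
     \<le> (2 * real (k + 1)) ^ k * (k - 1 :: nat) * (k * x) ^ (k - 1) / (real n + 1)"
proof (rule sum_power_le_of_card[OF _ _ _ assms(1-4)])
  let ?F = "{T\<in>supports n k j. T \<inter> S \<noteq> {} \<and> T - S \<noteq> {}}"
  show "card (T - S) \<in> {1..k - 1}" if "T \<in> ?F" for T
  proof -
    have T: "finite T" "card T \<le> k"
      using that finite_support card_support_le by blast+
    have "card (T - S) < card T" using that T by (intro psubset_card_mono) auto
    moreover have "card (T - S) > 0" using that T by (simp add: card_gt_0_iff)
    ultimately show ?thesis using T by auto
  qed
  fix t assume t: "t \<in> {1..k - 1}"
  \<comment> \<open>\<open>C\<close> collects the possible right-hand sides; a multiplicity \<open>0\<close> encodes an element of \<open>S\<close> outside \<open>T\<close>.\<close>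
  define C where "C = (\<lambda>m. j - (\<Sum>u\<in>S. m u * u)) ` (S \<rightarrow>\<^sub>E {0..k})"
  have finE: "finite (S \<rightarrow>\<^sub>E {0..k})" using S by (intro finite_PiE) auto
  have cardC: "card C \<le> (k + 1) ^ k"
  proof -
    have "card C \<le> card (S \<rightarrow>\<^sub>E {0..k})" unfolding C_def by (rule card_image_le[OF finE])
    also have "\<dots> = (k + 1) ^ card S" using S by (simp add: card_PiE)
    also have "\<dots> \<le> (k + 1) ^ k" using S by (intro power_increasing) auto
    finally show ?thesis .
  qed
  let ?G = "\<Union>c\<in>C. weighted_sets n k t c"
  have finC: "finite C" unfolding C_def using finE by simp
  have "{T \<in> ?F. card (T - S) = t} \<subseteq> (\<lambda>(Q, U). Q \<union> U) ` (Pow S \<times> ?G)"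
  proof
    fix T assume T: "T \<in> {T \<in> ?F. card (T - S) = t}"
    obtain m where m: "\<And>u. u \<in> T \<Longrightarrow> m u \<in> {1..k}" "(\<Sum>u\<in>T. m u * u) = j"
      "finite T" "T \<subseteq> {0..n}"
      using T support_multiplicities[of T n k j] finite_support[of T n k j] support_le[of T n k j]
      by blast
    define m' where "m' = (\<lambda>u\<in>S. if u \<in> T then m u else 0)"
    have "m' \<in> S \<rightarrow>\<^sub>E {0..k}" using m(1) by (force simp: m'_def)
    moreover have "(\<Sum>u\<in>S. m' u * u) = (\<Sum>u\<in>T \<inter> S. m u * u)"
      using S by (intro sum.mono_neutral_cong_right) (auto simp: m'_def)
    moreover have "(\<Sum>u\<in>T. m u * u) = (\<Sum>u\<in>T \<inter> S. m u * u) + (\<Sum>u\<in>T - S. m u * u)"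
      using m(3) by (rule sum.Int_Diff)
    ultimately have "(\<Sum>u\<in>T - S. m u * u) \<in> C"
      unfolding C_def using m(2) by (intro image_eqI[of _ _ m']) auto
    moreover have "T - S \<in> weighted_sets n k t (\<Sum>u\<in>T - S. m u * u)"
      unfolding weighted_sets_def using T m by auto
    ultimately have "(T \<inter> S, T - S) \<in> Pow S \<times> ?G" by blast
    moreover have "T = (\<lambda>(Q, U). Q \<union> U) (T \<inter> S, T - S)" by auto
    ultimately show "T \<in> (\<lambda>(Q, U). Q \<union> U) ` (Pow S \<times> ?G)" by (rule image_eqI[rotated])
  qed
  then have "card {T \<in> ?F. card (T - S) = t} \<le> card (Pow S \<times> ?G)"
    using S finC by (intro surj_card_le) auto
  also have "\<dots> = 2 ^ card S * card ?G" using S by (simp add: card_cartesian_product card_Pow)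
  finally have 1: "card {T \<in> ?F. card (T - S) = t} \<le> 2 ^ card S * card ?G" .
  have "card ?G \<le> (\<Sum>c\<in>C. card (weighted_sets n k t c))"
    by (rule card_UN_le[OF finC])
  also have "\<dots> \<le> (\<Sum>c\<in>C. k ^ t * (n + 1) ^ (t - 1))"
    using t by (intro sum_mono card_weighted_sets) auto
  also have "\<dots> = card C * (k ^ t * (n + 1) ^ (t - 1))" by simp
  also have "\<dots> \<le> (k + 1) ^ k * (k ^ t * (n + 1) ^ (t - 1))"
    using cardC by (rule mult_le_mono1)
  finally have 2: "card ?G \<le> (k + 1) ^ k * (k ^ t * (n + 1) ^ (t - 1))" .
  have 3: "(2::nat) ^ card S \<le> 2 ^ k" using S by (intro power_increasing) auto
  have "card {T \<in> ?F. card (T - S) = t} \<le> 2 ^ k * ((k + 1) ^ k * (k ^ t * (n + 1) ^ (t - 1)))"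
    by (rule order_trans[OF 1 mult_le_mono[OF 3 2]])
  then have "real (card {T \<in> ?F. card (T - S) = t}) \<le> real (2 ^ k * ((k + 1) ^ k * (k ^ t * (n + 1) ^ (t - 1))))"
    by (rule of_nat_mono)
  also have "\<dots> = (2 * real (k + 1)) ^ k * real (k ^ t * (n + 1) ^ (t - 1))"
    unfolding power_mult_distrib by (simp del: of_nat_add)
  finally show "real (card {T \<in> ?F. card (T - S) = t}) \<le> (2 * real (k + 1)) ^ k * real (k ^ t * (n + 1) ^ (t - 1))" .
qed auto

text \<open>
  The supports of representations with \<open>k\<close> distinct summands, which dominate.
\<close>
definition full_supports :: "nat \<Rightarrow> nat \<Rightarrow> nat \<Rightarrow> nat set set" where
  "full_supports n k j = {S \<in> supports n k j. card S = k}"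

lemma full_supports_Sum:
  assumes "S \<in> full_supports n k j" shows "\<Sum>S = j"
proof -
  obtain xs where xs: "S = set xs" "length xs = k" "sum_list xs = j" "card S = k"
    using assms by (auto simp: full_supports_def supports_def sum_lists_def)
  then have "distinct xs" by (simp add: card_distinct)
  then show ?thesis using xs sum_list_distinct_conv_sum_set[of xs "\<lambda>x. x"] by simp
qed

lemma card_distinct_sum_lists:
  "card {xs \<in> sum_lists n k j. distinct xs} = fact k * card (full_supports n k j)"
proof -
  have sub: "S \<subseteq> {0..n}" "finite S" "card S = k" if "S \<in> full_supports n k j" for S
    using that support_le finite_support unfolding full_supports_def by blast+
  have "{xs \<in> sum_lists n k j. distinct xs} = (\<Union>S\<in>full_supports n k j. permutations_of_set S)"
  proof (intro equalityI subsetI)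
    fix xs assume xs: "xs \<in> {xs \<in> sum_lists n k j. distinct xs}"
    then have "set xs \<in> full_supports n k j"
      unfolding full_supports_def supports_def using distinct_card[of xs] by (auto simp: sum_lists_def)
    then show "xs \<in> (\<Union>S\<in>full_supports n k j. permutations_of_set S)"
      using xs by (auto intro!: permutations_of_setI)
  next
    fix xs assume "xs \<in> (\<Union>S\<in>full_supports n k j. permutations_of_set S)"
    then obtain S where S: "S \<in> full_supports n k j" and xs: "set xs = S" "distinct xs"
      by (auto dest: permutations_of_setD)
    have "sum_list xs = j"
      using full_supports_Sum[OF S] xs sum_list_distinct_conv_sum_set[of xs "\<lambda>x. x"] by simp
    then show "xs \<in> {xs \<in> sum_lists n k j. distinct xs}"
      using sub[OF S] xs distinct_card[of xs] by (simp add: sum_lists_def)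
  qed
  also have "card \<dots> = (\<Sum>S\<in>full_supports n k j. card (permutations_of_set S))"
    by (intro card_UN_disjoint ballI impI) (auto simp: full_supports_def dest: permutations_of_setD)
  also have "\<dots> = (\<Sum>S\<in>full_supports n k j. fact k)"
    by (intro sum.cong refl) (simp add: sub)
  finally show ?thesis by simp
qed

lemma full_supports_le_sum_lists: "fact k * card (full_supports n k j) \<le> card (sum_lists n k j)"
  unfolding card_distinct_sum_lists[symmetric] by (intro card_mono) auto

text \<open>
  A list that is not distinct has a support with at most \<open>k - 1\<close> elements. There are only
  \<open>O(n^(k-2))\<close> such supports, by the bound of \<open>sum_supports_le\<close> at \<open>p = 1\<close>, and each carries at most
  \<open>k^k\<close> lists.
\<close>
lemma sum_lists_le_full_supports:
  assumes "1 \<le> k"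
  shows "real (card (sum_lists n k j)) \<le> fact k * real (card (full_supports n k j))
    + real (k ^ k) * (real (k - 1) * (k * (real n + 1)) ^ (k - 1) / (real n + 1))"
proof -
  let ?N = "{xs \<in> sum_lists n k j. \<not> distinct xs}"
  let ?F = "{S\<in>supports n k j. card S \<le> k - 1}"
  have sub: "?N \<subseteq> (\<Union>S\<in>?F. {xs. set xs \<subseteq> S \<and> length xs = k})"
  proof
    fix xs assume xs: "xs \<in> ?N"
    then have "card (set xs) \<noteq> length xs" "length xs = k"
      using card_distinct[of xs] by (auto simp: sum_lists_def)
    then have "card (set xs) < k" using card_length[of xs] by linarith
    then have "set xs \<in> ?F" using xs by (auto simp: supports_def)
    then show "xs \<in> (\<Union>S\<in>?F. {xs. set xs \<subseteq> S \<and> length xs = k})"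
      using xs by (auto simp: sum_lists_def)
  qed
  have fin: "finite S" if "S \<in> ?F" for S
    using that finite_support by blast
  have "card ?N \<le> card (\<Union>S\<in>?F. {xs. set xs \<subseteq> S \<and> length xs = k})"
    by (rule card_mono[OF _ sub]) (intro finite_UN_I finite_lists_length_eq fin; simp)
  also have "\<dots> \<le> (\<Sum>S\<in>?F. card {xs. set xs \<subseteq> S \<and> length xs = k})"
    by (intro card_UN_le) auto
  also have "\<dots> \<le> (\<Sum>S\<in>?F. k ^ k)"
    proof (rule sum_mono)
    fix S assume "S \<in> ?F"
    then have "finite S" "card S \<le> k" using finite_support card_support_le by blast+
    then show "card {xs. set xs \<subseteq> S \<and> length xs = k} \<le> k ^ k"
      by (simp add: card_lists_length_eq power_mono)
  qed
  also have "\<dots> = card ?F * k ^ k" by simp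
  finally have "real (card ?N) \<le> real (card ?F * k ^ k)" by (rule of_nat_mono)
  also have "\<dots> = real (k ^ k) * (\<Sum>S\<in>?F. 1 ^ card S)" by simp
  also have "\<dots> \<le> real (k ^ k) * (real (k - 1) * (k * (real n + 1)) ^ (k - 1) / (real n + 1))"
    using assms by (intro mult_left_mono sum_supports_le) auto
  finally have N: "real (card ?N) \<le> real (k ^ k) * (real (k - 1) * (k * (real n + 1)) ^ (k - 1) / (real n + 1))" .
  have "sum_lists n k j = {xs \<in> sum_lists n k j. distinct xs} \<union> ?N" by auto
  then have "card (sum_lists n k j) \<le> card {xs \<in> sum_lists n k j. distinct xs} + card ?N"
    using card_Un_le by metis
  then have "real (card (sum_lists n k j)) \<le> real (fact k * card (full_supports n k j)) + real (card ?N)"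
    unfolding card_distinct_sum_lists by (metis of_nat_mono of_nat_add)
  then show ?thesis using N by simp
qed

text \<open>
  The number of representations as an iterated window sum. The argument is an integer because
  the proof of unimodality shifts it below \<open>0\<close>.
\<close>
fun box_reps :: "nat \<Rightarrow> nat \<Rightarrow> int \<Rightarrow> nat" where
  "box_reps n 0 i = of_bool (i = 0)"
| "box_reps n (Suc k) i = (\<Sum>y\<in>{0..n}. box_reps n k (i - int y))"

lemma box_reps_eq_card:
  "box_reps n k i = card {xs. length xs = k \<and> set xs \<subseteq> {0..n} \<and> int (sum_list xs) = i}"
proof (induction k arbitrary: i)
  case 0
  have "{xs. length xs = 0 \<and> set xs \<subseteq> {0..n} \<and> int (sum_list xs) = i} = (if i = 0 then {[]} else {})"
    by auto
  then show ?case by simp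
next
  case (Suc k)
  let ?L = "\<lambda>k i. {xs. length xs = k \<and> set xs \<subseteq> {0..n} \<and> int (sum_list xs) = i}"
  have fin: "finite (?L k i)" for i
    by (rule finite_subset[OF _ finite_lists_length_eq[of "{0..n}" k]]) auto
  have "?L (Suc k) i = (\<Union>y\<in>{0..n}. (#) y ` ?L k (i - int y))"
    by (force simp: length_Suc_conv image_iff)
  also have "card \<dots> = (\<Sum>y\<in>{0..n}. card ((#) y ` ?L k (i - int y)))"
    using fin by (intro card_UN_disjoint) auto
  also have "\<dots> = (\<Sum>y\<in>{0..n}. box_reps n k (i - int y))"
    unfolding Suc by (intro sum.cong refl card_image) (auto simp: inj_on_def)
  finally show ?case by simp
qed

lemma card_sum_lists: "card (sum_lists n k j) = box_reps n k (int j)"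
  unfolding box_reps_eq_card sum_lists_def of_nat_eq_iff ..

text \<open>
  Monotonicity is asked only to the left of \<open>c / 2\<close>; with the symmetry it follows that the values
  decrease with the distance from \<open>c / 2\<close>, on both sides (\<open>centered_le\<close>).
\<close>
definition centered :: "int \<Rightarrow> (int \<Rightarrow> nat) \<Rightarrow> bool" where
  "centered c f \<longleftrightarrow> (\<forall>i. f (c - i) = f i) \<and> (\<forall>i. 2 * i + 1 \<le> c \<longrightarrow> f i \<le> f (i + 1))"

lemma centered_le:
  assumes "centered c f" "\<bar>2 * l - c\<bar> \<le> \<bar>2 * i - c\<bar>"
  shows "f i \<le> f l"
proof -
  have mono: "f i \<le> f l" if "i \<le> l" "2 * l \<le> c + 1" for i l
    using that
  proof (induction l rule: int_ge_induct)
    case (step l)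
    then have "f i \<le> f l" by auto
    also have "f l \<le> f (l + 1)" using assms(1) step unfolding centered_def by simp
    finally show ?case .
  qed simp
  have reflect: "f (c - i) = f i" for i using assms(1) by (simp add: centered_def)
  define i' where "i' = min i (c - i)"
  define l' where "l' = min l (c - l)"
  have "f i' = f i" "f l' = f l" using reflect[of i] reflect[of l] by (auto simp: i'_def l'_def min_def)
  moreover have "f i' \<le> f l'" using assms(2) by (intro mono) (auto simp: i'_def l'_def min_def)
  ultimately show ?thesis by simp
qed

text \<open>
  The step from \<open>i\<close> to \<open>i + 1\<close> gains \<open>f (i + 1)\<close> and loses \<open>f (i - n)\<close>; to the left of the new
  centre, \<open>i + 1\<close> is the nearer of the two to the old centre.
\<close>
lemma centered_window_sum:
  assumes "centered c f"
  shows "centered (c + int n) (\<lambda>i. \<Sum>y\<in>{0..n}. f (i - int y))"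
  unfolding centered_def
proof (intro conjI allI impI)
  fix i
  have "(\<Sum>y\<in>{0..n}. f (c + int n - i - int y)) = (\<Sum>y\<in>{0..n}. f (c - (i - int (n - y))))"
    by (intro sum.cong refl) (auto simp: of_nat_diff algebra_simps)
  also have "\<dots> = (\<Sum>y\<in>{0..n}. f (i - int (n - y)))"
    using assms by (simp add: centered_def)
  also have "\<dots> = (\<Sum>y\<in>{0..n}. f (i - int y))"
    by (rule sum.reindex_bij_witness[of _ "\<lambda>y. n - y" "\<lambda>y. n - y"]) auto
  finally show "(\<Sum>y\<in>{0..n}. f (c + int n - i - int y)) = (\<Sum>y\<in>{0..n}. f (i - int y))" .
next
  fix i assume i: "2 * i + 1 \<le> c + int n"
  have "(\<Sum>y\<in>{0..n}. f (i + 1 - int y)) = f (i + 1) + (\<Sum>y<n. f (i - int y))"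
    unfolding atLeast0AtMost lessThan_Suc_atMost[symmetric] by (subst sum.lessThan_Suc_shift) simp
  moreover have "(\<Sum>y\<in>{0..n}. f (i - int y)) = (\<Sum>y<n. f (i - int y)) + f (i - int n)"
    unfolding atLeast0AtMost lessThan_Suc_atMost[symmetric] by simp
  moreover have "f (i - int n) \<le> f (i + 1)"
    using i by (intro centered_le[OF assms]) arith
  ultimately show "(\<Sum>y\<in>{0..n}. f (i - int y)) \<le> (\<Sum>y\<in>{0..n}. f (i + 1 - int y))" by simp
qed

lemma centered_box_reps: "centered (int (k * n)) (box_reps n k)"
proof (induction k)
  case 0
  show ?case by (auto simp: centered_def)
next
  case (Suc k)
  show ?case using centered_window_sum[OF Suc, of n] by (simp add: add.commute)
qed

lemma card_sum_lists_unimodal: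
  assumes "i \<le> l" "i + l \<le> k * n"
  shows "card (sum_lists n k i) \<le> card (sum_lists n k l)"
  unfolding card_sum_lists
proof (rule centered_le[OF centered_box_reps])
  have "int i \<le> int l" "int i + int l \<le> int (k * n)" using assms by linarith+
  then show "\<bar>2 * int l - int (k * n)\<bar> \<le> \<bar>2 * int i - int (k * n)\<bar>" by linarith
qed

lemma card_sum_lists_reflect:
  assumes "j \<le> k * n"
  shows "card (sum_lists n k (k * n - j)) = card (sum_lists n k j)"
  using assms centered_box_reps[of k n] unfolding card_sum_lists centered_def
  by (simp add: of_nat_diff)

text \<open>
  For \<open>j \<le> n\<close> the bound \<open>n\<close> on the summands follows from their sum being \<open>j\<close>, so all compositions of
  \<open>j\<close> into \<open>k\<close> nonnegative parts count.
\<close>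
lemma card_sum_lists_small:
  assumes "j \<le> n" "1 \<le> k"
  shows "card (sum_lists n k j) = (j + (k - 1)) choose (k - 1)"
proof -
  have "sum_lists n k j = {l. size l = k \<and> sum_list l = j}"
    unfolding sum_lists_def using assms(1) member_le_sum_list by fastforce
  then have "card (sum_lists n k j) = (j + k - 1) choose j" by (simp add: card_length_sum_list)
  then show ?thesis using assms(2) binomial_symmetric[of j "j + (k - 1)"] by simp
qed

lemma power_le_fact_binomial: "j ^ m \<le> fact m * ((j + m) choose m)"
proof (induction m)
  case (Suc m)
  have "fact (Suc m) * ((j + Suc m) choose (Suc m)) = fact m * (Suc m * (Suc (j + m) choose Suc m))"
    by (simp only: fact_Suc of_nat_id add_Suc_right mult_ac)
  also have "\<dots> = Suc (j + m) * (fact m * ((j + m) choose m))"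
    unfolding Suc_times_binomial by (simp only: mult_ac)
  finally show ?case using mult_mono[OF _ Suc, of j "Suc (j + m)"] by simp
qed simp

lemma card_sum_lists_bounds:
  assumes "j \<le> n" "1 \<le> k"
  shows "real j ^ (k - 1) / fact (k - 1) \<le> real (card (sum_lists n k j))"
    and "real (card (sum_lists n k j)) \<le> (real j + real k) ^ (k - 1) / fact (k - 1)"
proof -
  have "real (j ^ (k - 1)) \<le> real (fact (k - 1) * card (sum_lists n k j))"
    unfolding card_sum_lists_small[OF assms] by (intro of_nat_mono power_le_fact_binomial)
  then show "real j ^ (k - 1) / fact (k - 1) \<le> real (card (sum_lists n k j))"
    by (simp add: field_simps)
  have "real (card (sum_lists n k j) * fact (k - 1)) \<le> real ((j + (k - 1)) ^ (k - 1))"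
    unfolding card_sum_lists_small[OF assms] by (intro of_nat_mono binomial_fact_pow)
  also have "\<dots> \<le> (real j + real k) ^ (k - 1)"
    unfolding of_nat_power by (intro power_mono) auto
  finally show "real (card (sum_lists n k j)) \<le> (real j + real k) ^ (k - 1) / fact (k - 1)"
    by (simp add: field_simps)
qed

section \<open>The probability of missing one or two targets\<close>

definition mean_size :: "nat \<Rightarrow> real \<Rightarrow> real" where
  "mean_size n p = (real n + 1) * p"

text \<open>
  The quantity \<open>\<epsilon>\<close> of the introduction, which bounds, up to a constant, the expected number of
  overlapping pairs of supports inside the random set: there are at most of the order of
  \<open>n^(2k-2-s)\<close> pairs that share \<open>s\<close> elements, each of them is present with probability
  \<open>p^(2k-s)\<close>, and \<open>s = 1\<close> dominates.
\<close>
definition overlap_error :: "nat \<Rightarrow> nat \<Rightarrow> real \<Rightarrow> real" where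
  "overlap_error n k p = mean_size n p ^ (2 * k - 1) / (real n + 1)\<^sup>2"

text \<open>
  The quantity \<open>\<lambda>\<^sub>j\<close> of the introduction. Dividing the number of all tuples by \<open>k!\<close> treats them as if
  their entries were distinct; the difference is absorbed by the error term.
\<close>
definition expected_reps :: "nat \<Rightarrow> nat \<Rightarrow> real \<Rightarrow> nat \<Rightarrow> real" where
  "expected_reps n k p j = p ^ k * real (card (sum_lists n k j)) / fact k"

abbreviation miss_prob :: "nat \<Rightarrow> nat \<Rightarrow> real \<Rightarrow> nat \<Rightarrow> real" where
  "miss_prob n k p j \<equiv> avoid_prob p {0..n} (supports n k j)"

text \<open>
  The constants depend only on \<open>k\<close>. They bound the sums of \<open>p ^ card S\<close> over all supports, over
  the supports with fewer than \<open>k\<close> elements, and over the supports overlapping a given one, in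
  units of \<open>x^k / (n + 1)\<close>, \<open>x^(k-1) / (n + 1)\<close> and \<open>x^(k-1) / (n + 1)\<close>; the last
  constant is large enough for every exponent that occurs.
\<close>
definition support_const :: "nat \<Rightarrow> real" where
  "support_const k = real k * real k ^ k"

definition small_const :: "nat \<Rightarrow> real" where
  "small_const k = real (k - 1) * real k ^ (k - 1)"

definition overlap_const :: "nat \<Rightarrow> real" where
  "overlap_const k = (2 * real (k + 1)) ^ k * small_const k"

definition error_const :: "nat \<Rightarrow> real" where
  "error_const k = 16 * support_const k * overlap_const k + 2 * small_const k
     + 2 * support_const k + real k ^ k * small_const k"

lemma const_nonneg [simp]: "0 \<le> support_const k" "0 \<le> small_const k" "0 \<le> overlap_const k" "0 \<le> error_const k"
  by (simp_all add: support_const_def small_const_def overlap_const_def error_const_def)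

text \<open>
  The estimates hold for every single \<open>n\<close> under two conditions: \<open>p \<le> 1/2\<close> for Janson's
  inequality, and \<open>x^k \<ge> n + 1\<close>, which says that a typical target has at least a constant expected number
  of representations and makes \<open>\<epsilon>\<close> the largest of all error terms.
\<close>
locale sparse_regime =
  fixes n k :: nat and p :: real
  assumes k2: "2 \<le> k" and p0: "0 \<le> p" and p_half: "p \<le> 1/2"
    and many_reps: "real n + 1 \<le> mean_size n p ^ k"
begin

abbreviation (input) "x \<equiv> mean_size n p"
abbreviation (input) "N \<equiv> real n + 1"
abbreviation (input) "\<epsilon> \<equiv> overlap_error n k p"

lemma k1: "1 \<le> k" using k2 by simp

lemma p1: "p \<le> 1" using p_half by simp

lemma size_eq: "x = N * p" by (simp add: mean_size_def)

lemma x_ge_1: "1 \<le> x"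
proof (rule ccontr)
  assume "\<not> 1 \<le> x"
  then have "x ^ k < 1" using p0 k2 by (intro power_less_one_iff[THEN iffD2]) (auto simp: mean_size_def)
  then show False using many_reps by simp
qed

lemma err_le:
  shows "x ^ (k - 1) / N \<le> \<epsilon>" "x ^ k / N\<^sup>2 \<le> \<epsilon>" "x ^ (k + 1) / N\<^sup>2 \<le> \<epsilon>"
    "x ^ k / N * (x ^ (k - 1) / N) = \<epsilon>"
proof -
  have e: "x ^ (2 * k - 1) = x ^ k * x ^ (k - 1)"
    using k2 by (simp add: power_add[symmetric] mult_2)
  show 1: "x ^ k / N * (x ^ (k - 1) / N) = \<epsilon>"
    unfolding overlap_error_def e by (simp add: power2_eq_square)
  have "1 * (x ^ (k - 1) / N) \<le> x ^ k / N * (x ^ (k - 1) / N)"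
    using many_reps x_ge_1 by (intro mult_right_mono) auto
  then show "x ^ (k - 1) / N \<le> \<epsilon>" using 1 by simp
  show "x ^ k / N\<^sup>2 \<le> \<epsilon>" "x ^ (k + 1) / N\<^sup>2 \<le> \<epsilon>"
    unfolding overlap_error_def using k2 x_ge_1 by (intro divide_right_mono power_increasing; simp)+
qed

lemma support_sum_le:
  "(\<Sum>S\<in>supports n k j. p ^ card S) \<le> support_const k * (x ^ k / N)"
proof -
  have "{S \<in> supports n k j. card S \<le> k} = supports n k j" using card_support_le by auto
  then show ?thesis
    using sum_supports_le[OF p0 size_eq x_ge_1 k1, where s = k and j = j]
    by (simp add: power_mult_distrib support_const_def mult.assoc)
qed

lemma small_support_sum_le:
  "(\<Sum>S\<in>{S\<in>supports n k j. card S \<le> k - 1}. p ^ card S) \<le> small_const k * \<epsilon>"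
proof -
  have "(\<Sum>S\<in>{S\<in>supports n k j. card S \<le> k - 1}. p ^ card S)
     \<le> real (k - 1) * (k * x) ^ (k - 1) / N"
    by (rule sum_supports_le[OF p0 size_eq x_ge_1 k1])
  also have "\<dots> = small_const k * (x ^ (k - 1) / N)"
    by (simp add: power_mult_distrib small_const_def)
  also have "\<dots> \<le> small_const k * \<epsilon>"
    using err_le(1) by (intro mult_left_mono) auto
  finally show ?thesis .
qed

text \<open>
  Two different supports can be ordered so that the second is not contained in the first. The sum
  over such ordered pairs factors: \<open>p ^ card (S \<union> T) = p ^ card S * p ^ card (T - S)\<close>, where the sum
  over \<open>S\<close> is \<open>O(x^k / (n + 1))\<close> and, for fixed \<open>S\<close>, the sum over \<open>T\<close> is \<open>O(x^(k-1) / (n + 1))\<close>.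
\<close>
lemma overlaps_sum_le:
  "(\<Sum>(S, T)\<in>overlaps (supports n k i \<union> supports n k j). p ^ card (S \<union> T))
     \<le> 8 * support_const k * overlap_const k * \<epsilon>"
proof -
  define W where "W = supports n k i \<union> supports n k j"
  define Q where "Q = {(S, T) \<in> overlaps W. T - S \<noteq> {}}"
  define B where "B = overlap_const k * (x ^ (k - 1) / N)"
  define A where "A = support_const k * (x ^ k / N)"
  have finW: "finite W" by (simp add: W_def)
  have W: "finite S" "card S \<le> k" if "S \<in> W" for S
    using that finite_support card_support_le unfolding W_def by blast+
  have finQ: "finite Q" unfolding Q_def using finite_overlaps[OF finW] by (auto intro: finite_subset)
  have B0: "0 \<le> B" unfolding B_def using x_ge_1 by simp
  have inner: "(\<Sum>T\<in>{T\<in>W. T \<inter> S \<noteq> {} \<and> T - S \<noteq> {}}. p ^ card (T - S)) \<le> 2 * B" if "S \<in> W" for S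
  proof -
    let ?G = "\<lambda>j. {T\<in>supports n k j. T \<inter> S \<noteq> {} \<and> T - S \<noteq> {}}"
    have G: "(\<Sum>T\<in>?G j. p ^ card (T - S)) \<le> B" for j
      using sum_overlapping_supports_le[OF p0 size_eq x_ge_1 k1 W[OF that], where j = j]
      by (simp add: B_def overlap_const_def small_const_def power_mult_distrib mult.assoc)
    have "{T\<in>W. T \<inter> S \<noteq> {} \<and> T - S \<noteq> {}} = ?G i \<union> ?G j" unfolding W_def by blast
    then have "(\<Sum>T\<in>{T\<in>W. T \<inter> S \<noteq> {} \<and> T - S \<noteq> {}}. p ^ card (T - S))
       + (\<Sum>T\<in>?G i \<inter> ?G j. p ^ card (T - S))
       = (\<Sum>T\<in>?G i. p ^ card (T - S)) + (\<Sum>T\<in>?G j. p ^ card (T - S))"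
      by (simp only:) (rule sum.union_inter; simp)
    moreover have "0 \<le> (\<Sum>T\<in>?G i \<inter> ?G j. p ^ card (T - S))"
      using p0 by (intro sum_nonneg) auto
    ultimately show ?thesis using G[of i] G[of j] by linarith
  qed
  have sumW: "(\<Sum>S\<in>W. p ^ card S) \<le> 2 * A"
  proof -
    have "(\<Sum>S\<in>W. p ^ card S) + (\<Sum>S\<in>supports n k i \<inter> supports n k j. p ^ card S)
      = (\<Sum>S\<in>supports n k i. p ^ card S) + (\<Sum>S\<in>supports n k j. p ^ card S)"
      unfolding W_def by (rule sum.union_inter) auto
    moreover have "0 \<le> (\<Sum>S\<in>supports n k i \<inter> supports n k j. p ^ card S)"
      using p0 by (intro sum_nonneg) auto
    ultimately show ?thesis
      using support_sum_le[of i, folded A_def] support_sum_le[of j, folded A_def] by linarith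
  qed
  have "(\<Sum>(S, T)\<in>Q. p ^ card (S \<union> T)) = (\<Sum>(S, T)\<in>Q. p ^ card S * p ^ card (T - S))"
  proof (intro sum.cong refl, clarify)
    fix S T assume "(S, T) \<in> Q"
    then have "finite S" "finite T" using W by (auto simp: Q_def overlaps_def)
    then have "card (S \<union> T) = card S + card (T - S)"
      by (metis Diff_disjoint Un_Diff_cancel card_Un_disjoint finite_Diff)
    then show "p ^ card (S \<union> T) = p ^ card S * p ^ card (T - S)" by (simp add: power_add)
  qed
  also have "\<dots> \<le> (\<Sum>(S, T)\<in>(SIGMA S:W. {T\<in>W. T \<inter> S \<noteq> {} \<and> T - S \<noteq> {}}). p ^ card S * p ^ card (T - S))"
    using finW p0 by (intro sum_mono2) (auto simp: Q_def overlaps_def)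
  also have "\<dots> = (\<Sum>S\<in>W. p ^ card S * (\<Sum>T\<in>{T\<in>W. T \<inter> S \<noteq> {} \<and> T - S \<noteq> {}}. p ^ card (T - S)))"
    using finW by (subst sum.Sigma[symmetric]) (auto simp: sum_distrib_left)
  also have "\<dots> \<le> (\<Sum>S\<in>W. p ^ card S * (2 * B))"
    using p0 by (intro sum_mono mult_left_mono inner) auto
  also have "\<dots> = (\<Sum>S\<in>W. p ^ card S) * (2 * B)" by (simp add: sum_distrib_right)
  also have "\<dots> \<le> 2 * A * (2 * B)" using sumW B0 by (intro mult_right_mono) auto
  finally have Q: "(\<Sum>(S, T)\<in>Q. p ^ card (S \<union> T)) \<le> 2 * A * (2 * B)" .
  have "overlaps W \<subseteq> Q \<union> prod.swap ` Q"
    by (force simp: Q_def overlaps_def image_iff)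
  then have "(\<Sum>(S, T)\<in>overlaps W. p ^ card (S \<union> T)) \<le> (\<Sum>(S, T)\<in>Q \<union> prod.swap ` Q. p ^ card (S \<union> T))"
    using finQ p0 by (intro sum_mono2) auto
  also have "\<dots> \<le> (\<Sum>(S, T)\<in>Q. p ^ card (S \<union> T)) + (\<Sum>(S, T)\<in>prod.swap ` Q. p ^ card (S \<union> T))"
  proof -
    have "0 \<le> (\<Sum>(S, T)\<in>Q \<inter> prod.swap ` Q. p ^ card (S \<union> T))"
      using p0 by (intro sum_nonneg) auto
    moreover have "(\<Sum>(S, T)\<in>Q \<union> prod.swap ` Q. p ^ card (S \<union> T)) + (\<Sum>(S, T)\<in>Q \<inter> prod.swap ` Q. p ^ card (S \<union> T))
       = (\<Sum>(S, T)\<in>Q. p ^ card (S \<union> T)) + (\<Sum>(S, T)\<in>prod.swap ` Q. p ^ card (S \<union> T))"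
      using finQ by (intro sum.union_inter) auto
    ultimately show ?thesis by linarith
  qed
  also have "(\<Sum>(S, T)\<in>prod.swap ` Q. p ^ card (S \<union> T)) = (\<Sum>(S, T)\<in>Q. p ^ card (S \<union> T))"
    by (subst sum.reindex) (auto simp: inj_on_def Un_commute intro!: sum.cong)
  finally have "(\<Sum>(S, T)\<in>overlaps W. p ^ card (S \<union> T)) \<le> 8 * A * B" using Q by simp
  also have "8 * A * B = 8 * support_const k * overlap_const k
       * (x ^ k / N * (x ^ (k - 1) / N))"
    unfolding A_def B_def by (simp only: mult_ac)
  finally show ?thesis unfolding err_le(4) W_def .
qed

text \<open>
  The probability of avoiding \<open>F\<close> if its members were avoided independently.
\<close>
definition "indep_prod F = (\<Prod>S\<in>F. 1 - p ^ card S)"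

lemma power_card_le_half:
  assumes "S \<in> supports n k j" shows "p ^ card S \<le> 1/2"
proof -
  have "p ^ card S \<le> p ^ 1"
    using card_support_ge[OF assms k1] p0 p1 by (intro power_decreasing) auto
  then show ?thesis using p_half by simp
qed

text \<open>
  Follows from \<open>ln (1 - y) \<ge> - y - 2 y\<^sup>2\<close> for \<open>0 \<le> y \<le> 1/2\<close>.
\<close>
lemma indep_prod_lower:
  assumes "F \<subseteq> supports n k j"
  shows "exp (- (\<Sum>S\<in>F. p ^ card S + 2 * (p ^ card S)\<^sup>2)) \<le> indep_prod F"
proof -
  have fin: "finite F" using assms finite_supports finite_subset by blast
  have "exp (- (\<Sum>S\<in>F. p ^ card S + 2 * (p ^ card S)\<^sup>2))
      = (\<Prod>S\<in>F. exp (- (p ^ card S + 2 * (p ^ card S)\<^sup>2)))"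
    by (simp add: exp_sum[OF fin] sum_negf[symmetric])
  also have "\<dots> \<le> indep_prod F"
    unfolding indep_prod_def
  proof (intro prod_mono conjI)
    fix S assume "S \<in> F"
    then have h: "0 \<le> p ^ card S" "p ^ card S \<le> 1/2"
      using assms power_card_le_half p0 by auto
    have "exp (- (p ^ card S + 2 * (p ^ card S)\<^sup>2)) \<le> exp (ln (1 - p ^ card S))"
      using ln_one_minus_pos_lower_bound[OF h] by simp
    then show "exp (- (p ^ card S + 2 * (p ^ card S)\<^sup>2)) \<le> 1 - p ^ card S"
      using h by simp
  qed simp
  finally show ?thesis .
qed

lemma square_le_self: "S \<in> supports n k j \<Longrightarrow> p ^ card S + 2 * (p ^ card S)\<^sup>2 \<le> 2 * p ^ card S"
  using mult_left_mono[OF power_card_le_half[of S j], of "p ^ card S"] p0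
  by (simp add: power2_eq_square)

lemma indep_prod_small_lower:
  assumes "F \<subseteq> {S\<in>supports n k j. card S \<le> k - 1}"
  shows "exp (- (2 * small_const k * \<epsilon>)) \<le> indep_prod F"
proof -
  have "(\<Sum>S\<in>F. p ^ card S + 2 * (p ^ card S)\<^sup>2) \<le> (\<Sum>S\<in>F. 2 * p ^ card S)"
    using assms by (intro sum_mono square_le_self) auto
  also have "\<dots> \<le> (\<Sum>S\<in>{S\<in>supports n k j. card S \<le> k - 1}. 2 * p ^ card S)"
    using assms p0 by (intro sum_mono2) auto
  also have "\<dots> \<le> 2 * (small_const k * \<epsilon>)"
    unfolding sum_distrib_left[symmetric] by (intro mult_left_mono small_support_sum_le) simp
  finally have "exp (- (2 * small_const k * \<epsilon>)) \<le> exp (- (\<Sum>S\<in>F. p ^ card S + 2 * (p ^ card S)\<^sup>2))"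
    by (simp add: mult.assoc)
  also have "\<dots> \<le> indep_prod F" using assms by (intro indep_prod_lower[of _ j]) auto
  finally show ?thesis .
qed

lemma full_power_eq: "(\<Sum>S\<in>full_supports n k j. p ^ card S) = real (card (full_supports n k j)) * p ^ k"
  by (simp add: full_supports_def)

lemma finite_full_supports: "finite (full_supports n k j)"
  by (simp add: full_supports_def)

lemma full_supports_le_expected: "real (card (full_supports n k j)) * p ^ k \<le> expected_reps n k p j"
proof -
  have "real (fact k * card (full_supports n k j)) \<le> real (card (sum_lists n k j))"
    by (intro of_nat_mono full_supports_le_sum_lists)
  then have "p ^ k * (fact k * real (card (full_supports n k j))) \<le> p ^ k * real (card (sum_lists n k j))"
    using p0 by (intro mult_left_mono) auto
  then show ?thesis unfolding expected_reps_def by (simp add: field_simps)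
qed

lemma full_supports_ge_expected:
  "expected_reps n k p j - real k ^ k * small_const k * \<epsilon> \<le> real (card (full_supports n k j)) * p ^ k"
proof -
  let ?E = "real (k ^ k) * (real (k - 1) * (k * N) ^ (k - 1) / N)"
  obtain k' where k': "k = Suc k'" using k1 by (cases k) auto
  have scale: "p ^ k * (real (k ^ k) * (real (k - 1) * (k * M) ^ (k - 1) / M))
     = real k ^ k * small_const k * ((M * p) ^ k / M\<^sup>2)" if "M \<noteq> 0" for M :: real
    using that by (simp add: k' power_mult_distrib power2_eq_square small_const_def del: of_nat_Suc)
      (simp add: algebra_simps)
  have e: "p ^ k * ?E = real k ^ k * small_const k * (x ^ k / N\<^sup>2)"
    unfolding size_eq by (rule scale) simp
  have "expected_reps n k p j \<le> p ^ k * (fact k * real (card (full_supports n k j)) + ?E) / fact k"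
    unfolding expected_reps_def using p0
    by (intro divide_right_mono mult_left_mono sum_lists_le_full_supports k1) auto
  also have "\<dots> = real (card (full_supports n k j)) * p ^ k + p ^ k * ?E / fact k"
    unfolding distrib_left add_divide_distrib by simp
  also have "p ^ k * ?E / fact k \<le> p ^ k * ?E / 1"
    using p0 fact_ge_1[of k, where 'a=real] by (intro divide_left_mono) (auto simp: fact_ge_1)
  also have "\<dots> \<le> real k ^ k * small_const k * \<epsilon>"
    unfolding div_by_1 e using err_le(2) by (intro mult_left_mono) auto
  finally show ?thesis by simp
qed

lemma indep_prod_supports_upper:
  "indep_prod (supports n k j) \<le> exp (- expected_reps n k p j + real k ^ k * small_const k * \<epsilon>)"
proof -
  let ?f = "\<lambda>S. 1 - p ^ card S" and ?F = "full_supports n k j"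
  have sub: "?F \<subseteq> supports n k j" by (auto simp: full_supports_def)
  have f01: "0 \<le> ?f S" "?f S \<le> 1" for S :: "nat set" using p0 p1 by (auto simp: power_le_one)
  have "indep_prod (supports n k j) = prod ?f (supports n k j - ?F) * prod ?f ?F"
    unfolding indep_prod_def by (rule prod.subset_diff[OF sub]) simp
  also have "\<dots> \<le> 1 * prod ?f ?F"
    using f01 by (intro mult_right_mono prod_le_1 prod_nonneg) auto
  also have "\<dots> \<le> (\<Prod>S\<in>?F. exp (- (p ^ card S)))"
  proof -
    have "?f S \<le> exp (- (p ^ card S))" for S :: "nat set"
      using exp_ge_add_one_self[of "- (p ^ card S)"] by simp
    then show ?thesis using f01 by (auto intro!: prod_mono)
  qed
  also have "\<dots> = exp (- (real (card ?F) * p ^ k))"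
    by (simp add: exp_sum[OF finite_full_supports, symmetric] sum_negf full_power_eq)
  also have "\<dots> \<le> exp (- expected_reps n k p j + real k ^ k * small_const k * \<epsilon>)"
    using full_supports_ge_expected[of j] by simp
  finally show ?thesis .
qed

text \<open>
  The full supports give the main term together with a quadratic error, which is small because
  \<open>p^k \<le> p\<close>; all smaller supports together change the exponent by \<open>O(\<epsilon>)\<close> only.
\<close>
lemma indep_prod_supports_lower:
  "exp (- expected_reps n k p j - (2 * small_const k + 2 * support_const k) * \<epsilon>)
     \<le> indep_prod (supports n k j)"
proof -
  let ?F = "full_supports n k j"
  have sub: "?F \<subseteq> supports n k j" by (auto simp: full_supports_def)
  have "p ^ k \<le> p ^ 1" using p0 p1 k1 by (intro power_decreasing) auto
  then have pk: "p ^ k \<le> p" by simp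
  have "real (card ?F) * p ^ k \<le> (\<Sum>S\<in>supports n k j. p ^ card S)"
    unfolding full_power_eq[symmetric] using p0 sub by (intro sum_mono2) auto
  also have "\<dots> \<le> support_const k * (x ^ k / N)" by (rule support_sum_le)
  finally have "(real (card ?F) * p ^ k) * p ^ k \<le> (support_const k * (x ^ k / N)) * p"
    by (rule mult_mono[OF _ pk]) (use p0 x_ge_1 in \<open>auto intro!: mult_nonneg_nonneg divide_nonneg_nonneg\<close>)
  also have "\<dots> = support_const k * (x ^ (k + 1) / N\<^sup>2)"
    by (simp add: size_eq power2_eq_square)
  also have "\<dots> \<le> support_const k * \<epsilon>" by (intro mult_left_mono err_le) auto
  finally have sq: "real (card ?F) * (p ^ k)\<^sup>2 \<le> support_const k * \<epsilon>"
    by (simp add: power2_eq_square mult.assoc)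
  have "(\<Sum>S\<in>?F. p ^ card S + 2 * (p ^ card S)\<^sup>2) = real (card ?F) * p ^ k + 2 * (real (card ?F) * (p ^ k)\<^sup>2)"
    by (simp add: full_supports_def algebra_simps)
  also have "\<dots> \<le> expected_reps n k p j + 2 * support_const k * \<epsilon>"
    using full_supports_le_expected[of j] sq by simp
  finally have "exp (- (expected_reps n k p j + 2 * support_const k * \<epsilon>)) \<le> exp (- (\<Sum>S\<in>?F. p ^ card S + 2 * (p ^ card S)\<^sup>2))"
    by (simp only: exp_le_cancel_iff neg_le_iff_le)
  also have "\<dots> \<le> indep_prod ?F" by (rule indep_prod_lower[OF sub])
  finally have full: "exp (- (expected_reps n k p j + 2 * support_const k * \<epsilon>)) \<le> indep_prod ?F" .
  have rest: "exp (- (2 * small_const k * \<epsilon>)) \<le> indep_prod (supports n k j - ?F)"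
  proof (rule indep_prod_small_lower)
    show "supports n k j - ?F \<subseteq> {S \<in> supports n k j. card S \<le> k - 1}"
    proof
      fix S assume S: "S \<in> supports n k j - ?F"
      then have "card S \<le> k" "card S \<noteq> k" using card_support_le by (auto simp: full_supports_def)
      then show "S \<in> {S \<in> supports n k j. card S \<le> k - 1}" using S by auto
    qed
  qed
  have "exp (- expected_reps n k p j - (2 * small_const k + 2 * support_const k) * \<epsilon>)
      = exp (- (2 * small_const k * \<epsilon>)) * exp (- (expected_reps n k p j + 2 * support_const k * \<epsilon>))"
    unfolding exp_add[symmetric] by (simp add: algebra_simps)
  also have "\<dots> \<le> indep_prod (supports n k j - ?F) * indep_prod ?F"
    using full rest by (intro mult_mono) (auto intro: order_trans[OF exp_ge_zero])
  also have "\<dots> = indep_prod (supports n k j)"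
    unfolding indep_prod_def by (rule prod.subset_diff[OF sub, symmetric]) simp
  finally show ?thesis .
qed

lemma supports_family: "supports n k i \<union> supports n k j \<subseteq> Pow {0..n}" "{} \<notin> supports n k i \<union> supports n k j"
  using supports_subset[of n k i] supports_subset[of n k j] card_support_ge[OF _ k1, of "{}" n] by auto

lemma indep_prod_le_miss_prob: "indep_prod (supports n k j) \<le> miss_prob n k p j"
  unfolding indep_prod_def by (rule avoid_prob_lower) (use p0 p1 supports_subset in auto)

lemma avoid_two_upper:
  "avoid_prob p {0..n} (supports n k i \<union> supports n k j)
     \<le> indep_prod (supports n k i \<union> supports n k j)
        * exp (16 * support_const k * overlap_const k * \<epsilon>)"
proof -
  let ?W = "supports n k i \<union> supports n k j"
  have nonneg: "0 \<le> indep_prod ?W"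
    unfolding indep_prod_def using p0 p1 by (intro prod_nonneg) (auto simp: power_le_one)
  have "avoid_prob p {0..n} ?W \<le> indep_prod ?W * exp (2 * (\<Sum>(S, T)\<in>overlaps ?W. p ^ card (S \<union> T)))"
    unfolding indep_prod_def by (rule janson_inequality) (use p0 p_half supports_family in auto)
  also have "\<dots> \<le> indep_prod ?W * exp (2 * (8 * support_const k * overlap_const k * \<epsilon>))"
    by (intro mult_left_mono nonneg exp_le_cancel_iff[THEN iffD2] overlaps_sum_le) simp
  finally show ?thesis by (simp add: mult.assoc)
qed

lemma \<epsilon>_nonneg: "0 \<le> \<epsilon>" unfolding overlap_error_def using x_ge_1 by simp

theorem miss_prob_upper:
  "miss_prob n k p j \<le> exp (- expected_reps n k p j + error_const k * \<epsilon>)"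
proof -
  let ?c = "16 * support_const k * overlap_const k"
  let ?g = "real k ^ k * small_const k"
  have "miss_prob n k p j \<le> indep_prod (supports n k j) * exp (?c * \<epsilon>)"
    using avoid_two_upper[of j j] by simp
  also have "\<dots> \<le> exp (- expected_reps n k p j + ?g * \<epsilon>) * exp (?c * \<epsilon>)"
    using indep_prod_supports_upper[of j] by (intro mult_right_mono) auto
  also have "\<dots> = exp (- expected_reps n k p j + (?g + ?c) * \<epsilon>)"
    unfolding exp_add[symmetric] by (simp only: algebra_simps)
  also have "\<dots> \<le> exp (- expected_reps n k p j + error_const k * \<epsilon>)"
  proof -
    have "?g + ?c \<le> error_const k" unfolding error_const_def by simp
    then have "(?g + ?c) * \<epsilon> \<le> error_const k * \<epsilon>" by (rule mult_right_mono[OF _ \<epsilon>_nonneg])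
    then show ?thesis by simp
  qed
  finally show ?thesis .
qed

theorem miss_prob_lower:
  "exp (- expected_reps n k p j - error_const k * \<epsilon>) \<le> miss_prob n k p j"
proof -
  let ?c = "2 * small_const k + 2 * support_const k :: real"
  have "?c \<le> error_const k" unfolding error_const_def by simp
  then have "?c * \<epsilon> \<le> error_const k * \<epsilon>" by (rule mult_right_mono[OF _ \<epsilon>_nonneg])
  then have "exp (- expected_reps n k p j - error_const k * \<epsilon>) \<le> exp (- expected_reps n k p j - ?c * \<epsilon>)"
    by simp
  also note indep_prod_supports_lower
  also note indep_prod_le_miss_prob
  finally show ?thesis .
qed

text \<open>
  Janson's inequality for the union of the two families compares with a product over the union,
  which differs from the product over both families by the factors of the common supports. A set of
  \<open>k\<close> elements determines its sum, so a common support of two different targets has fewer than \<open>k\<close>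
  elements, and these factors are \<open>exp (O(\<epsilon>))\<close>.
\<close>
theorem miss_both_upper:
  assumes "i \<noteq> j"
  shows "avoid_prob p {0..n} (supports n k i \<union> supports n k j)
     \<le> miss_prob n k p i * miss_prob n k p j * exp (error_const k * \<epsilon>)"
proof -
  let ?c = "16 * support_const k * overlap_const k"
  let ?s = "2 * small_const k :: real"
  let ?A = "supports n k i" and ?B = "supports n k j"
  have nonneg: "0 \<le> indep_prod F" for F
    unfolding indep_prod_def using p0 p1 by (intro prod_nonneg) (auto simp: power_le_one)
  have common: "exp (- (?s * \<epsilon>)) \<le> indep_prod (?A \<inter> ?B)"
  proof (rule indep_prod_small_lower)
    show "?A \<inter> ?B \<subseteq> {S \<in> supports n k i. card S \<le> k - 1}"
    proof
      fix S assume S: "S \<in> ?A \<inter> ?B"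
      have "card S \<noteq> k"
        using full_supports_Sum[of S n k i] full_supports_Sum[of S n k j] S assms
        by (auto simp: full_supports_def)
      moreover have "card S \<le> k" using S card_support_le by blast
      ultimately show "S \<in> {S \<in> supports n k i. card S \<le> k - 1}" using S by auto
    qed
  qed
  have "indep_prod (?A \<union> ?B) * exp (- (?s * \<epsilon>)) \<le> indep_prod (?A \<union> ?B) * indep_prod (?A \<inter> ?B)"
    by (rule mult_left_mono[OF common nonneg])
  also have "\<dots> = indep_prod ?A * indep_prod ?B"
    unfolding indep_prod_def by (rule prod.union_inter) auto
  finally have union: "indep_prod (?A \<union> ?B) \<le> indep_prod ?A * indep_prod ?B * exp (?s * \<epsilon>)"
    by (simp add: exp_minus field_simps)
  have "avoid_prob p {0..n} (?A \<union> ?B) \<le> indep_prod (?A \<union> ?B) * exp (?c * \<epsilon>)"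
    by (rule avoid_two_upper)
  also have "\<dots> \<le> indep_prod ?A * indep_prod ?B * exp (?s * \<epsilon>) * exp (?c * \<epsilon>)"
    by (intro mult_right_mono union) auto
  also have "\<dots> = indep_prod ?A * indep_prod ?B * exp ((?s + ?c) * \<epsilon>)"
    unfolding distrib_right exp_add by (simp only: mult.assoc)
  also have "\<dots> \<le> miss_prob n k p i * miss_prob n k p j * exp (error_const k * \<epsilon>)"
  proof (intro mult_mono)
    have "?s + ?c \<le> error_const k" unfolding error_const_def by simp
    then have "(?s + ?c) * \<epsilon> \<le> error_const k * \<epsilon>" by (rule mult_right_mono[OF _ \<epsilon>_nonneg])
    then show "exp ((?s + ?c) * \<epsilon>) \<le> exp (error_const k * \<epsilon>)" by simp
  qed (use nonneg indep_prod_le_miss_prob avoid_prob_nonneg p0 p1 in \<open>auto intro!: mult_nonneg_nonneg\<close>)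
  finally show ?thesis .
qed

end

section \<open>The number of missed targets\<close>

lemma tv_dist_le:
  assumes "\<And>B. \<bar>measure_pmf.prob P B - measure_pmf.prob Q B\<bar> \<le> c"
  shows "tv_dist P Q \<le> c"
  unfolding tv_dist_def by (rule cSUP_least) (use assms in auto)

lemma abs_prob_diff_le_tv_dist: "\<bar>measure_pmf.prob P B - measure_pmf.prob Q B\<bar> \<le> tv_dist P Q"
  unfolding tv_dist_def
proof (rule cSUP_upper)
  show "bdd_above (range (\<lambda>B. \<bar>measure_pmf.prob P B - measure_pmf.prob Q B\<bar>))"
  proof (rule bdd_aboveI2)
    fix B
    have "0 \<le> measure_pmf.prob P B" "measure_pmf.prob P B \<le> 1"
         "0 \<le> measure_pmf.prob Q B" "measure_pmf.prob Q B \<le> 1" by simp_all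
    then show "\<bar>measure_pmf.prob P B - measure_pmf.prob Q B\<bar> \<le> 1" by linarith
  qed
qed simp

lemma tv_dist_nonneg: "0 \<le> tv_dist P Q"
  using abs_prob_diff_le_tv_dist[of P "{}" Q] by simp

lemma num_missing_eq_avoids:
  assumes "A \<subseteq> {0..n}"
  shows "num_missing k \<alpha> n A = card {j \<in> targets k \<alpha> n. avoids (supports n k j) A}"
  unfolding num_missing_def not_is_k_sum_iff_avoids[OF assms] ..

text \<open>
  The expectation of \<open>X\<close> in the form in which it is estimated; see \<open>expectation_num_missing\<close>.
\<close>
definition mean_missing :: "nat \<Rightarrow> real \<Rightarrow> nat \<Rightarrow> real \<Rightarrow> real" where
  "mean_missing k \<alpha> n p = (\<Sum>j\<in>targets k \<alpha> n. miss_prob n k p j)"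

lemma expectation_num_missing:
  assumes "0 \<le> p" "p \<le> 1"
  shows "measure_pmf.expectation (random_subset n p) (\<lambda>S. real (num_missing k \<alpha> n S)) = mean_missing k \<alpha> n p"
proof -
  have "measure_pmf.expectation (random_subset n p) (\<lambda>S. real (num_missing k \<alpha> n S))
     = subset_exp p {0..n} (\<lambda>S. real (num_missing k \<alpha> n S))"
    by (rule expectation_random_subset[OF assms])
  also have "\<dots> = subset_exp p {0..n} (\<lambda>S. \<Sum>j\<in>targets k \<alpha> n. of_bool (avoids (supports n k j) S))"
    by (rule subset_exp_cong) (simp add: num_missing_eq_avoids Int_def)
  finally show ?thesis unfolding mean_missing_def subset_exp_sum .
qed

lemma prob_truncated_basis:
  "measure_pmf.prob (random_subset n p) {S. truncated_basis k \<alpha> n S}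
     = measure_pmf.prob (map_pmf (num_missing k \<alpha> n) (random_subset n p)) {0}"
proof -
  have "S \<subseteq> {0..n}" if "S \<in> set_pmf (random_subset n p)" for S
    using that unfolding random_subset_def by auto
  then have "measure_pmf.prob (random_subset n p) {S. truncated_basis k \<alpha> n S}
     = measure_pmf.prob (random_subset n p) (num_missing k \<alpha> n -` {0})"
    by (intro measure_pmf.finite_measure_eq_AE)
       (auto simp: AE_measure_pmf_iff truncated_basis_iff_num_missing_eq_0)
  then show ?thesis by simp
qed

lemma targets_nonempty:
  assumes "2 \<le> k" "0 < \<alpha>" "\<alpha> < 1"
  shows "n \<in> targets k \<alpha> n"
proof -
  have "\<alpha> * real n \<le> 1 * real n" "1 * real n \<le> (real k - \<alpha>) * real n"
    using assms by (intro mult_right_mono; simp)+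
  then show ?thesis by (simp add: targets_def)
qed

text \<open>
  The Poisson law is specified for positive means only.
\<close>
lemma (in sparse_regime) mean_missing_pos:
  assumes "0 < \<alpha>" "\<alpha> < 1"
  shows "0 < mean_missing k \<alpha> n p"
proof -
  have "0 < miss_prob n k p n"
    using miss_prob_lower[of n] by (rule less_le_trans[OF exp_gt_zero])
  also have "\<dots> \<le> mean_missing k \<alpha> n p" unfolding mean_missing_def
    using avoid_prob_nonneg[OF p0 p1] targets_nonempty[OF k2 assms] by (intro member_le_sum) auto
  finally show ?thesis .
qed

text \<open>
  The covariance of two indicators is at most \<open>\<delta>\<close> times the product of the probabilities, with
  \<open>\<delta> = exp (O(\<epsilon>)) - 1\<close>; the sum of all covariances is at most \<open>\<delta>\<close> times the square of the mean, and
  the Stein-Chen bound divides it by the mean.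
\<close>
lemma (in sparse_regime) tv_dist_num_missing_le:
  assumes \<alpha>: "0 < \<alpha>" "\<alpha> < 1" and m: "\<And>j. j \<in> targets k \<alpha> n \<Longrightarrow> miss_prob n k p j \<le> m"
  shows "tv_dist (map_pmf (num_missing k \<alpha> n) (random_subset n p)) (poisson_pmf (mean_missing k \<alpha> n p))
     \<le> mean_missing k \<alpha> n p * (exp (error_const k * \<epsilon>) - 1) + m"
proof (rule tv_dist_le)
  fix B :: "nat set"
  let ?J = "targets k \<alpha> n" and ?P = "miss_prob n k p"
  let ?X = "\<lambda>j A. avoids (supports n k j) A"
  let ?E = "subset_exp p {0..n}"
  define r where "r = mean_missing k \<alpha> n p"
  define \<delta> where "\<delta> = exp (error_const k * \<epsilon>) - 1"
  have P0: "0 \<le> ?P j" for j using p0 p1 by (rule avoid_prob_nonneg)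
  have \<delta>0: "0 \<le> \<delta>" using \<epsilon>_nonneg by (simp add: \<delta>_def)
  have W: "num_missing k \<alpha> n A = card {j \<in> ?J. ?X j A}" if "A \<subseteq> {0..n}" for A
    using that by (rule num_missing_eq_avoids)
  have r_alt: "?E (\<lambda>A. real (card {j \<in> ?J. ?X j A})) = r"
  proof -
    have "?E (\<lambda>A. real (card {j \<in> ?J. ?X j A})) = ?E (\<lambda>S. \<Sum>j\<in>?J. of_bool (?X j S))"
      by (rule subset_exp_cong) (simp add: Int_def)
    then show ?thesis unfolding r_def mean_missing_def subset_exp_sum .
  qed
  have r0: "0 < r" unfolding r_def by (rule mean_missing_pos[OF \<alpha>])
  have "measure_pmf.prob (map_pmf (num_missing k \<alpha> n) (random_subset n p)) B
      = measure_pmf.prob (random_subset n p) {S. num_missing k \<alpha> n S \<in> B}"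
    by (simp add: vimage_def)
  also have "\<dots> = ?E (\<lambda>A. of_bool (num_missing k \<alpha> n A \<in> B))"
    by (rule prob_random_subset[OF p0 p1])
  also have "\<dots> = ?E (\<lambda>A. of_bool (card {j \<in> ?J. ?X j A} \<in> B))"
    by (rule subset_exp_cong) (simp add: W)
  finally have "\<bar>measure_pmf.prob (map_pmf (num_missing k \<alpha> n) (random_subset n p)) B - measure_pmf.prob (poisson_pmf r) B\<bar>
    = \<bar>?E (\<lambda>A. of_bool (card {j \<in> ?J. ?X j A} \<in> B)) - measure_pmf.prob (poisson_pmf r) B\<bar>" by simp
  also have "\<dots> \<le> 1 / r * (\<Sum>j\<in>?J. (?P j)\<^sup>2 +
      (\<Sum>i\<in>?J - {j}. ?E (\<lambda>A. of_bool (?X i A \<and> ?X j A)) - ?P i * ?P j))"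
    unfolding r_alt[symmetric]
    by (rule poisson_approximation_antitone)
       (use p0 p1 r0 r_alt in \<open>auto intro: avoids_antimono\<close>)
  also have "\<dots> \<le> 1 / r * (\<Sum>j\<in>?J. ?P j * m + ?P j * (\<delta> * r))"
  proof (intro mult_left_mono sum_mono add_mono)
    fix j assume j: "j \<in> ?J"
    show "(?P j)\<^sup>2 \<le> ?P j * m"
      unfolding power2_eq_square using m[OF j] P0 by (intro mult_left_mono) auto
    have "(\<Sum>i\<in>?J - {j}. ?E (\<lambda>A. of_bool (?X i A \<and> ?X j A)) - ?P i * ?P j)
        \<le> (\<Sum>i\<in>?J - {j}. ?P j * \<delta> * ?P i)"
    proof (rule sum_mono)
      fix i assume i: "i \<in> ?J - {j}"
      have "?E (\<lambda>A. of_bool (?X i A \<and> ?X j A)) = avoid_prob p {0..n} (supports n k i \<union> supports n k j)"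
        by (rule subset_exp_cong, rule arg_cong[of _ _ of_bool]) (auto simp: avoids_def)
      also have "\<dots> \<le> ?P i * ?P j * exp (error_const k * \<epsilon>)"
        using i by (intro miss_both_upper) auto
      finally show "?E (\<lambda>A. of_bool (?X i A \<and> ?X j A)) - ?P i * ?P j \<le> ?P j * \<delta> * ?P i"
        by (simp add: \<delta>_def algebra_simps)
    qed
    also have "\<dots> \<le> (\<Sum>i\<in>?J. ?P j * \<delta> * ?P i)"
      using P0 \<delta>0 by (intro sum_mono2) auto
    also have "\<dots> = ?P j * (\<delta> * r)"
      unfolding sum_distrib_left[symmetric] r_def mean_missing_def by (simp add: mult.assoc)
    finally show "(\<Sum>i\<in>?J - {j}. ?E (\<lambda>A. of_bool (?X i A \<and> ?X j A)) - ?P i * ?P j) \<le> ?P j * (\<delta> * r)" .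
  qed (use r0 in auto)
  also have "\<dots> = 1 / r * (r * m + r * (\<delta> * r))"
    unfolding sum.distrib sum_distrib_right[symmetric] r_def mean_missing_def ..
  also have "\<dots> = r * \<delta> + m" using r0 by (simp add: field_simps)
  finally show "\<bar>measure_pmf.prob (map_pmf (num_missing k \<alpha> n) (random_subset n p)) B
    - measure_pmf.prob (poisson_pmf (mean_missing k \<alpha> n p)) B\<bar>
    \<le> mean_missing k \<alpha> n p * (exp (error_const k * \<epsilon>) - 1) + m" by (simp add: r_def \<delta>_def)
qed

section \<open>The two ends of the target interval\<close>

text \<open>
  The density is parametrised by \<open>L\<close>, the value of \<open>\<lambda>\<^sub>j\<close> at the ends of the target interval up to
  lower order terms; the constant \<open>K\<close> is chosen so that \<open>p^k = K L / n^(k-1)\<close>.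
\<close>
locale edge_regime = sparse_regime +
  fixes \<alpha> L :: real
  assumes \<alpha>: "0 < \<alpha>" "\<alpha> < 1" and n1: "1 \<le> n" and L0: "0 < L"
    and pk: "p ^ k = fact k * fact (k - 1) / \<alpha> ^ (k - 1) * L / real n ^ (k - 1)"
begin

lemma scaled_power: "p ^ k * (y ^ (k - 1) / fact (k - 1)) / fact k = L * (y / (\<alpha> * n)) ^ (k - 1)"
  unfolding pk using \<alpha> n1 by (simp add: field_simps power_divide power_mult_distrib)

text \<open>
  By unimodality, \<open>j\<close> has at least as many representations as any \<open>i\<close> farther from the centre.
\<close>
lemma expected_reps_lower:
  assumes "i \<le> n" "i \<le> j" "i + j \<le> k * n"
  shows "L * (i / (\<alpha> * n)) ^ (k - 1) \<le> expected_reps n k p j"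
proof -
  have "real i ^ (k - 1) / fact (k - 1) \<le> real (card (sum_lists n k i))"
    by (rule card_sum_lists_bounds(1)[OF assms(1) k1])
  also have "\<dots> \<le> real (card (sum_lists n k j))"
    by (intro of_nat_mono card_sum_lists_unimodal assms)
  finally show ?thesis
    unfolding expected_reps_def scaled_power[symmetric] using p0
    by (intro divide_right_mono mult_left_mono) auto
qed

lemma expected_reps_upper:
  assumes "j \<le> n"
  shows "expected_reps n k p j \<le> L * ((real j + real k) / (\<alpha> * n)) ^ (k - 1)"
  unfolding expected_reps_def scaled_power[symmetric] using p0 card_sum_lists_bounds(2)[OF assms k1]
  by (intro divide_right_mono mult_left_mono) auto

definition "edge = nat \<lceil>\<alpha> * n\<rceil>"

lemma edge: "\<alpha> * n \<le> edge" "edge < \<alpha> * n + 1" "edge \<le> n"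
proof -
  have nn: "0 \<le> \<alpha> * n" using \<alpha> by simp
  then show "\<alpha> * n \<le> edge" "edge < \<alpha> * n + 1" unfolding edge_def by linarith+
  have "\<alpha> * n \<le> 1 * real n" using \<alpha> by (intro mult_right_mono) auto
  then show "edge \<le> n" unfolding edge_def by linarith
qed

text \<open>
  The target interval is symmetric under \<open>j \<mapsto> k n - j\<close>, so its upper end is determined by the
  same rounding as its lower end.
\<close>
lemma target_iff: "j \<in> targets k \<alpha> n \<longleftrightarrow> edge \<le> j \<and> edge + j \<le> k * n"
proof -
  have 1: "\<alpha> * n \<le> j \<longleftrightarrow> edge \<le> j" for j :: nat
    unfolding edge_def using \<alpha> by linarith
  have "edge + j \<le> k * n \<longleftrightarrow> j \<le> k * n \<and> edge \<le> k * n - j"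
    by auto
  also have "\<dots> \<longleftrightarrow> j \<le> k * n \<and> \<alpha> * n \<le> real k * real n - real j"
    using 1[of "k * n - j"] by (auto simp: of_nat_diff)
  also have "\<dots> \<longleftrightarrow> \<alpha> * n \<le> real k * real n - real j"
  proof -
    have "j \<le> k * n" if "\<alpha> * n \<le> real k * real n - real j"
    proof -
      have "0 \<le> \<alpha> * n" using \<alpha> by simp
      then have "real j \<le> real k * real n" using that by linarith
      then have "real j \<le> real (k * n)" by simp
      then show ?thesis by (simp only: of_nat_le_iff)
    qed
    then show ?thesis by blast
  qed
  finally have 2: "edge + j \<le> k * n \<longleftrightarrow> real j \<le> (real k - \<alpha>) * n"
    by (auto simp: algebra_simps)
  show ?thesis unfolding targets_def using 1[of j] 2 by simp
qed

lemma ratio_ge: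
  assumes "\<alpha> * n \<le> i" shows "1 \<le> i / (\<alpha> * n)"
  using assms \<alpha> n1 by simp

lemma expected_reps_target:
  assumes "j \<in> targets k \<alpha> n" shows "L \<le> expected_reps n k p j"
proof -
  have "1 \<le> (edge / (\<alpha> * n)) ^ (k - 1)"
    by (rule one_le_power[OF ratio_ge[OF edge(1)]])
  then have "L \<le> L * (edge / (\<alpha> * n)) ^ (k - 1)" using L0 by simp
  also have "\<dots> \<le> expected_reps n k p j"
    using assms edge by (intro expected_reps_lower) (auto simp: target_iff)
  finally show ?thesis .
qed

lemma miss_prob_target:
  assumes "j \<in> targets k \<alpha> n"
  shows "miss_prob n k p j \<le> exp (- L + error_const k * \<epsilon>)"
proof -
  note miss_prob_upper[of j]
  also have "exp (- expected_reps n k p j + error_const k * \<epsilon>) \<le> exp (- L + error_const k * \<epsilon>)"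
    using expected_reps_target[OF assms] by simp
  finally show ?thesis .
qed

lemma card_targets: "real (card (targets k \<alpha> n)) \<le> (real k + 1) * n"
proof -
  have "targets k \<alpha> n \<subseteq> {..k * n}" by (auto simp: target_iff)
  then have "card (targets k \<alpha> n) \<le> card {..k * n}" by (intro card_mono) auto
  then have "card (targets k \<alpha> n) \<le> (k + 1) * n" using n1 by simp
  then have "real (card (targets k \<alpha> n)) \<le> real ((k + 1) * n)" by (rule of_nat_mono)
  then show ?thesis by (simp add: algebra_simps)
qed

lemma mean_missing_crude: "mean_missing k \<alpha> n p \<le> (real k + 1) * n * exp (- L + error_const k * \<epsilon>)"
proof -
  have "mean_missing k \<alpha> n p \<le> (\<Sum>j\<in>targets k \<alpha> n. exp (- L + error_const k * \<epsilon>))"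
    unfolding mean_missing_def by (intro sum_mono miss_prob_target)
  also have "\<dots> = real (card (targets k \<alpha> n)) * exp (- L + error_const k * \<epsilon>)" by simp
  also have "\<dots> \<le> (real k + 1) * n * exp (- L + error_const k * \<epsilon>)"
    using card_targets by (intro mult_right_mono) auto
  finally show ?thesis .
qed

lemma tv_dist_crude:
  "tv_dist (map_pmf (num_missing k \<alpha> n) (random_subset n p)) (poisson_pmf (mean_missing k \<alpha> n p))
    \<le> exp (- L + error_const k * \<epsilon>) * ((real k + 1) * n * (exp (error_const k * \<epsilon>) - 1) + 1)"
proof -
  let ?t = "exp (- L + error_const k * \<epsilon>)" and ?d = "exp (error_const k * \<epsilon>) - 1"
  have "0 \<le> ?d" using \<epsilon>_nonneg by simp
  then have "mean_missing k \<alpha> n p * ?d \<le> (real k + 1) * n * ?t * ?d"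
    using mean_missing_crude by (intro mult_right_mono) auto
  then show ?thesis
    using tv_dist_num_missing_le[OF \<alpha> miss_prob_target] by (simp add: algebra_simps)
qed

definition "exp_reps_sum = (\<Sum>j\<in>targets k \<alpha> n. exp (- expected_reps n k p j))"

lemma mean_missing_exp_reps_sum:
  "exp (- (error_const k * \<epsilon>)) * exp_reps_sum \<le> mean_missing k \<alpha> n p"
  "mean_missing k \<alpha> n p \<le> exp (error_const k * \<epsilon>) * exp_reps_sum"
  unfolding exp_reps_sum_def mean_missing_def sum_distrib_left exp_add[symmetric]
  using miss_prob_lower miss_prob_upper by (auto intro!: sum_mono simp: add.commute)

abbreviation (input) "low_end \<equiv> {edge..<n}"

lemma reflect_expected_reps:
  assumes "j \<le> k * n" shows "expected_reps n k p (k * n - j) = expected_reps n k p j"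
  unfolding expected_reps_def card_sum_lists_reflect[OF assms] ..

text \<open>
  Reflection maps the targets below \<open>n\<close> onto those above \<open>(k - 1) n\<close> and preserves the number of
  representations. For \<open>k \<ge> 2\<close> the two ends are disjoint.
\<close>
lemma exp_reps_sum_split:
  "\<exists>mid. mid \<subseteq> {n..(k - 1) * n} \<and>
     exp_reps_sum = 2 * (\<Sum>j\<in>low_end. exp (- expected_reps n k p j)) + (\<Sum>j\<in>mid. exp (- expected_reps n k p j))"
proof -
  let ?f = "\<lambda>j. exp (- expected_reps n k p j)"
  let ?high = "(\<lambda>j. k * n - j) ` low_end"
  let ?mid = "targets k \<alpha> n - low_end - ?high"
  have kn: "2 * n \<le> k * n" using k2 by simp
  have low: "low_end \<subseteq> targets k \<alpha> n"
  proof
    fix j assume "j \<in> low_end"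
    then show "j \<in> targets k \<alpha> n" unfolding target_iff atLeastLessThan_iff using kn by linarith
  qed
  have high: "?high \<subseteq> targets k \<alpha> n - low_end"
  proof
    fix i assume "i \<in> ?high"
    then obtain j where "edge \<le> j" "j < n" "i = k * n - j" by auto
    then have "edge \<le> i" "edge + i \<le> k * n" "\<not> i < n" using kn by linarith+
    then show "i \<in> targets k \<alpha> n - low_end" by (simp add: target_iff)
  qed
  have inj: "inj_on (\<lambda>j. k * n - j) low_end"
  proof (rule inj_onI)
    fix i j assume "i \<in> low_end" "j \<in> low_end" "k * n - i = k * n - j"
    then show "i = j" using kn unfolding atLeastLessThan_iff by linarith
  qed
  have "exp_reps_sum = sum ?f (targets k \<alpha> n - low_end) + sum ?f low_end"
    unfolding exp_reps_sum_def by (rule sum.subset_diff[OF low]) simp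
  also have "sum ?f (targets k \<alpha> n - low_end) = sum ?f ?mid + sum ?f ?high"
    by (rule sum.subset_diff[OF high]) simp
  also have "sum ?f ?high = sum ?f low_end"
    unfolding sum.reindex[OF inj] o_def
  proof (intro sum.cong refl)
    fix j assume "j \<in> low_end"
    then have "j \<le> k * n" unfolding atLeastLessThan_iff using kn by linarith
    then show "exp (- expected_reps n k p (k * n - j)) = exp (- expected_reps n k p j)"
      by (simp only: reflect_expected_reps)
  qed
  finally have "exp_reps_sum = 2 * sum ?f low_end + sum ?f ?mid" by simp
  moreover have "?mid \<subseteq> {n..(k - 1) * n}"
  proof
    fix j assume j: "j \<in> ?mid"
    then have t: "edge \<le> j" "edge + j \<le> k * n" by (auto simp: target_iff)
    have "n \<le> j" using j t by auto
    moreover have "j \<le> (k - 1) * n"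
    proof (rule ccontr)
      assume "\<not> j \<le> (k - 1) * n"
      then have "k * n - j \<in> low_end" "j = k * n - (k * n - j)"
        using t k1 by (auto simp: diff_mult_distrib)
      then show False using j by blast
    qed
    ultimately show "j \<in> {n..(k - 1) * n}" by simp
  qed
  ultimately show ?thesis by blast
qed

text \<open>
  The ratio of the geometric sequence that \<open>exp (- \<lambda>\<^sub>j)\<close> follows near the lower end.
\<close>
definition "decay = exp (- (L * (k - 1 :: nat) / (\<alpha> * n)))"

lemma decay: "0 < decay" "decay < 1"
  using L0 \<alpha> n1 k2 unfolding decay_def by simp_all

text \<open>
  Bernoulli's inequality bounds \<open>(j / (\<alpha> n))^(k-1)\<close> from below by its tangent at \<open>j = \<alpha> n\<close>.
\<close>
lemma low_end_upper:
  "(\<Sum>j\<in>low_end. exp (- expected_reps n k p j)) \<le> exp (- L) / (1 - decay)"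
proof -
  have each: "exp (- expected_reps n k p (edge + i)) \<le> exp (- L) * decay ^ i" if "edge + i < n" for i
  proof -
    have an: "0 < \<alpha> * n" using \<alpha> n1 by simp
    have "1 + real (k - 1) * (i / (\<alpha> * n)) \<le> (1 + i / (\<alpha> * n)) ^ (k - 1)"
      using an by (intro Bernoulli_inequality) (simp add: order_trans[of _ 0])
    also have "\<dots> \<le> ((edge + i) / (\<alpha> * n)) ^ (k - 1)"
      using an edge(1) by (intro power_mono) (auto simp: field_simps)
    finally have "L * (1 + real (k - 1) * (i / (\<alpha> * n))) \<le> L * ((edge + i) / (\<alpha> * n)) ^ (k - 1)"
      using L0 by (intro mult_left_mono) auto
    also have "\<dots> \<le> expected_reps n k p (edge + i)"
    proof (rule order_trans[OF _ expected_reps_lower[of "edge + i"]])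
      have "2 * n \<le> k * n" using k2 by simp
      then show "(edge + i) + (edge + i) \<le> k * n" using that by linarith
    qed (use that in auto)
    finally have "exp (- expected_reps n k p (edge + i)) \<le> exp (- (L * (1 + real (k - 1) * (i / (\<alpha> * n)))))"
      by simp
    also have "\<dots> = exp (- L) * decay ^ i"
      unfolding decay_def exp_of_nat_mult[symmetric] exp_add[symmetric] by (simp add: algebra_simps)
    finally show ?thesis .
  qed
  have "(\<Sum>j\<in>low_end. exp (- expected_reps n k p j)) = (\<Sum>i<n - edge. exp (- expected_reps n k p (edge + i)))"
    by (rule sum.reindex_bij_witness[of _ "\<lambda>i. edge + i" "\<lambda>j. j - edge"]) auto
  also have "\<dots> \<le> (\<Sum>i<n - edge. exp (- L) * decay ^ i)"
    by (intro sum_mono each) auto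
  also have "\<dots> = exp (- L) * ((1 - decay ^ (n - edge)) / (1 - decay))"
    unfolding sum_distrib_left[symmetric] using decay by (simp add: sum_gp_strict)
  also have "\<dots> \<le> exp (- L) * (1 / (1 - decay))"
    using decay by (intro mult_left_mono divide_right_mono) auto
  finally show ?thesis by simp
qed

text \<open>
  Only the first \<open>m\<close> targets are kept. With \<open>d = k - 1\<close> and \<open>u \<le> v\<close> the relative distance from the edge,
  \<open>(1 + u)^d \<le> exp (d u) \<le> 1 + d u + (d v)\<^sup>2\<close>, so the deviation from the tangent costs the
  factor \<open>exp (- L (d v)\<^sup>2)\<close>. The shift \<open>k + 1\<close> in \<open>v\<close> and in the power of \<open>decay\<close> comes from
  rounding \<open>\<alpha> n\<close> up and from the difference between \<open>j\<close> and \<open>j + k\<close> in \<open>expected_reps_upper\<close>.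
\<close>
lemma low_end_lower:
  assumes m: "edge + m \<le> n" and v: "v = (m + k + 1) / (\<alpha> * n)" "real (k - 1) * v \<le> 1"
  shows "exp (- L) * exp (- (L * (real (k - 1) * v)\<^sup>2)) * decay ^ (k + 1) * ((1 - decay ^ m) / (1 - decay))
     \<le> (\<Sum>j\<in>low_end. exp (- expected_reps n k p j))"
proof -
  let ?d = "real (k - 1)"
  have an: "0 < \<alpha> * n" using \<alpha> n1 by simp
  have each: "exp (- L) * exp (- (L * (?d * v)\<^sup>2)) * decay ^ (k + 1) * decay ^ i
      \<le> exp (- expected_reps n k p (edge + i))" if "i < m" for i
  proof -
    define u where "u = (i + k + 1) / (\<alpha> * n)"
    have u: "0 \<le> u" "u \<le> v" unfolding u_def v(1) using that an by (auto intro!: divide_right_mono)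
    have du: "0 \<le> ?d * u" "?d * u \<le> ?d * v" using u by (auto intro: mult_left_mono)
    have "expected_reps n k p (edge + i) \<le> L * ((real (edge + i) + real k) / (\<alpha> * n)) ^ (k - 1)"
      using that m by (intro expected_reps_upper) auto
    also have "\<dots> \<le> L * (1 + u) ^ (k - 1)"
    proof (intro mult_left_mono power_mono)
      have "(real (edge + i) + real k) / (\<alpha> * n) \<le> (\<alpha> * n + (i + k + 1)) / (\<alpha> * n)"
        using edge(2) an by (intro divide_right_mono) auto
      also have "\<dots> = 1 + u" using \<alpha> n1 by (simp add: u_def add_divide_distrib)
      finally show "(real (edge + i) + real k) / (\<alpha> * n) \<le> 1 + u" .
    qed (use an L0 in auto)
    also have "\<dots> \<le> L * exp u ^ (k - 1)"
      using u L0 by (intro mult_left_mono power_mono exp_ge_add_one_self) auto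
    also have "\<dots> = L * exp (?d * u)" by (simp add: exp_of_nat_mult)
    also have "\<dots> \<le> L * (1 + ?d * u + (?d * u)\<^sup>2)"
      using du v(2) L0 by (intro mult_left_mono exp_bound) auto
    also have "\<dots> \<le> L * (1 + ?d * u + (?d * v)\<^sup>2)"
      using power_mono[OF du(2,1), of 2] L0 by (intro mult_left_mono) auto
    finally have "exp (- (L * (1 + ?d * u + (?d * v)\<^sup>2))) \<le> exp (- expected_reps n k p (edge + i))" by simp
    moreover have "exp (- (L * (1 + ?d * u + (?d * v)\<^sup>2)))
       = exp (- L) * exp (- (L * (?d * v)\<^sup>2)) * decay ^ (k + 1) * decay ^ i"
      unfolding decay_def mult.assoc power_add[symmetric] exp_of_nat_mult[symmetric] exp_add[symmetric] u_def
      by (simp add: algebra_simps add_divide_distrib)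
    ultimately show ?thesis by (simp only:)
  qed
  have "exp (- L) * exp (- (L * (?d * v)\<^sup>2)) * decay ^ (k + 1) * ((1 - decay ^ m) / (1 - decay))
     = (\<Sum>i<m. exp (- L) * exp (- (L * (?d * v)\<^sup>2)) * decay ^ (k + 1) * decay ^ i)"
    unfolding sum_distrib_left[symmetric] using decay by (simp add: sum_gp_strict)
  also have "\<dots> \<le> (\<Sum>i<m. exp (- expected_reps n k p (edge + i)))"
    by (intro sum_mono each) auto
  also have "\<dots> = (\<Sum>j\<in>{edge..<edge + m}. exp (- expected_reps n k p j))"
    by (rule sum.reindex_bij_witness[of _ "\<lambda>j. j - edge" "\<lambda>i. edge + i"]) auto
  also have "\<dots> \<le> (\<Sum>j\<in>low_end. exp (- expected_reps n k p j))"
    using m by (intro sum_mono2) auto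
  finally show ?thesis .
qed

text \<open>
  A target \<open>j\<close> in the middle has at least as many representations as \<open>n\<close>, so \<open>\<lambda>\<^sub>j\<close> is at
  least \<open>(1 / \<alpha>)^(k-1) L\<close>, a fixed proportion above \<open>L\<close>.
\<close>
lemma exp_reps_sum_upper:
  "exp_reps_sum \<le> 2 * (exp (- L) / (1 - decay)) + (real k + 1) * n * exp (- (L * (1 / \<alpha>) ^ (k - 1)))"
proof -
  obtain mid where mid: "mid \<subseteq> {n..(k - 1) * n}"
    and split: "exp_reps_sum = 2 * (\<Sum>j\<in>low_end. exp (- expected_reps n k p j)) + (\<Sum>j\<in>mid. exp (- expected_reps n k p j))"
    using exp_reps_sum_split by blast
  have "(\<Sum>j\<in>mid. exp (- expected_reps n k p j)) \<le> (\<Sum>j\<in>mid. exp (- (L * (1 / \<alpha>) ^ (k - 1))))"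
  proof (rule sum_mono)
    fix j assume "j \<in> mid"
    then have j: "n \<le> j" "j \<le> (k - 1) * n" using mid by auto
    then have "n + j \<le> k * n" using k1 by (simp add: diff_mult_distrib)
    then have "L * (n / (\<alpha> * n)) ^ (k - 1) \<le> expected_reps n k p j"
      using j by (intro expected_reps_lower) auto
    then show "exp (- expected_reps n k p j) \<le> exp (- (L * (1 / \<alpha>) ^ (k - 1)))"
      using n1 by simp
  qed
  also have "\<dots> = card mid * exp (- (L * (1 / \<alpha>) ^ (k - 1)))" by simp
  also have "\<dots> \<le> (real k + 1) * n * exp (- (L * (1 / \<alpha>) ^ (k - 1)))"
  proof (intro mult_right_mono)
    have "card mid \<le> card {..k * n}"
    proof (intro card_mono subsetI)
      fix j assume "j \<in> mid"
      then have "j \<le> (k - 1) * n" using mid by auto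
      also have "\<dots> \<le> k * n" by (intro mult_right_mono) auto
      finally show "j \<in> {..k * n}" by simp
    qed simp
    then have "card mid \<le> (k + 1) * n" using n1 by simp
    then have "real (card mid) \<le> real ((k + 1) * n)" by (rule of_nat_mono)
    then show "real (card mid) \<le> (real k + 1) * n" by (simp add: algebra_simps)
  qed simp
  finally show ?thesis unfolding split using low_end_upper by simp
qed

lemma exp_reps_sum_lower:
  assumes m: "edge + m \<le> n" and v: "v = (m + k + 1) / (\<alpha> * n)" "real (k - 1) * v \<le> 1"
  shows "2 * (exp (- L) * exp (- (L * (real (k - 1) * v)\<^sup>2)) * decay ^ (k + 1) * ((1 - decay ^ m) / (1 - decay)))
     \<le> exp_reps_sum"
proof -
  obtain mid where
    split: "exp_reps_sum = 2 * (\<Sum>j\<in>low_end. exp (- expected_reps n k p j)) + (\<Sum>j\<in>mid. exp (- expected_reps n k p j))"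
    using exp_reps_sum_split by blast
  have "0 \<le> (\<Sum>j\<in>mid. exp (- expected_reps n k p j))" by (intro sum_nonneg) auto
  then show ?thesis unfolding split using low_end_lower[OF assms] by linarith
qed


text \<open>
  The mean is multiplied by \<open>L exp L / n\<close>, the reciprocal of its order of magnitude, so that only
  \<open>L / n\<close>, \<open>L\<close> and \<open>\<epsilon>\<close> remain and the limit can be read off.
\<close>
lemma mean_missing_scaled_upper:
  "mean_missing k \<alpha> n p * (L * exp L / n) \<le> exp (error_const k * \<epsilon>) *
     (2 * ((L / n) / (1 - exp (- (real (k - 1) / \<alpha> * (L / n)))))
      + (real k + 1) * (L * exp (- (L * ((1 / \<alpha>) ^ (k - 1) - 1)))))"
proof -
  have d: "decay = exp (- (real (k - 1) / \<alpha> * (L / n)))"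
    by (simp add: decay_def mult.commute)
  have "mean_missing k \<alpha> n p \<le> exp (error_const k * \<epsilon>) *
      (2 * (exp (- L) / (1 - decay)) + (real k + 1) * n * exp (- (L * (1 / \<alpha>) ^ (k - 1))))"
    by (rule order_trans[OF mean_missing_exp_reps_sum(2)]) (intro mult_left_mono exp_reps_sum_upper; simp)
  then have "mean_missing k \<alpha> n p * (L * exp L / n) \<le> exp (error_const k * \<epsilon>) *
      (2 * (exp (- L) / (1 - decay)) + (real k + 1) * n * exp (- (L * (1 / \<alpha>) ^ (k - 1)))) * (L * exp L / n)"
    using L0 by (intro mult_right_mono) auto
  also have "\<dots> = exp (error_const k * \<epsilon>) *
     (2 * ((exp (- L) * exp L) * ((L / n) / (1 - decay)))
      + (real k + 1) * (L * (exp (- (L * (1 / \<alpha>) ^ (k - 1))) * exp L)))"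
    using n1 by (simp add: distrib_left distrib_right mult_ac)
  also have "exp (- (L * (1 / \<alpha>) ^ (k - 1))) * exp L = exp (- (L * ((1 / \<alpha>) ^ (k - 1) - 1)))"
    unfolding exp_add[symmetric] by (simp add: algebra_simps)
  finally show ?thesis unfolding d by (simp add: exp_minus_inverse exp_minus)
qed

lemma mean_missing_scaled_lower:
  assumes m: "\<alpha> * n + 1 + real m \<le> n" and v: "v = (m + k + 1) / (\<alpha> * n)" "real (k - 1) * v \<le> 1"
  shows "exp (- (error_const k * \<epsilon>)) * (2 * (exp (- (L * (real (k - 1) * v)\<^sup>2))
      * exp (- (real (k - 1) / \<alpha> * (L / n))) ^ (k + 1)
      * (1 - exp (- (real (k - 1) / \<alpha> * (L / n * m))))
      * ((L / n) / (1 - exp (- (real (k - 1) / \<alpha> * (L / n)))))))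
     \<le> mean_missing k \<alpha> n p * (L * exp L / n)"
proof -
  have d: "decay = exp (- (real (k - 1) / \<alpha> * (L / n)))"
    by (simp add: decay_def mult.commute)
  have dm: "decay ^ m = exp (- (real (k - 1) / \<alpha> * (L / n * m)))"
    unfolding d exp_of_nat_mult[symmetric] by (simp add: mult_ac)
  have em: "edge + m \<le> n" using m edge(2) by linarith
  let ?X = "exp (- (L * (real (k - 1) * v)\<^sup>2)) * decay ^ (k + 1) * (1 - decay ^ m)"
  have "exp (- (error_const k * \<epsilon>)) * (2 * (exp (- L) * exp (- (L * (real (k - 1) * v)\<^sup>2)) * decay ^ (k + 1) * ((1 - decay ^ m) / (1 - decay))))
    \<le> mean_missing k \<alpha> n p"
    by (rule order_trans[OF _ mean_missing_exp_reps_sum(1)]) (intro mult_left_mono exp_reps_sum_lower[OF em v]; simp)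
  then have 1: "exp (- (error_const k * \<epsilon>)) * (2 * (exp (- L) * exp (- (L * (real (k - 1) * v)\<^sup>2)) * decay ^ (k + 1) * ((1 - decay ^ m) / (1 - decay))))
     * (L * exp L / n) \<le> mean_missing k \<alpha> n p * (L * exp L / n)"
    using L0 by (intro mult_right_mono) auto
  have 2: "exp (- (error_const k * \<epsilon>)) * (2 * (exp (- L) * exp (- (L * (real (k - 1) * v)\<^sup>2)) * decay ^ (k + 1) * ((1 - decay ^ m) / (1 - decay))))
     * (L * exp L / n) = exp (- (error_const k * \<epsilon>)) * (2 * ((exp (- L) * exp L) * (?X * ((L / n) / (1 - decay)))))"
    by (simp add: mult_ac)
  have el: "exp (- L) * exp L = 1" by (simp add: exp_minus)
  show ?thesis using 1 unfolding 2 el mult_1_left dm[symmetric] d[symmetric] .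
qed

end

section \<open>Limits at the threshold\<close>

text \<open>
  Covers both parts of the theorem: \<open>L = log n - log log n + A\<^sub>n / K\<close> with \<open>\<beta> = 1\<close>, and
  \<open>L = \<beta> log n\<close>.
\<close>
locale threshold_sequence =
  fixes k :: nat and \<alpha> K \<beta> :: real and L p :: "nat \<Rightarrow> real"
  assumes k2: "2 \<le> k" and \<alpha>: "0 < \<alpha>" "\<alpha> < 1"
    and K: "K = fact k * fact (k - 1) / \<alpha> ^ (k - 1)"
    and \<beta>: "0 < \<beta>" and L: "(\<lambda>n. L n / ln (real n)) \<longlonglongrightarrow> \<beta>"
    and p: "\<forall>\<^sub>F n in sequentially. p n = root k (K * L n / real n ^ (k - 1))"
begin

lemma K_pos: "0 < K" using \<alpha> by (simp add: K)

lemma L_eq: "\<forall>\<^sub>F n in sequentially. L n / ln (real n) * ln (real n) = L n"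
  using eventually_gt_at_top[of 1] by eventually_elim simp

lemma L_at_top: "filterlim L at_top sequentially"
proof -
  have "filterlim (\<lambda>n. L n / ln (real n) * ln (real n)) at_top sequentially"
    by (rule filterlim_tendsto_pos_mult_at_top[OF L \<beta>]) real_asymp
  then show ?thesis using filterlim_cong[OF refl refl L_eq] by simp
qed

lemma L_over_n: "(\<lambda>n. L n / real n) \<longlonglongrightarrow> 0"
proof -
  have "(\<lambda>n. L n / ln (real n) * (ln (real n) / real n)) \<longlonglongrightarrow> \<beta> * 0"
    by (rule tendsto_mult[OF L]) real_asymp
  then have "(\<lambda>n. L n / ln (real n) * (ln (real n) / real n)) \<longlonglongrightarrow> 0" by simp
  moreover have "\<forall>\<^sub>F n in sequentially. L n / ln (real n) * (ln (real n) / real n) = L n / real n"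
    using eventually_gt_at_top[of 1] by eventually_elim simp
  ultimately show ?thesis by (rule Lim_transform_eventually)
qed

lemma L_gt: "\<forall>\<^sub>F n in sequentially. c < L n"
  using L_at_top by (simp add: filterlim_at_top_dense)

lemma p_tendsto_0: "p \<longlonglongrightarrow> 0"
proof -
  have "(\<lambda>n. K * L n / real n ^ (k - 1)) \<longlonglongrightarrow> 0"
  proof (rule tendsto_sandwich)
    show "\<forall>\<^sub>F n in sequentially. 0 \<le> K * L n / real n ^ (k - 1)"
      using L_gt[of 0] by eventually_elim (use K_pos in simp)
    show "\<forall>\<^sub>F n in sequentially. K * L n / real n ^ (k - 1) \<le> K * (L n / real n)"
      using L_gt[of 0] eventually_ge_at_top[of 1]
    proof eventually_elim
      case (elim n)
      have "real n ^ 1 \<le> real n ^ (k - 1)" using k2 elim by (intro power_increasing) auto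
      then show ?case using elim K_pos by (simp add: frac_le)
    qed
    show "(\<lambda>n. K * (L n / real n)) \<longlonglongrightarrow> 0"
      using tendsto_mult_right_zero[OF L_over_n] by simp
  qed simp
  then have "(\<lambda>n. root k (K * L n / real n ^ (k - 1))) \<longlonglongrightarrow> root k 0"
    by (rule tendsto_real_root)
  then show ?thesis using filterlim_cong[OF refl refl p] by simp
qed

lemma p_power: "\<forall>\<^sub>F n in sequentially. p n ^ k = K * L n / real n ^ (k - 1)"
  using p L_gt[of 0]
proof eventually_elim
  case (elim n)
  have "0 \<le> K * L n / real n ^ (k - 1)" using elim K_pos by simp
  then show ?case unfolding elim(1) using k2 by (intro real_root_pow_pos2) auto
qed

lemma p_nonneg: "\<forall>\<^sub>F n in sequentially. 0 \<le> p n"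
  using p L_gt[of 0]
proof eventually_elim
  case (elim n)
  then show ?case using K_pos by (auto intro!: real_root_ge_zero)
qed

text \<open>
  Here \<open>x^k = (n + 1)^k K L / n^(k-1)\<close> lies between \<open>(n + 1) K L\<close> and
  \<open>(n + 1) 2^(k-1) K L\<close>; for large \<open>n\<close>, \<open>K L \<ge> 1\<close> and \<open>L \<le> (\<beta> + 1) log n\<close>.
\<close>
lemma mean_size_power:
  "\<forall>\<^sub>F n in sequentially. real n + 1 \<le> mean_size n (p n) ^ k
     \<and> mean_size n (p n) ^ k \<le> (real n + 1) * (2 ^ (k - 1) * K * (\<beta> + 1) * ln (real n))"
proof -
  have "\<forall>\<^sub>F n in sequentially. L n / ln (real n) < \<beta> + 1"
    by (rule order_tendstoD(2)[OF L]) simp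
  then show ?thesis using p_power L_gt[of "1 / K"] L_gt[of 0] eventually_gt_at_top[of 1]
  proof eventually_elim
    case (elim n)
    have KL: "1 \<le> K * L n" using elim K_pos by (simp add: field_simps)
    have up: "L n \<le> (\<beta> + 1) * ln (real n)" using elim by (simp add: field_simps)
    define w where "w = (real n + 1) ^ (k - 1) / real n ^ (k - 1)"
    have w: "1 \<le> w" "w \<le> 2 ^ (k - 1)"
    proof -
      have "1 \<le> ((real n + 1) / real n) ^ (k - 1)" using elim by (intro one_le_power) auto
      then show "1 \<le> w" unfolding w_def by (simp add: power_divide)
      have "((real n + 1) / real n) ^ (k - 1) \<le> 2 ^ (k - 1)"
        using elim by (intro power_mono) (auto simp: field_simps)
      then show "w \<le> 2 ^ (k - 1)" unfolding w_def by (simp add: power_divide)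
    qed
    have "(real n + 1) ^ k = (real n + 1) * (real n + 1) ^ (k - 1)"
      using k2 by (simp flip: power_Suc)
    then have e: "mean_size n (p n) ^ k = (real n + 1) * (w * (K * L n))"
      unfolding mean_size_def power_mult_distrib elim w_def by simp
    have "1 * 1 \<le> w * (K * L n)" using w KL by (intro mult_mono) auto
    moreover have "w * (K * L n) \<le> 2 ^ (k - 1) * (K * ((\<beta> + 1) * ln (real n)))"
      using w up KL K_pos by (intro mult_mono mult_left_mono) auto
    ultimately show ?case unfolding e
      by (auto simp: mult.assoc intro!: mult_left_mono)
  qed
qed

lemma eventually_edge_regime: "\<forall>\<^sub>F n in sequentially. edge_regime n k (p n) \<alpha> (L n)"
proof -
  have "\<forall>\<^sub>F n in sequentially. p n < 1/2" by (rule order_tendstoD(2)[OF p_tendsto_0]) simp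
  then show ?thesis
    using mean_size_power p_power p_nonneg L_gt[of 0] eventually_ge_at_top[of 1]
  proof eventually_elim
    case (elim n)
    show ?case
      by unfold_locales (use elim k2 \<alpha> in \<open>auto simp: K\<close>)
  qed
qed

text \<open>
  Writing \<open>x^(2k-1) = (x^k)\<^sup>2 / x\<close> with \<open>x^k = O(n log n)\<close> and \<open>x \<ge> n^(1/k)\<close> bounds \<open>\<epsilon>\<close> by a
  multiple of \<open>(log n)\<^sup>2 n^(-1/k)\<close>.
\<close>
lemma overlap_error_bound:
  obtains M where "0 < M" "\<forall>\<^sub>F n in sequentially. overlap_error n k (p n) \<le> M * ((ln (real n))\<^sup>2 * real n powr (- (1 / k)))"
proof -
  define M where "M = 2 ^ (k - 1) * K * (\<beta> + 1)"
  have M0: "0 < M" unfolding M_def using K_pos \<beta> by simp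
  have "\<forall>\<^sub>F n in sequentially. overlap_error n k (p n) \<le> M\<^sup>2 * ((ln (real n))\<^sup>2 * real n powr (- (1 / k)))"
    using mean_size_power p_nonneg eventually_gt_at_top[of 1]
  proof eventually_elim
    case (elim n)
    let ?x = "mean_size n (p n)" and ?N = "real n + 1" and ?y = "real n powr (1 / k)"
    have x0: "0 \<le> ?x" using elim by (simp add: mean_size_def)
    have y: "?y ^ k = real n" using elim k2 by (simp add: powr_power)
    have y0: "0 < ?y" using elim by simp
    have yx: "?y \<le> ?x"
    proof (rule power_le_imp_le_base)
      show "?y ^ Suc (k - 1) \<le> ?x ^ Suc (k - 1)" using elim k2 y by simp
    qed (rule x0)
    have xk: "?x ^ k \<le> ?N * (M * ln (real n))" using elim unfolding M_def by simp
    have "?x * ?x ^ (2 * k - 1) = (?x ^ k)\<^sup>2"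
    proof -
      have "Suc (2 * k - 1) = k * 2" using k2 by simp
      then show ?thesis unfolding power_Suc[symmetric] power_mult[symmetric] by simp
    qed
    also have "\<dots> \<le> (?N * (M * ln (real n)))\<^sup>2"
      using xk x0 by (intro power_mono) auto
    finally have 1: "?x * ?x ^ (2 * k - 1) \<le> (?N * (M * ln (real n)))\<^sup>2" .
    have "?y * ?x ^ (2 * k - 1) \<le> ?x * ?x ^ (2 * k - 1)"
      using yx x0 by (intro mult_right_mono) auto
    then have "?y * ?x ^ (2 * k - 1) \<le> ?N\<^sup>2 * (M * ln (real n))\<^sup>2"
      using 1 by (simp add: power_mult_distrib)
    then have "?x ^ (2 * k - 1) / ?N\<^sup>2 \<le> (M * ln (real n))\<^sup>2 / ?y"
      using y0 by (simp add: field_simps)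
    then show ?case
      unfolding overlap_error_def by (simp add: power_mult_distrib powr_minus_divide)
  qed
  then show ?thesis using M0 by (intro that[of "M\<^sup>2"]) auto
qed

lemma overlap_error_nonneg: "\<forall>\<^sub>F n in sequentially. 0 \<le> overlap_error n k (p n)"
  using p_nonneg by eventually_elim (simp add: overlap_error_def mean_size_def)

lemma overlap_error_tendsto_0: "(\<lambda>n. error_const k * overlap_error n k (p n)) \<longlonglongrightarrow> 0"
proof -
  obtain M where M: "\<forall>\<^sub>F n in sequentially. overlap_error n k (p n) \<le> M * ((ln (real n))\<^sup>2 * real n powr (- (1 / k)))"
    using overlap_error_bound by blast
  have "0 < 1 / real k" using k2 by simp
  then have "(\<lambda>n. (ln (real n))\<^sup>2 * real n powr (- (1 / k))) \<longlonglongrightarrow> 0"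
    by real_asymp
  then have "(\<lambda>n. M * ((ln (real n))\<^sup>2 * real n powr (- (1 / k)))) \<longlonglongrightarrow> 0"
    by (rule tendsto_mult_right_zero)
  then have "(\<lambda>n. overlap_error n k (p n)) \<longlonglongrightarrow> 0"
    by (rule tendsto_sandwich[OF overlap_error_nonneg M tendsto_const])
  then show ?thesis by (rule tendsto_mult_right_zero)
qed

text \<open>
  The mean is at most \<open>n^(1-b)\<close> up to a constant for every \<open>b < \<beta>\<close>, and the exponent
  \<open>1 - b - 1/k\<close> of its product with \<open>\<epsilon>\<close> is negative when \<open>b\<close> is chosen above \<open>(k-1)/k\<close>.
\<close>
theorem poisson_approximation:
  assumes "(real k - 1) / real k < \<beta>"
  shows "(\<lambda>n. tv_dist (map_pmf (num_missing k \<alpha> n) (random_subset n (p n)))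
            (poisson_pmf (mean_missing k \<alpha> n (p n)))) \<longlonglongrightarrow> 0"
proof -
  obtain M where M: "0 < M" "\<forall>\<^sub>F n in sequentially. overlap_error n k (p n) \<le> M * ((ln (real n))\<^sup>2 * real n powr (- (1 / k)))"
    using overlap_error_bound by blast
  define C where "C = error_const k"
  obtain b where b: "(real k - 1) / real k < b" "b < \<beta>" using assms dense by blast
  define s where "s = b + 1 / k - 1"
  have kk: "(real k - 1) / real k = 1 - 1 / real k" using k2 by (simp add: field_simps)
  have s0: "0 < s" using b(1) unfolding s_def kk by simp
  have "0 \<le> (real k - 1) / real k" using k2 by simp
  then have b0: "0 < b" using b(1) by linarith
  have C0: "0 \<le> C" unfolding C_def by simp
  have bound: "\<forall>\<^sub>F n in sequentially. tv_dist (map_pmf (num_missing k \<alpha> n) (random_subset n (p n)))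
            (poisson_pmf (mean_missing k \<alpha> n (p n)))
     \<le> exp 1 * ((real k + 1) * (2 * C * M) * ((ln (real n))\<^sup>2 * real n powr (- s)) + real n powr (- b))"
  proof -
    have "\<forall>\<^sub>F n in sequentially. b < L n / ln (real n)"
      by (rule order_tendstoD(1)[OF L b(2)])
    moreover have "\<forall>\<^sub>F n in sequentially. C * overlap_error n k (p n) < 1"
      unfolding C_def by (rule order_tendstoD(2)[OF overlap_error_tendsto_0]) simp
    ultimately show ?thesis
      using M(2) overlap_error_nonneg eventually_edge_regime eventually_gt_at_top[of 1]
    proof eventually_elim
      case (elim n)
      interpret edge_regime n k "p n" \<alpha> "L n" by (rule elim)
      define e where "e = C * overlap_error n k (p n)"
      have e: "0 \<le> e" "e \<le> 1" unfolding e_def using elim C0 by auto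
      have n: "0 < real n" "0 < ln (real n)" using elim by auto
      have "exp e \<le> 1 + e + e\<^sup>2" by (rule exp_bound[OF e])
      also have "e\<^sup>2 \<le> e" using e by (simp add: power2_eq_square mult_left_le)
      finally have ee: "exp e - 1 \<le> 2 * e" by simp
      also have "\<dots> \<le> 2 * (C * (M * ((ln (real n))\<^sup>2 * real n powr (- (1 / k)))))"
        unfolding e_def using elim C0 by (intro mult_left_mono) auto
      finally have "(real k + 1) * n * (exp e - 1) + 1
        \<le> (real k + 1) * n * (2 * (C * (M * ((ln (real n))\<^sup>2 * real n powr (- (1 / k)))))) + 1"
        by (intro add_right_mono mult_left_mono) auto
      moreover have "exp (- L n + e) \<le> exp 1 * real n powr (- b)"
      proof -
        have "b * ln (real n) \<le> L n" using elim n by (simp add: field_simps)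
        then have "exp (- L n + e) \<le> exp (1 + - b * ln (real n))" using e by simp
        then show ?thesis unfolding exp_add powr_def using n by simp
      qed
      ultimately have "exp (- L n + e) * ((real k + 1) * n * (exp e - 1) + 1)
        \<le> exp 1 * real n powr (- b) * ((real k + 1) * n * (2 * (C * (M * ((ln (real n))\<^sup>2 * real n powr (- (1 / k)))))) + 1)"
        using e by (intro mult_mono) auto
      also have "\<dots> = exp 1 * ((real k + 1) * (2 * C * M) * ((ln (real n))\<^sup>2 * (real n powr (- b) * (n * real n powr (- (1 / k))))) + real n powr (- b))"
        by (simp add: algebra_simps)
      also have "real n powr (- b) * (n * real n powr (- (1 / k))) = real n powr (- s)"
      proof -
        have "real n powr (- b) * (real n powr 1 * real n powr (- (1 / k))) = real n powr (- s)"
          unfolding powr_add[symmetric] s_def by (simp add: algebra_simps)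
        then show ?thesis using n by simp
      qed
      finally show ?case using tv_dist_crude unfolding e_def C_def by linarith
    qed
  qed
  have "(\<lambda>n. (ln (real n))\<^sup>2 * real n powr (- s)) \<longlonglongrightarrow> 0"
    using s0 by real_asymp
  moreover have "(\<lambda>n. real n powr (- b)) \<longlonglongrightarrow> 0"
    using b0 by real_asymp
  ultimately have "(\<lambda>n. exp 1 * ((real k + 1) * (2 * C * M) * ((ln (real n))\<^sup>2 * real n powr (- s)) + real n powr (- b))) \<longlonglongrightarrow> exp 1 * ((real k + 1) * (2 * C * M) * 0 + 0)"
    by (intro tendsto_intros)
  then have lim: "(\<lambda>n. exp 1 * ((real k + 1) * (2 * C * M) * ((ln (real n))\<^sup>2 * real n powr (- s)) + real n powr (- b))) \<longlonglongrightarrow> 0"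
    by simp
  show ?thesis
    by (rule tendsto_sandwich[OF _ bound tendsto_const lim]) (simp add: tv_dist_nonneg)
qed

lemma geometric_factor:
  assumes "0 < c"
  shows "(\<lambda>n. (L n / real n) / (1 - exp (- (c * (L n / real n))))) \<longlonglongrightarrow> 1 / c"
proof -
  have "((\<lambda>t::real. t / (1 - exp (- (c * t)))) \<longlongrightarrow> inverse c) (at_right 0)"
    using assms by real_asymp
  then have "((\<lambda>t::real. t / (1 - exp (- (c * t)))) \<longlongrightarrow> 1 / c) (at_right 0)"
    unfolding inverse_eq_divide .
  moreover have "filterlim (\<lambda>n. L n / real n) (at_right 0) sequentially"
    unfolding filterlim_at using L_over_n
  proof (intro conjI)
    show "\<forall>\<^sub>F n in sequentially. L n / real n \<in> {0<..} \<and> L n / real n \<noteq> 0"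
      using L_gt[of 0] eventually_gt_at_top[of 0] by eventually_elim simp
  qed
  ultimately show ?thesis by (rule filterlim_compose)
qed

text \<open>
  Both ends together give \<open>2 G\<close>, where \<open>G = (L/n) / (1 - exp (- c L/n))\<close> with \<open>c = (k-1)/\<alpha>\<close> is
  the scaled geometric series and tends to \<open>1/c\<close>. In the lower bound the number \<open>m\<close> of retained
  targets must satisfy \<open>m L / n \<rightarrow> \<infinity>\<close>, so that the truncated geometric series is
  complete in the limit, and \<open>L (m/n)\<^sup>2 \<rightarrow> 0\<close>, so that the curvature of the power does not matter.
\<close>
theorem mean_asymptotics:
  "(\<lambda>n. mean_missing k \<alpha> n (p n) * (L n * exp (L n) / real n)) \<longlonglongrightarrow> 2 * \<alpha> / (real k - 1)"
proof -
  let ?\<epsilon> = "\<lambda>n. error_const k * overlap_error n k (p n)"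
  define d where "d = real (k - 1)"
  define c where "c = d / \<alpha>"
  have d0: "0 < d" unfolding d_def using k2 by simp
  have c0: "0 < c" unfolding c_def using d0 \<alpha> by simp
  define G where "G = (\<lambda>n. (L n / real n) / (1 - exp (- (c * (L n / real n)))))"
  have G: "G \<longlonglongrightarrow> 1 / c" unfolding G_def by (rule geometric_factor[OF c0])
  \<comment> \<open>Any exponent strictly between \<open>-1\<close> and \<open>-1/2\<close> meets both requirements.\<close>
  define m where "m = (\<lambda>n. nat \<lfloor>real n * L n powr (- (2/3))\<rfloor>)"
  define v where "v = (\<lambda>n. (m n + k + 1) / (\<alpha> * n))"
  have limit: "2 * \<alpha> / (real k - 1) = 2 * (1 / c)" unfolding c_def d_def using k2 by (simp add: of_nat_diff)
  have m_upper: "\<forall>\<^sub>F n in sequentially. real (m n) / real n \<le> L n powr (- (2/3))"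
    using eventually_gt_at_top[of 0]
  proof eventually_elim
    case (elim n)
    have "0 \<le> real n * L n powr (- (2/3))" by simp
    then have "real (m n) \<le> real n * L n powr (- (2/3))" unfolding m_def by linarith
    then show ?case using elim by (simp add: field_simps)
  qed
  have m_lower: "real n * L n powr (- (2/3)) - 1 \<le> real (m n)" for n
    unfolding m_def by linarith
  have w0: "(\<lambda>n. L n powr (- (2/3))) \<longlonglongrightarrow> 0"
    by (rule filterlim_compose[OF _ L_at_top]) real_asymp
  have kn0: "(\<lambda>n. (real k + 1) / real n) \<longlonglongrightarrow> 0" by real_asymp
  have v_upper: "\<forall>\<^sub>F n in sequentially. v n \<le> (L n powr (- (2/3)) + (real k + 1) / real n) / \<alpha>"
    using m_upper
  proof eventually_elim
    case (elim n)
    have "v n = (real (m n) / n + (real k + 1) / n) / \<alpha>"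
      unfolding v_def by (simp add: add_divide_distrib add_ac mult.commute)
    then show ?case using elim \<alpha> by (simp add: divide_right_mono)
  qed
  have v_nonneg: "0 \<le> v n" for n unfolding v_def using \<alpha> by simp
  have "(\<lambda>n. (L n powr (- (2/3)) + (real k + 1) / real n) / \<alpha>) \<longlonglongrightarrow> (0 + 0) / \<alpha>"
    using \<alpha> by (intro tendsto_intros w0 kn0) auto
  then have v0: "v \<longlonglongrightarrow> 0"
    using tendsto_sandwich[OF always_eventually v_upper tendsto_const, of 0] v_nonneg by simp
  have Lv: "(\<lambda>n. L n * (d * v n)\<^sup>2) \<longlonglongrightarrow> 0"
  proof (rule tendsto_sandwich[OF _ _ tendsto_const])
    show "\<forall>\<^sub>F n in sequentially. 0 \<le> L n * (d * v n)\<^sup>2"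
      using L_gt[of 0] by eventually_elim simp
    show "\<forall>\<^sub>F n in sequentially. L n * (d * v n)\<^sup>2
        \<le> (d / \<alpha>)\<^sup>2 * (2 * (L n powr (- (1/3)) + (real k + 1)\<^sup>2 * (L n / real n * (1 / real n))))"
      using v_upper L_gt[of 0]
    proof eventually_elim
      case (elim n)
      let ?w = "L n powr (- (2/3))" and ?u = "(real k + 1) / real n"
      have "(d * v n)\<^sup>2 \<le> (d * ((?w + ?u) / \<alpha>))\<^sup>2"
        using elim v_nonneg d0 by (intro power_mono mult_left_mono mult_nonneg_nonneg) auto
      also have "\<dots> = (d / \<alpha>)\<^sup>2 * (?w + ?u)\<^sup>2"
        by (simp add: power_mult_distrib power_divide)
      also have "(?w + ?u)\<^sup>2 \<le> 2 * (?w\<^sup>2 + ?u\<^sup>2)"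
        using sum_squares_bound[of ?w ?u] by (simp add: power2_sum)
      finally have "L n * (d * v n)\<^sup>2 \<le> L n * ((d / \<alpha>)\<^sup>2 * (2 * (?w\<^sup>2 + ?u\<^sup>2)))"
        using elim by (simp add: mult_left_mono)
      also have "\<dots> = (d / \<alpha>)\<^sup>2 * (2 * (L n * ?w\<^sup>2 + L n * ?u\<^sup>2))" by (simp add: algebra_simps)
      also have "L n * ?w\<^sup>2 = L n powr (- (1/3))"
      proof -
        have "L n * ?w\<^sup>2 = L n powr 1 * (?w * ?w)" using elim by (simp add: power2_eq_square)
        also have "\<dots> = L n powr (- (1/3))" unfolding powr_add[symmetric] by simp
        finally show ?thesis .
      qed
      also have "L n * ?u\<^sup>2 = (real k + 1)\<^sup>2 * (L n / real n * (1 / real n))"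
        by (simp add: power2_eq_square)
      finally show ?case .
    qed
    have "(\<lambda>n. L n powr (- (1/3))) \<longlonglongrightarrow> 0"
      by (rule filterlim_compose[OF _ L_at_top]) real_asymp
    then have "(\<lambda>n. (d / \<alpha>)\<^sup>2 * (2 * (L n powr (- (1/3)) + (real k + 1)\<^sup>2 * (L n / real n * (1 / real n)))))
      \<longlonglongrightarrow> (d / \<alpha>)\<^sup>2 * (2 * (0 + (real k + 1)\<^sup>2 * (0 * 0)))"
      by (intro tendsto_intros L_over_n lim_1_over_n)
    then show "(\<lambda>n. (d / \<alpha>)\<^sup>2 * (2 * (L n powr (- (1/3)) + (real k + 1)\<^sup>2 * (L n / real n * (1 / real n)))))
      \<longlonglongrightarrow> 0" by simp
  qed
  have tm: "filterlim (\<lambda>n. L n / real n * real (m n)) at_top sequentially"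
  proof (rule filterlim_at_top_mono)
    have "filterlim (\<lambda>n. L n powr (1/3)) at_top sequentially"
      by (rule filterlim_compose[OF _ L_at_top]) real_asymp
    then show "filterlim (\<lambda>n. - (L n / real n) + L n powr (1/3)) at_top sequentially"
      by (rule filterlim_tendsto_add_at_top[OF tendsto_minus[OF L_over_n]])
    show "\<forall>\<^sub>F n in sequentially. - (L n / real n) + L n powr (1/3) \<le> L n / real n * real (m n)"
      using L_gt[of 0] eventually_gt_at_top[of 0]
    proof eventually_elim
      case (elim n)
      have "L n / real n * (real n * L n powr (- (2/3)) - 1) \<le> L n / real n * real (m n)"
        using elim m_lower by (intro mult_left_mono) auto
      moreover have "L n / real n * (real n * L n powr (- (2/3)) - 1) = L n powr 1 * L n powr (- (2/3)) - L n / real n"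
        using elim by (simp add: field_simps)
      moreover have "L n powr 1 * L n powr (- (2/3)) = L n powr (1/3)"
        unfolding powr_add[symmetric] by simp
      ultimately show ?case by simp
    qed
  qed
  have exp_tm: "(\<lambda>n. exp (- (c * (L n / real n * real (m n))))) \<longlonglongrightarrow> 0"
  proof -
    have "((\<lambda>x::real. exp (- (c * x))) \<longlongrightarrow> 0) at_top" using c0 by real_asymp
    then show ?thesis using tm by (rule filterlim_compose)
  qed
  have fits: "\<forall>\<^sub>F n in sequentially. \<alpha> * n + 1 + real (m n) \<le> n"
  proof -
    have "(\<lambda>n. 1 / real n + L n powr (- (2/3))) \<longlonglongrightarrow> 0 + 0"
      by (intro tendsto_add lim_1_over_n w0)
    then have "\<forall>\<^sub>F n in sequentially. 1 / real n + L n powr (- (2/3)) < 1 - \<alpha>"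
      by (rule order_tendstoD(2)) (use \<alpha> in simp)
    then show ?thesis using m_upper eventually_gt_at_top[of 0]
    proof eventually_elim
      case (elim n)
      have "1 / real n + real (m n) / real n \<le> 1 - \<alpha>" using elim by linarith
      then show ?case using elim(3) by (simp add: field_simps)
    qed
  qed
  have v_small: "\<forall>\<^sub>F n in sequentially. d * v n \<le> 1"
  proof -
    have "\<forall>\<^sub>F n in sequentially. d * v n < 1"
      by (rule order_tendstoD(2)[OF tendsto_mult_right_zero[OF v0]]) simp
    then show ?thesis by eventually_elim simp
  qed
  define lo where "lo = (\<lambda>n. exp (- ?\<epsilon> n) * (2 * (exp (- (L n * (d * v n)\<^sup>2))
      * exp (- (c * (L n / n))) ^ (k + 1) * (1 - exp (- (c * (L n / n * m n)))) * G n)))"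
  define hi where "hi = (\<lambda>n. exp (?\<epsilon> n) * (2 * G n
      + (real k + 1) * (L n * exp (- (L n * ((1 / \<alpha>) ^ (k - 1) - 1))))))"
  have lo_le: "\<forall>\<^sub>F n in sequentially. lo n \<le> mean_missing k \<alpha> n (p n) * (L n * exp (L n) / real n)"
    using fits v_small eventually_edge_regime
  proof eventually_elim
    case (elim n)
    interpret edge_regime n k "p n" \<alpha> "L n" by (rule elim)
    show ?case unfolding lo_def G_def c_def d_def
      by (rule mean_missing_scaled_lower) (use elim in \<open>auto simp: v_def d_def\<close>)
  qed
  have hi_ge: "\<forall>\<^sub>F n in sequentially. mean_missing k \<alpha> n (p n) * (L n * exp (L n) / real n) \<le> hi n"
    using eventually_edge_regime
  proof eventually_elim
    case (elim n)
    interpret edge_regime n k "p n" \<alpha> "L n" by (rule elim)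
    show ?case unfolding hi_def G_def c_def d_def by (rule mean_missing_scaled_upper)
  qed
  have "lo \<longlonglongrightarrow> exp (- 0) * (2 * (exp (- 0) * exp (- (c * 0)) ^ (k + 1) * (1 - 0) * (1 / c)))"
    unfolding lo_def by (intro tendsto_intros overlap_error_tendsto_0 Lv L_over_n exp_tm G)
  then have lo: "lo \<longlonglongrightarrow> 2 * \<alpha> / (real k - 1)" unfolding limit by simp
  have "(\<lambda>n. L n * exp (- (L n * ((1 / \<alpha>) ^ (k - 1) - 1)))) \<longlonglongrightarrow> 0"
  proof -
    have "1 < (1 / \<alpha>) ^ (k - 1)" using \<alpha> k2 by (intro one_less_power) auto
    then have "((\<lambda>x::real. x * exp (- (x * ((1 / \<alpha>) ^ (k - 1) - 1)))) \<longlongrightarrow> 0) at_top"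
      by real_asymp
    then show ?thesis using L_at_top by (rule filterlim_compose)
  qed
  then have "hi \<longlonglongrightarrow> exp 0 * (2 * (1 / c) + (real k + 1) * 0)"
    unfolding hi_def by (intro tendsto_intros overlap_error_tendsto_0 G)
  then have hi: "hi \<longlonglongrightarrow> 2 * \<alpha> / (real k - 1)" unfolding limit by simp
  show ?thesis by (rule tendsto_sandwich[OF lo_le hi_ge lo hi])
qed

text \<open>
  The event \<open>X = 0\<close> has probability \<open>exp (- \<mu>)\<close> under the Poisson law.
\<close>
lemma basis_prob_tendsto:
  assumes "(real k - 1) / real k < \<beta>" and "(\<lambda>n. exp (- mean_missing k \<alpha> n (p n))) \<longlonglongrightarrow> l"
  shows "(\<lambda>n. measure_pmf.prob (random_subset n (p n)) {S. truncated_basis k \<alpha> n S}) \<longlonglongrightarrow> l"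
proof -
  let ?P = "\<lambda>n. measure_pmf.prob (random_subset n (p n)) {S. truncated_basis k \<alpha> n S}"
  let ?tv = "\<lambda>n. tv_dist (map_pmf (num_missing k \<alpha> n) (random_subset n (p n)))
            (poisson_pmf (mean_missing k \<alpha> n (p n)))"
  have "\<forall>\<^sub>F n in sequentially. norm (?P n - exp (- mean_missing k \<alpha> n (p n))) \<le> ?tv n"
    using eventually_edge_regime
  proof eventually_elim
    case (elim n)
    interpret edge_regime n k "p n" \<alpha> "L n" by (rule elim)
    have "measure_pmf.prob (poisson_pmf (mean_missing k \<alpha> n (p n))) {0} = exp (- mean_missing k \<alpha> n (p n))"
      using mean_missing_pos[OF \<alpha>] by (simp add: measure_pmf_single)
    then show ?case unfolding prob_truncated_basis real_norm_def
      using abs_prob_diff_le_tv_dist[of _ "{0}"] by metis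
  qed
  then have "(\<lambda>n. ?P n - exp (- mean_missing k \<alpha> n (p n))) \<longlonglongrightarrow> 0"
    using poisson_approximation[OF assms(1)] by (rule Lim_null_comparison)
  from tendsto_add[OF this assms(2)] show ?thesis by simp
qed

lemma eventually_expectation:
  "\<forall>\<^sub>F n in sequentially. measure_pmf.expectation (random_subset n (p n)) (\<lambda>S. real (num_missing k \<alpha> n S))
     = mean_missing k \<alpha> n (p n)"
  using eventually_edge_regime
proof eventually_elim
  case (elim n)
  interpret edge_regime n k "p n" \<alpha> "L n" by (rule elim)
  show ?case by (rule expectation_num_missing[OF p0 p1])
qed

end

text \<open>
  Since \<open>A\<^sub>n = o(log log n)\<close>, \<open>L \<sim> log n\<close>, so \<open>\<beta> = 1\<close>. Moreover \<open>exp L = n / log n * exp (A\<^sub>n / K)\<close>,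
  so the scaling factor \<open>L exp L / n\<close> of the mean is \<open>exp (A\<^sub>n / K)\<close> asymptotically.
\<close>
lemma threshold_window:
  assumes "2 \<le> k" "0 < \<alpha>" "\<alpha> < 1" "K = fact k * fact (k - 1) / \<alpha> ^ (k - 1)"
    and A: "(\<lambda>n. \<bar>A n\<bar>) \<in> o(\<lambda>n. ln (ln (real n)))"
    and p: "\<forall>\<^sub>F n in sequentially.
           p n = root k ((K * ln (real n) - K * ln (ln (real n)) + A n) / real n ^ (k - 1))"
  shows "threshold_sequence k \<alpha> K 1 (\<lambda>n. ln (real n) - ln (ln (real n)) + A n / K) p"
    and "(\<lambda>n. mean_missing k \<alpha> n (p n) * exp (A n / K)) \<longlonglongrightarrow> 2 * \<alpha> / (real k - 1)"
proof -
  let ?L = "\<lambda>n. ln (real n) - ln (ln (real n)) + A n / K"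
  have K: "0 < K" using assms by simp
  have "(\<lambda>n. \<bar>A n\<bar> / ln (ln (real n))) \<longlonglongrightarrow> 0" using A by (rule smalloD_tendsto)
  moreover have "(\<lambda>n. ln (ln (real n)) / ln (real n)) \<longlonglongrightarrow> 0" by real_asymp
  ultimately have "(\<lambda>n. \<bar>A n\<bar> / ln (ln (real n)) * (ln (ln (real n)) / ln (real n))) \<longlonglongrightarrow> 0 * 0"
    by (rule tendsto_mult)
  moreover have "\<forall>\<^sub>F n in sequentially. \<bar>A n\<bar> / ln (ln (real n)) * (ln (ln (real n)) / ln (real n)) = norm (A n / ln (real n))"
  proof -
    have "\<forall>\<^sub>F n in sequentially. 0 < ln (ln (real n))" by real_asymp
    then show ?thesis using eventually_gt_at_top[of 1] by eventually_elim simp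
  qed
  ultimately have "(\<lambda>n. norm (A n / ln (real n))) \<longlonglongrightarrow> 0"
    by (auto intro: Lim_transform_eventually)
  then have A0: "(\<lambda>n. A n / ln (real n)) \<longlonglongrightarrow> 0" by (rule tendsto_norm_zero_cancel)
  have "(\<lambda>n. 1 - ln (ln (real n)) / ln (real n) + A n / ln (real n) * (1 / K)) \<longlonglongrightarrow> 1 - 0 + 0 * (1 / K)"
    by (intro tendsto_intros A0) real_asymp
  then have "(\<lambda>n. 1 - ln (ln (real n)) / ln (real n) + A n / ln (real n) * (1 / K)) \<longlonglongrightarrow> 1" by simp
  moreover have "\<forall>\<^sub>F n in sequentially. 1 - ln (ln (real n)) / ln (real n) + A n / ln (real n) * (1 / K) = ?L n / ln (real n)"
    using eventually_gt_at_top[of 1] by eventually_elim (simp add: add_divide_distrib diff_divide_distrib mult.commute)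
  ultimately have L: "(\<lambda>n. ?L n / ln (real n)) \<longlonglongrightarrow> 1" by (rule Lim_transform_eventually)
  have "K * ln (real n) - K * ln (ln (real n)) + A n = K * ?L n" for n
    using K by (simp add: distrib_left right_diff_distrib)
  then have p': "\<forall>\<^sub>F n in sequentially. p n = root k (K * ?L n / real n ^ (k - 1))"
    using p by simp
  show seq: "threshold_sequence k \<alpha> K 1 ?L p"
    by unfold_locales (use assms L p' in auto)
  interpret threshold_sequence k \<alpha> K 1 ?L p by (rule seq)
  have "(\<lambda>n. mean_missing k \<alpha> n (p n) * (?L n * exp (?L n) / real n) / (?L n / ln (real n)))
     \<longlonglongrightarrow> (2 * \<alpha> / (real k - 1)) / 1"
    by (intro tendsto_divide mean_asymptotics L) simp
  moreover have "\<forall>\<^sub>F n in sequentially.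
      mean_missing k \<alpha> n (p n) * (?L n * exp (?L n) / real n) / (?L n / ln (real n))
      = mean_missing k \<alpha> n (p n) * exp (A n / K)"
    using L_gt[of 0] eventually_gt_at_top[of 1]
  proof eventually_elim
    case (elim n)
    have "exp (?L n) = real n / ln (real n) * exp (A n / K)"
      using elim by (simp add: exp_add exp_diff)
    then show ?case using elim by simp
  qed
  ultimately show "(\<lambda>n. mean_missing k \<alpha> n (p n) * exp (A n / K)) \<longlonglongrightarrow> 2 * \<alpha> / (real k - 1)"
    using Lim_transform_eventually by fastforce
qed

theorem theorem10:
  fixes k :: nat and \<alpha> K :: real
  assumes "k \<ge> 2"
    and "0 < \<alpha>" and "\<alpha> < 1"
    and "K = fact k * fact (k - 1) / \<alpha> ^ (k - 1)"
  shows
    "(\<forall>(A :: nat \<Rightarrow> real) (p :: nat \<Rightarrow> real).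
        (\<lambda>n. \<bar>A n\<bar>) \<in> o(\<lambda>n. ln (ln (real n))) \<longrightarrow>
        (\<forall>\<^sub>F n in sequentially.
           p n = root k ((K * ln (real n) - K * ln (ln (real n)) + A n) / real n ^ (k - 1))) \<longrightarrow>
        (filterlim A at_bot sequentially \<longrightarrow>
           (\<lambda>n. measure_pmf.prob (random_subset n (p n)) {S. truncated_basis k \<alpha> n S})
             \<longlonglongrightarrow> 0) \<and>
        (filterlim A at_top sequentially \<longrightarrow>
           (\<lambda>n. measure_pmf.prob (random_subset n (p n)) {S. truncated_basis k \<alpha> n S})
             \<longlonglongrightarrow> 1) \<and>
        (\<forall>a::real. A \<longlonglongrightarrow> a \<longrightarrow>
           (\<lambda>n. measure_pmf.prob (random_subset n (p n)) {S. truncated_basis k \<alpha> n S})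
             \<longlonglongrightarrow> exp (- (2 * \<alpha> / (real k - 1) * exp (- a / K))))) \<and>
     (\<forall>(\<beta> :: real) (p :: nat \<Rightarrow> real).
        \<beta> > (real k - 1) / real k \<longrightarrow>
        (\<forall>\<^sub>F n in sequentially. p n = root k (\<beta> * K * ln (real n) / real n ^ (k - 1))) \<longrightarrow>
        (\<lambda>n. tv_dist
               (map_pmf (num_missing k \<alpha> n) (random_subset n (p n)))
               (poisson_pmf (measure_pmf.expectation (random_subset n (p n))
                               (\<lambda>S. real (num_missing k \<alpha> n S)))))
          \<longlonglongrightarrow> 0)"
proof (rule conjI; intro allI impI)
  fix A p :: "nat \<Rightarrow> real"
  assume A: "(\<lambda>n. \<bar>A n\<bar>) \<in> o(\<lambda>n. ln (ln (real n)))"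
    and p: "\<forall>\<^sub>F n in sequentially.
           p n = root k ((K * ln (real n) - K * ln (ln (real n)) + A n) / real n ^ (k - 1))"
  let ?\<mu> = "\<lambda>n. mean_missing k \<alpha> n (p n)" and ?c = "2 * \<alpha> / (real k - 1)"
  have scaled: "(\<lambda>n. ?\<mu> n * exp (A n / K)) \<longlonglongrightarrow> ?c"
    by (rule threshold_window(2)[OF assms A p])
  interpret threshold_sequence k \<alpha> K 1 "\<lambda>n. ln (real n) - ln (ln (real n)) + A n / K" p
    by (rule threshold_window(1)[OF assms A p])
  have c0: "0 < ?c" using \<alpha> k2 by simp
  \<comment> \<open>Undoing the scaling reduces each of the three cases to the limit of \<open>exp (- A\<^sub>n / K)\<close>.\<close>
  have \<mu>: "?\<mu> n = ?\<mu> n * exp (A n / K) * exp (- A n / K)" for n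
    by (simp add: exp_minus)
  have k: "(real k - 1) / real k < 1" using k2 by simp
  note conclude = basis_prob_tendsto[OF k]
  show "(filterlim A at_bot sequentially \<longrightarrow>
           (\<lambda>n. measure_pmf.prob (random_subset n (p n)) {S. truncated_basis k \<alpha> n S}) \<longlonglongrightarrow> 0) \<and>
        (filterlim A at_top sequentially \<longrightarrow>
           (\<lambda>n. measure_pmf.prob (random_subset n (p n)) {S. truncated_basis k \<alpha> n S}) \<longlonglongrightarrow> 1) \<and>
        (\<forall>a::real. A \<longlonglongrightarrow> a \<longrightarrow>
           (\<lambda>n. measure_pmf.prob (random_subset n (p n)) {S. truncated_basis k \<alpha> n S})
             \<longlonglongrightarrow> exp (- (2 * \<alpha> / (real k - 1) * exp (- a / K))))"
  proof (intro conjI allI impI conclude)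
    assume bot: "filterlim A at_bot sequentially"
    have "filterlim (\<lambda>x::real. exp (- x / K)) at_top at_bot" using K_pos by real_asymp
    then have "filterlim (\<lambda>n. exp (- A n / K)) at_top sequentially" using bot by (rule filterlim_compose)
    then have "filterlim (\<lambda>n. ?\<mu> n * exp (A n / K) * exp (- A n / K)) at_top sequentially"
      by (rule filterlim_tendsto_pos_mult_at_top[OF scaled c0])
    then have "filterlim ?\<mu> at_top sequentially" unfolding \<mu>[symmetric] .
    moreover have "((\<lambda>x::real. exp (- x)) \<longlongrightarrow> 0) at_top" by real_asymp
    ultimately show "(\<lambda>n. exp (- ?\<mu> n)) \<longlonglongrightarrow> 0" by (rule filterlim_compose[rotated])
  next
    assume top: "filterlim A at_top sequentially"
    have "((\<lambda>x::real. exp (- x / K)) \<longlongrightarrow> 0) at_top" using K_pos by real_asymp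
    then have "(\<lambda>n. exp (- A n / K)) \<longlonglongrightarrow> 0" using top by (rule filterlim_compose)
    from tendsto_mult[OF scaled this] have "?\<mu> \<longlonglongrightarrow> 0" unfolding \<mu>[symmetric] by simp
    from tendsto_exp[OF tendsto_minus[OF this]] show "(\<lambda>n. exp (- ?\<mu> n)) \<longlonglongrightarrow> 1" by simp
  next
    fix a assume "A \<longlonglongrightarrow> a"
    then have "(\<lambda>n. exp (- A n / K)) \<longlonglongrightarrow> exp (- a / K)"
      using K_pos by (intro tendsto_intros) auto
    from tendsto_mult[OF scaled this] have "?\<mu> \<longlonglongrightarrow> ?c * exp (- a / K)" unfolding \<mu>[symmetric] .
    from tendsto_exp[OF tendsto_minus[OF this]]
    show "(\<lambda>n. exp (- ?\<mu> n)) \<longlonglongrightarrow> exp (- (?c * exp (- a / K)))" .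
  qed
next
  fix \<beta> :: real and p :: "nat \<Rightarrow> real"
  assume large: "(real k - 1) / real k < \<beta>"
    and p: "\<forall>\<^sub>F n in sequentially. p n = root k (\<beta> * K * ln (real n) / real n ^ (k - 1))"
  have "0 \<le> (real k - 1) / real k" using assms by simp
  then have \<beta>0: "0 < \<beta>" using large by linarith
  have "\<forall>\<^sub>F n in sequentially. \<beta> = \<beta> * ln (real n) / ln (real n)"
    using eventually_gt_at_top[of 1] by eventually_elim simp
  then have L: "(\<lambda>n. \<beta> * ln (real n) / ln (real n)) \<longlonglongrightarrow> \<beta>"
    by (rule Lim_transform_eventually[OF tendsto_const])
  interpret threshold_sequence k \<alpha> K \<beta> "\<lambda>n. \<beta> * ln (real n)" p
    by unfold_locales (use assms \<beta>0 L p in \<open>auto simp: mult_ac\<close>)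
  have "\<forall>\<^sub>F n in sequentially.
      tv_dist (map_pmf (num_missing k \<alpha> n) (random_subset n (p n))) (poisson_pmf (mean_missing k \<alpha> n (p n)))
      = tv_dist (map_pmf (num_missing k \<alpha> n) (random_subset n (p n)))
               (poisson_pmf (measure_pmf.expectation (random_subset n (p n)) (\<lambda>S. real (num_missing k \<alpha> n S))))"
    using eventually_expectation by eventually_elim simp
  then show "(\<lambda>n. tv_dist (map_pmf (num_missing k \<alpha> n) (random_subset n (p n)))
               (poisson_pmf (measure_pmf.expectation (random_subset n (p n))
                               (\<lambda>S. real (num_missing k \<alpha> n S))))) \<longlonglongrightarrow> 0"
    by (rule Lim_transform_eventually[OF poisson_approximation[OF large]])
qed

end
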